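(* Let $p$ be a prime and let $X$ be a compact, connected, smooth manifold (with base point) such that its fundamental group $\pi_1(X)$ is a finite $p$-group of rank $n$. Then: (1) The number of isomorphism classes of path-connected covering spaces of $X$ that are covered by the Frattini cover is $S_{n,p}$. (2) For each integer $k$ with $0\le k\le n$, the number of isomorphism classes of path-connected covering spaces of $X$ that are covered by the Frattini cover and have join number $n-k$ is $\binom{n}{k}_p$. (3) For each integer $k$ with $0\le k\le n$, the number of isomorphism classes of path-connected covering spaces $X'$ of $X$ that are covered by the Frattini cover and such that $\pi_{X'}/\Phi(\pi_1(X))$ has rank $k$ is $\binom{n}{k}_p$.
   Context: For a prime power $q$ and integers $0\le k\le n$, the Gaussian binomial coefficient is $\binom{n}{k}_q=\frac{(q^n-1)(q^n-q)\cdots(q^n-q^{k-1})}{(q^k-1)(q^k-q)\cdots(q^k-q^{k-1})}$ if $1\le k\le n$, and $\binom{n}{0}_q=1$. Put $S_{n,q}=\sum_{k=0}^n\binom{n}{k}_q$. A finite $p$-group is a group whose order is a power of the prime $p$. The rank of a group is the smallest nonnegative integer $n$ such that the group can be generated by $n$ elements. The Frattini subgroup $\Phi(G)$ of a finite group $G$ is the intersection of all its maximal (proper) subgroups (equal to $G$ if there are none). All spaces are base-pointed and all maps (including covering maps and isomorphisms of covering spaces) are base-point preserving continuous functions. For path-connected covering spaces $p_1:C_1\to X$ and $p_2:C_2\to X$, write $C_1\succ C_2$ ("$C_1$ covers $C_2$", or "$C_2$ is covered by $C_1$") if there is a map $f:C_1\to C_2$ with $p_1=p_2\circ f$; this induces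 a partial order on isomorphism classes of path-connected covering spaces of $X$. The join $C_1\vee C_2$ is a path-connected covering space $C$ with $C\succ C_1$ and $C\succ C_2$ such that any covering space $C'$ with $C'\succ C_1$ and $C'\succ C_2$ satisfies $C'\succ C$. The fundamental theorem of covering spaces gives an order-reversing bijection between subgroups of $\pi_1(X)$ and isomorphism classes of path-connected covering spaces of $X$; $\pi_{X'}$ denotes the subgroup of $\pi_1(X)$ corresponding to the path-connected covering space $X'$, i.e. the image of $\pi_1(X')$ in $\pi_1(X)$ under the covering map. Intersections of subgroups correspond to joins. Minimal covering spaces are those corresponding to maximal subgroups of $\pi_1(X)$ (the minimal nontrivial path-connected covers). The Frattini cover is the (isomorphism class of the) cover corresponding to $\Phi(\pi_1(X))$. If a covering space $C$ is a join of minimal coverings, its join number is the smallest number of minimal coverings whose join is $C$; the trivial cover $X$ has join number $0$ (empty join). *)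

theory Defs
  imports
    "HOL-Analysis.Analysis"
    "HOL-Algebra.Generated_Groups"
    "HOL-Algebra.Coset"
    "HOL-Computational_Algebra.Primes"
begin

section \<open>Gaussian binomial coefficients\<close>

definition gauss_binomial :: "nat \<Rightarrow> nat \<Rightarrow> nat \<Rightarrow> real" where
  "gauss_binomial q n k =
     (\<Prod>i<k. real q ^ n - real q ^ i) / (\<Prod>i<k. real q ^ k - real q ^ i)"

definition gauss_sum :: "nat \<Rightarrow> nat \<Rightarrow> real" where
  "gauss_sum q n = (\<Sum>k=0..n. gauss_binomial q n k)"


section \<open>Groups\<close>

definition finite_p_group :: "nat \<Rightarrow> ('a, 'b) monoid_scheme \<Rightarrow> bool" where
  "finite_p_group p G \<longleftrightarrow> group G \<and> finite (carrier G) \<and> (\<exists>m. order G = p ^ m)"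

text \<open>Only meaningful for finitely generated groups (otherwise \<open>LEAST\<close> is unspecified).\<close>

definition group_rank :: "('a, 'b) monoid_scheme \<Rightarrow> nat" where
  "group_rank G =
     (LEAST n. \<exists>S. S \<subseteq> carrier G \<and> finite S \<and> card S = n \<and> generate G S = carrier G)"

definition maximal_subgroup :: "'a set \<Rightarrow> ('a, 'b) monoid_scheme \<Rightarrow> bool" where
  "maximal_subgroup M G \<longleftrightarrow>
     subgroup M G \<and> M \<noteq> carrier G \<and>
     (\<forall>H. subgroup H G \<and> M \<subseteq> H \<longrightarrow> H = M \<or> H = carrier G)"

definition frattini :: "('a, 'b) monoid_scheme \<Rightarrow> 'a set" where
  "frattini G = carrier G \<inter> \<Inter>{M. maximal_subgroup M G}"


section \<open>Smooth manifolds\<close>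

text \<open>
  The library's \<open>Euclidean_space d\<close> consists of the sequences vanishing from index \<open>d\<close> on;
  in contrast to the class of Euclidean spaces it includes the case \<open>d = 0\<close>.
\<close>

primrec C_k_on :: "nat \<Rightarrow> (nat \<Rightarrow> real) set \<Rightarrow> nat \<Rightarrow> ((nat \<Rightarrow> real) \<Rightarrow> real) \<Rightarrow> bool" where
  "C_k_on d W 0 f \<longleftrightarrow> continuous_map (subtopology (Euclidean_space d) W) euclideanreal f"
| "C_k_on d W (Suc k) f \<longleftrightarrow>
     continuous_map (subtopology (Euclidean_space d) W) euclideanreal f \<and>
     (\<forall>i<d. \<exists>f'. (\<forall>x\<in>W. ((\<lambda>t. f (x(i := t))) has_real_derivative f' x) (at (x i))) \<and>
                  C_k_on d W k f')"

definition smooth_real_on :: "nat \<Rightarrow> (nat \<Rightarrow> real) set \<Rightarrow> ((nat \<Rightarrow> real) \<Rightarrow> real) \<Rightarrow> bool" where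
  "smooth_real_on d W f \<longleftrightarrow> (\<forall>k. C_k_on d W k f)"

text \<open>A chart is given by its domain together with its coordinate map.\<close>

type_synonym 'a chart = "'a set \<times> ('a \<Rightarrow> nat \<Rightarrow> real)"

definition is_chart :: "nat \<Rightarrow> 'a topology \<Rightarrow> 'a chart \<Rightarrow> bool" where
  "is_chart d X = (\<lambda>(U, \<phi>). openin X U \<and> openin (Euclidean_space d) (\<phi> ` U) \<and>
     homeomorphic_map (subtopology X U) (subtopology (Euclidean_space d) (\<phi> ` U)) \<phi>)"

definition smooth_atlas :: "nat \<Rightarrow> 'a topology \<Rightarrow> 'a chart set \<Rightarrow> bool" where
  "smooth_atlas d X \<A> \<longleftrightarrow>
     (\<forall>c\<in>\<A>. is_chart d X c) \<and> (\<Union>c\<in>\<A>. fst c) = topspace X \<and>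
     (\<forall>(U, \<phi>)\<in>\<A>. \<forall>(V, \<psi>)\<in>\<A>. \<forall>j<d.
        smooth_real_on d (\<phi> ` (U \<inter> V)) (\<lambda>x. \<psi> (inv_into U \<phi> x) j))"

text \<open>
  Manifolds are without boundary. The atlas need not be maximal: it determines a unique
  smooth structure.
\<close>

definition smooth_manifold :: "nat \<Rightarrow> 'a topology \<Rightarrow> 'a chart set \<Rightarrow> bool" where
  "smooth_manifold d X \<A> \<longleftrightarrow> Hausdorff_space X \<and> second_countable X \<and> smooth_atlas d X \<A>"


section \<open>The fundamental group\<close>

definition loop_at :: "'a topology \<Rightarrow> 'a \<Rightarrow> (real \<Rightarrow> 'a) \<Rightarrow> bool" where
  "loop_at X x0 g \<longleftrightarrow> pathin X g \<and> g 0 = x0 \<and> g 1 = x0"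

definition loop_homotopic :: "'a topology \<Rightarrow> 'a \<Rightarrow> (real \<Rightarrow> 'a) \<Rightarrow> (real \<Rightarrow> 'a) \<Rightarrow> bool" where
  "loop_homotopic X x0 = homotopic_with (\<lambda>h. h 0 = x0 \<and> h 1 = x0) (top_of_set {0..1}) X"

definition loop_class :: "'a topology \<Rightarrow> 'a \<Rightarrow> (real \<Rightarrow> 'a) \<Rightarrow> (real \<Rightarrow> 'a) set" where
  "loop_class X x0 g = {h. loop_homotopic X x0 g h}"

text \<open>The same formula as the library's \<open>+++\<close>, which requires a topological type class.\<close>

definition path_concat :: "(real \<Rightarrow> 'a) \<Rightarrow> (real \<Rightarrow> 'a) \<Rightarrow> real \<Rightarrow> 'a" where
  "path_concat g h = (\<lambda>t. if t \<le> 1/2 then g (2 * t) else h (2 * t - 1))"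

definition fundamental_group :: "'a topology \<Rightarrow> 'a \<Rightarrow> (real \<Rightarrow> 'a) set monoid" where
  "fundamental_group X x0 =
     \<lparr>carrier = {loop_class X x0 g | g. loop_at X x0 g},
      mult = (\<lambda>a b. \<Union>g\<in>a. \<Union>h\<in>b. loop_class X x0 (path_concat g h)),
      one = loop_class X x0 (\<lambda>_. x0)\<rparr>"

definition induced_hom ::
  "'b topology \<Rightarrow> 'b \<Rightarrow> ('a \<Rightarrow> 'b) \<Rightarrow> (real \<Rightarrow> 'a) set \<Rightarrow> (real \<Rightarrow> 'b) set" where
  "induced_hom Y y0 f a = (\<Union>g\<in>a. loop_class Y y0 (f \<circ> g))"


section \<open>Based covering spaces\<close>

text \<open>The library's \<open>covering_space\<close>, transferred from subsets of typed spaces to abstract topologies.\<close>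

definition covering_map :: "'c topology \<Rightarrow> ('c \<Rightarrow> 'a) \<Rightarrow> 'a topology \<Rightarrow> bool" where
  "covering_map E q X \<longleftrightarrow>
     continuous_map E X q \<and> q ` topspace E = topspace X \<and>
     (\<forall>x\<in>topspace X. \<exists>U. x \<in> U \<and> openin X U \<and>
        (\<exists>\<V>. \<Union>\<V> = topspace E \<inter> q -` U \<and> (\<forall>S\<in>\<V>. openin E S) \<and> pairwise disjnt \<V> \<and>
              (\<forall>S\<in>\<V>. homeomorphic_map (subtopology E S) (subtopology X U) q)))"

record ('c, 'a) based_cover =
  total_space :: "'c topology"
  base_point :: 'c
  proj :: "'c \<Rightarrow> 'a"

definition pc_cover :: "'a topology \<Rightarrow> 'a \<Rightarrow> ('c, 'a) based_cover \<Rightarrow> bool" where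
  "pc_cover X x0 C \<longleftrightarrow>
     covering_map (total_space C) (proj C) X \<and> path_connected_space (total_space C) \<and>
     base_point C \<in> topspace (total_space C) \<and> proj C (base_point C) = x0"

definition covers :: "('c, 'a) based_cover \<Rightarrow> ('d, 'a) based_cover \<Rightarrow> bool" (infix \<open>\<succ>\<close> 50) where
  "C1 \<succ> C2 \<longleftrightarrow> (\<exists>f. continuous_map (total_space C1) (total_space C2) f \<and>
                  f (base_point C1) = base_point C2 \<and>
                  (\<forall>e\<in>topspace (total_space C1). proj C1 e = proj C2 (f e)))"

definition cover_iso :: "('c, 'a) based_cover \<Rightarrow> ('d, 'a) based_cover \<Rightarrow> bool" where
  "cover_iso C1 C2 \<longleftrightarrow> (\<exists>f. homeomorphic_map (total_space C1) (total_space C2) f \<and>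
                  f (base_point C1) = base_point C2 \<and>
                  (\<forall>e\<in>topspace (total_space C1). proj C1 e = proj C2 (f e)))"

definition trivial_cover :: "'a topology \<Rightarrow> 'a \<Rightarrow> ('a, 'a) based_cover" where
  "trivial_cover X x0 = \<lparr>total_space = X, base_point = x0, proj = (\<lambda>x. x)\<rparr>"

definition cover_subgroup ::
  "'a topology \<Rightarrow> 'a \<Rightarrow> ('c, 'a) based_cover \<Rightarrow> (real \<Rightarrow> 'a) set set" where
  "cover_subgroup X x0 C =
     induced_hom X x0 (proj C) ` carrier (fundamental_group (total_space C) (base_point C))"

definition minimal_cover :: "'a topology \<Rightarrow> 'a \<Rightarrow> ('c, 'a) based_cover \<Rightarrow> bool" where
  "minimal_cover X x0 C \<longleftrightarrow>
     pc_cover X x0 C \<and> maximal_subgroup (cover_subgroup X x0 C) (fundamental_group X x0)"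

definition frattini_cover :: "'a topology \<Rightarrow> 'a \<Rightarrow> ('c, 'a) based_cover \<Rightarrow> bool" where
  "frattini_cover X x0 C \<longleftrightarrow>
     pc_cover X x0 C \<and> cover_subgroup X x0 C = frattini (fundamental_group X x0)"

definition is_join :: "'a topology \<Rightarrow> 'a \<Rightarrow>
    ('c, 'a) based_cover \<Rightarrow> ('c, 'a) based_cover \<Rightarrow> ('c, 'a) based_cover \<Rightarrow> bool" where
  "is_join X x0 C1 C2 C \<longleftrightarrow>
     pc_cover X x0 C \<and> C \<succ> C1 \<and> C \<succ> C2 \<and>
     (\<forall>C' :: ('c, 'a) based_cover. pc_cover X x0 C' \<and> C' \<succ> C1 \<and> C' \<succ> C2 \<longrightarrow> C' \<succ> C)"

primrec is_join_list :: "'a topology \<Rightarrow> 'a \<Rightarrow>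
    ('c, 'a) based_cover list \<Rightarrow> ('c, 'a) based_cover \<Rightarrow> bool" where
  "is_join_list X x0 [] C \<longleftrightarrow> pc_cover X x0 C \<and> cover_iso C (trivial_cover X x0)"
| "is_join_list X x0 (D # Ds) C \<longleftrightarrow> (\<exists>C'. is_join_list X x0 Ds C' \<and> is_join X x0 D C' C)"

definition join_of_minimal :: "'a topology \<Rightarrow> 'a \<Rightarrow> ('c, 'a) based_cover \<Rightarrow> nat \<Rightarrow> bool" where
  "join_of_minimal X x0 C m \<longleftrightarrow>
     (\<exists>Ds. length Ds = m \<and> (\<forall>D\<in>set Ds. minimal_cover X x0 D) \<and> is_join_list X x0 Ds C)"

text \<open>A relation, since the join number is defined only for joins of minimal covers.\<close>

definition has_join_number :: "'a topology \<Rightarrow> 'a \<Rightarrow> ('c, 'a) based_cover \<Rightarrow> nat \<Rightarrow> bool" where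
  "has_join_number X x0 C m \<longleftrightarrow>
     join_of_minimal X x0 C m \<and> (\<forall>m'<m. \<not> join_of_minimal X x0 C m')"


section \<open>Counting isomorphism classes\<close>

text \<open>
  Isomorphism classes are formed on one fixed type of points, sets of paths in the base space.
  This type is large enough: by \<open>pc_cover_representable\<close> below, every path-connected cover,
  on whatever type, is isomorphic to one on this type.
\<close>

type_synonym 'a path_cover = "((real \<Rightarrow> 'a) set, 'a) based_cover"

definition cover_iso_rel :: "'a topology \<Rightarrow> 'a \<Rightarrow> ('a path_cover \<times> 'a path_cover) set" where
  "cover_iso_rel X x0 = {(C, D). pc_cover X x0 C \<and> pc_cover X x0 D \<and> cover_iso C D}"

definition num_cover_classes :: "'a topology \<Rightarrow> 'a \<Rightarrow> ('a path_cover \<Rightarrow> bool) \<Rightarrow> nat" where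
  "num_cover_classes X x0 P = card ({C. pc_cover X x0 C \<and> P C} // cover_iso_rel X x0)"

definition below_frattini :: "'a topology \<Rightarrow> 'a \<Rightarrow> 'a path_cover \<Rightarrow> bool" where
  "below_frattini X x0 C \<longleftrightarrow> (\<exists>F :: 'a path_cover. frattini_cover X x0 F \<and> F \<succ> C)"

lemma covering_map_unique_lift:
  assumes cov: "covering_map E q X"
    and g: "pathin E g" and h: "pathin E h" and 0: "g 0 = h 0"
    and eq: "\<And>t. t \<in> {0..1} \<Longrightarrow> q (g t) = q (h t)"
  shows "g 1 = h 1"
proof -
  let ?I = "top_of_set {0..1::real}"
  have cg: "continuous_map ?I E g" and ch: "continuous_map ?I E h"
    using g h by (auto simp: pathin_def)
  have inE: "g t \<in> topspace E" "h t \<in> topspace E" if "t \<in> {0..1}" for t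
    using cg ch that by (auto simp: continuous_map_def)
  have key: "\<exists>N. openin ?I N \<and> t \<in> N \<and> (\<forall>s\<in>N. (g s = h s) = (g t = h t))"
    if t: "t \<in> {0..1}" for t
  proof -
    have "q (g t) \<in> topspace X"
      using inE(1)[OF t] cov by (auto simp: covering_map_def)
    then obtain U \<V> where U: "q (g t) \<in> U"
      and V: "\<Union>\<V> = topspace E \<inter> q -` U" "\<And>S. S \<in> \<V> \<Longrightarrow> openin E S" "pairwise disjnt \<V>"
        "\<And>S. S \<in> \<V> \<Longrightarrow> homeomorphic_map (subtopology E S) (subtopology X U) q"
      using cov unfolding covering_map_def by metis
    have "g t \<in> \<Union>\<V>" "h t \<in> \<Union>\<V>"
      using V(1) U inE[OF t] eq[OF t] by auto
    then obtain S T where S: "S \<in> \<V>" "g t \<in> S" and T: "T \<in> \<V>" "h t \<in> T"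
      by blast
    have inj: "inj_on q R" if "R \<in> \<V>" for R
    proof -
      have "topspace (subtopology E R) = R"
        using V(2)[OF that] openin_subset by fastforce
      then show ?thesis
        using V(4)[OF that] unfolding homeomorphic_map_def by simp
    qed
    have ST: "S = T" if "g t = h t"
      using that S T V(3) by (auto simp: pairwise_def disjnt_iff)
    have ST': "S \<inter> T = {}" if "g t \<noteq> h t"
    proof -
      have "S \<noteq> T"
        using that inj[OF S(1)] S T eq[OF t] by (auto dest: inj_onD)
      then show ?thesis
        using V(3) S T by (auto simp: pairwise_def disjnt_def)
    qed
    let ?N = "{s \<in> topspace ?I. g s \<in> S} \<inter> {s \<in> topspace ?I. h s \<in> T}"
    have "openin ?I ?N"
      using openin_continuous_map_preimage[OF cg V(2)[OF S(1)]]
        openin_continuous_map_preimage[OF ch V(2)[OF T(1)]] by blast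
    moreover have "t \<in> ?N" using t S T by simp
    moreover have "(g s = h s) = (g t = h t)" if s: "s \<in> ?N" for s
    proof (cases "g t = h t")
      case True
      then show ?thesis
        using s ST inj[OF S(1)] eq[of s] by (auto dest: inj_onD)
    next
      case False
      then show ?thesis using s ST' by auto
    qed
    ultimately show ?thesis by blast
  qed
  define A where "A = {t \<in> {0..1::real}. g t = h t}"
  define B where "B = {t \<in> {0..1::real}. g t \<noteq> h t}"
  have sub: "N \<subseteq> {0..1}" if "openin ?I N" for N
    using openin_subset[OF that] by simp
  have oA: "openin ?I A"
  proof (subst openin_subopen, intro ballI)
    fix t assume "t \<in> A"
    then obtain N where N: "openin ?I N" "t \<in> N" "\<forall>s\<in>N. g s = h s"
      using key[of t] by (auto simp: A_def)
    then show "\<exists>N. openin ?I N \<and> t \<in> N \<and> N \<subseteq> A"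
      using N subsetD[OF sub[OF N(1)]] by (intro exI[of _ N] conjI subsetI) (auto simp: A_def)
  qed
  have oB: "openin ?I B"
  proof (subst openin_subopen, intro ballI)
    fix t assume "t \<in> B"
    then obtain N where N: "openin ?I N" "t \<in> N" "\<forall>s\<in>N. g s \<noteq> h s"
      using key[of t] by (auto simp: B_def)
    then show "\<exists>N. openin ?I N \<and> t \<in> N \<and> N \<subseteq> B"
      using N subsetD[OF sub[OF N(1)]] by (intro exI[of _ N] conjI subsetI) (auto simp: B_def)
  qed
  have "connected_space ?I"
    by (simp add: connected_space_subtopology connectedin_iff_connected)
  moreover have "topspace ?I \<subseteq> A \<union> B" "A \<inter> B = {}" "0 \<in> A"
    using 0 by (auto simp: A_def B_def)
  ultimately have "B = {}"
    using oA oB unfolding connected_space_def by (metis empty_iff)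
  then show ?thesis by (auto simp: B_def)
qed

lemma pc_cover_representable:
  fixes C :: "('c, 'a) based_cover"
  assumes C: "pc_cover X x0 C"
  shows "\<exists>D :: 'a path_cover. pc_cover X x0 D \<and> cover_iso C D"
proof -
  let ?E = "total_space C" and ?q = "proj C"
  define j where "j e = {w. \<exists>g. pathin ?E g \<and> g 0 = base_point C \<and> g 1 = e \<and>
                         (\<forall>t\<in>{0..1}. w t = ?q (g t))}" for e
  have cov: "covering_map ?E ?q X" and pc: "path_connected_space ?E"
    and b: "base_point C \<in> topspace ?E" and b0: "?q (base_point C) = x0"
    using C by (auto simp: pc_cover_def)
  have inj: "inj_on j (topspace ?E)"
  proof (rule inj_onI)
    fix e e' assume e: "e \<in> topspace ?E" "e' \<in> topspace ?E" and eq: "j e = j e'"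
    obtain g where g: "pathin ?E g" "g 0 = base_point C" "g 1 = e"
      using pc b e unfolding path_connected_space_def by blast
    then have "(\<lambda>t. ?q (g t)) \<in> j e'"
      unfolding eq[symmetric] by (auto simp: j_def)
    then obtain h where h: "pathin ?E h" "h 0 = base_point C" "h 1 = e'"
      "\<forall>t\<in>{0..1}. ?q (g t) = ?q (h t)"
      by (auto simp: j_def)
    show "e = e'"
      using covering_map_unique_lift[OF cov g(1) h(1)] g h by auto
  qed
  define k where "k = inv_into (topspace ?E) j"
  have kj: "k (j e) = e" if "e \<in> topspace ?E" for e
    using inj that by (simp add: k_def)
  define E' where "E' = pullback_topology (j ` topspace ?E) k ?E"
  define D :: "'a path_cover" where "D = \<lparr>total_space = E', base_point = j (base_point C), proj = ?q \<circ> k\<rparr>"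
  have top': "topspace E' = j ` topspace ?E"
    using kj by (auto simp: E'_def topspace_pullback_topology)
  have ck: "continuous_map E' ?E k"
    unfolding E'_def using continuous_map_pullback[of ?E ?E id] by (simp add: o_def)
  have cj: "continuous_map ?E E' j"
    unfolding E'_def
  proof (rule continuous_map_pullback')
    show "continuous_map ?E ?E (k \<circ> j)"
      by (rule continuous_map_eq[OF continuous_map_id]) (simp add: kj)
  qed auto
  have hm: "homeomorphic_maps ?E E' j k"
    using ck cj kj top' by (auto simp: homeomorphic_maps_def)
  then have hj: "homeomorphic_map ?E E' j" and hk: "homeomorphic_map E' ?E k"
    using homeomorphic_maps_map by blast+
  have iso: "cover_iso C D"
    unfolding cover_iso_def using hj kj by (auto simp: D_def)
  have pcE': "path_connected_space E'"
    using pc hj homeomorphic_path_connected_space homeomorphic_map_imp_homeomorphic_space by blast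
  have kE: "k ` topspace E' = topspace ?E"
    unfolding top' image_image using kj by simp
  have "covering_map E' (?q \<circ> k) X"
    unfolding covering_map_def
  proof (intro conjI ballI)
    show "continuous_map E' X (?q \<circ> k)"
      using cov by (intro continuous_map_compose[OF ck]) (simp add: covering_map_def)
    show "(?q \<circ> k) ` topspace E' = topspace X"
      using cov by (simp only: image_comp[symmetric] kE covering_map_def)
    fix x assume "x \<in> topspace X"
    then obtain U \<V> where U: "x \<in> U" "openin X U"
      and V: "\<Union>\<V> = topspace ?E \<inter> ?q -` U" "\<And>S. S \<in> \<V> \<Longrightarrow> openin ?E S" "pairwise disjnt \<V>"
        "\<And>S. S \<in> \<V> \<Longrightarrow> homeomorphic_map (subtopology ?E S) (subtopology X U) ?q"
      using cov unfolding covering_map_def by metis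
    have sub: "S \<subseteq> topspace ?E" if "S \<in> \<V>" for S
      using V(2)[OF that] openin_subset by blast
    let ?\<W> = "(`) j ` \<V>"
    have "\<Union>?\<W> = j ` (\<Union>\<V>)" by blast
    also have "\<dots> = topspace E' \<inter> (?q \<circ> k) -` U"
      unfolding V(1) top' using kj by auto
    finally have 1: "\<Union>?\<W> = topspace E' \<inter> (?q \<circ> k) -` U" .
    have 2: "openin E' T" if T: "T \<in> ?\<W>" for T
    proof -
      obtain S where "S \<in> \<V>" "T = j ` S" using T by blast
      then show ?thesis
        using V(2) homeomorphic_map_openness[OF hj sub] by simp
    qed
    have 3: "pairwise disjnt ?\<W>"
    proof (clarsimp simp: pairwise_def disjnt_def)
      fix S T assume ST: "S \<in> \<V>" "T \<in> \<V>" "j ` S \<noteq> j ` T"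
      then have "S \<inter> T = {}" using V(3) by (auto simp: pairwise_def disjnt_def)
      then show "j ` S \<inter> j ` T = {}"
        using inj_on_image_Int[OF inj sub[OF ST(1)] sub[OF ST(2)]] by simp
    qed
    have 4: "homeomorphic_map (subtopology E' T) (subtopology X U) (?q \<circ> k)" if T: "T \<in> ?\<W>" for T
    proof -
      obtain S where S: "S \<in> \<V>" "T = j ` S" using T by blast
      have kj': "k (j e) = e" if "e \<in> S" for e
        using kj sub[OF S(1)] that by blast
      have "topspace E' \<inter> T = j ` S" "topspace ?E \<inter> S = S"
        using S sub[OF S(1)] unfolding top' by blast+
      moreover have "k ` j ` S = S"
        unfolding image_image using kj' by simp
      ultimately have "k ` (topspace E' \<inter> T) = topspace ?E \<inter> S"
        by simp
      then have "homeomorphic_map (subtopology E' T) (subtopology ?E S) k"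
        by (rule homeomorphic_map_subtopologies[OF hk])
      then show ?thesis
        using V(4)[OF S(1)] by (rule homeomorphic_map_compose)
    qed
    show "\<exists>U. x \<in> U \<and> openin X U \<and>
        (\<exists>\<V>. \<Union>\<V> = topspace E' \<inter> (?q \<circ> k) -` U \<and> (\<forall>S\<in>\<V>. openin E' S) \<and> pairwise disjnt \<V> \<and>
              (\<forall>S\<in>\<V>. homeomorphic_map (subtopology E' S) (subtopology X U) (?q \<circ> k)))"
      by (intro exI[of _ U] conjI exI[of _ ?\<W>] ballI U 1 2 3 4)
  qed
  then have "pc_cover X x0 D"
    unfolding pc_cover_def using pcE' b b0 kj top' by (auto simp: D_def)
  with iso show ?thesis by blast
qed

end

theory Submission
  imports Defs "HOL-Algebra.Group_Action" "HOL-Algebra.Multiplicative_Group"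
begin

text \<open>
  The charts show that \<open>X\<close> is locally contractible enough for covering space theory: path lifting,
  monodromy and the space of path classes modulo a subgroup identify the isomorphism classes of
  covers with the subgroups of \<open>\<pi>\<^sub>1(X)\<close>, turning \<open>\<succ>\<close> into inclusion and joins into intersections. In a
  \<open>p\<close>-group every maximal subgroup is normal, because a \<open>p\<close>-group acting on its cosets fixes more than
  one of them, and so the Frattini quotient is elementary abelian, of order \<open>p\<^sup>n\<close> by Burnside's basis
  argument. What remains is the count of \<open>k\<close>-dimensional subspaces of an \<open>n\<close>-dimensional space over
  the field with \<open>p\<close> elements, by counting independent lists in two ways; the join number of a
  subspace is its codimension, the least number of hyperplanes meeting in it.
\<close>


section \<open>Groups with an elementary abelian quotient\<close>

text \<open>The junction of topology and algebra is \<open>num_cover_classes_eq\<close>, which turns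
  each of the three counts into the cardinality of a set of subgroups above the Frattini subgroup;
  joins and join numbers pass through it as intersections of maximal subgroups. Two choices shape
  the algebra. Dimensions appear only as exponents in \<open>card H = p ^ k * card F\<close>, so the
  lower bounds, for the rank as well as for the join number, are mere estimates of cardinalities,
  and the powers of \<open>card F\<close> cancel in the end. The group axioms of the fundamental
  group come with \<open>finite_p_group\<close>; as the group is finite, closure under products is
  all that has to be checked for normalisers, centralisers, the Frattini subgroup and the subgroups
  of covers, an inverse being a power. On the topological side, subdivision of the unit interval is
  replaced throughout by bisection (\<open>Bolzano\<close>): a property of intervals that passes to
  the union of adjacent ones and holds on all short ones holds on \<open>[0, 1]\<close>.\<close>

lemma (in group) finite_submonoid_is_subgroup:
  assumes "finite (carrier G)" "H \<subseteq> carrier G" "\<one> \<in> H" "\<And>x y. x \<in> H \<Longrightarrow> y \<in> H \<Longrightarrow> x \<otimes> y \<in> H"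
  shows "subgroup H G"
proof (rule subgroupI)
  fix a assume a: "a \<in> H"
  have pw: "a [^] n \<in> H" for n::nat
    by (induction n) (use a assms in auto)
  have "0 < order G" using assms(1) order_gt_0_iff_finite by blast
  then have "a [^] (order G - 1) \<otimes> a = \<one>"
    using pow_order_eq_1[of a] nat_pow_Suc[of a "order G - 1"] a assms(2) by auto
  then have "inv a = a [^] (order G - 1)"
    using a assms(2) by (intro inv_equality) auto
  then show "inv a \<in> H" using pw by simp
qed (use assms in auto)

text \<open>
  The quotient by \<open>F\<close> is elementary abelian. Its subspaces are represented by the subgroups of \<open>G\<close>
  containing \<open>F\<close>, so that no quotient group is needed for the counting.
\<close>

locale elementary_quotient = group G for G (structure) +
  fixes p :: nat and F :: "'a set"
  assumes finite_carrier: "finite (carrier G)"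
    and prime_p: "prime p"
    and subgroup_F: "subgroup F G"
    and commutator_in: "\<lbrakk>x \<in> carrier G; y \<in> carrier G\<rbrakk> \<Longrightarrow> x \<otimes> y \<otimes> inv x \<otimes> inv y \<in> F"
    and pow_in: "x \<in> carrier G \<Longrightarrow> x [^] p \<in> F"
begin

section \<open>Adjoining one element to a subgroup above \<open>F\<close>\<close>

lemma normal_supergroup:
  assumes H: "subgroup H G" "F \<subseteq> H"
  shows "H \<lhd> G"
proof -
  have "x \<otimes> h \<otimes> inv x \<in> H" if x: "x \<in> carrier G" and h: "h \<in> H" for x h
  proof -
    have h': "h \<in> carrier G" using subgroup.mem_carrier[OF H(1) h] .
    have "x \<otimes> h \<otimes> inv x \<otimes> inv h \<in> H" using commutator_in[OF x h'] H by blast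
    then have "x \<otimes> h \<otimes> inv x \<otimes> inv h \<otimes> h \<in> H" using subgroup.m_closed[OF H(1) _ h] by blast
    moreover have "x \<otimes> h \<otimes> inv x \<otimes> inv h \<otimes> h = x \<otimes> h \<otimes> inv x"
      using x h' by (simp add: m_assoc)
    ultimately show ?thesis by simp
  qed
  then show ?thesis using H(1) by (simp add: normal_inv_iff)
qed

lemma finite_subgroup: "subgroup H G \<Longrightarrow> finite H"
  using finite_carrier finite_subset subgroup.subset by blast

lemma subgroup_card_pos: "subgroup H G \<Longrightarrow> 0 < card H"
  using finite_subgroup subgroup.one_closed card_gt_0_iff by blast

lemma p_gt_1: "1 < p"
  using prime_p prime_gt_1_nat by blast

text \<open>Coordinates after adjoining one vector to a subspace: normality of \<open>H\<close>
  moves the powers of \<open>x\<close> to the right, and \<open>x [^] p \<in> H\<close> reduces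
  their exponents modulo \<open>p\<close>.\<close>

lemma generate_insert:
  assumes H: "subgroup H G" "F \<subseteq> H" and x: "x \<in> carrier G"
  shows "generate G (insert x H) = (\<lambda>(h, i). h \<otimes> x [^] i) ` (H \<times> {..<p})"
proof -
  have Hc: "H \<subseteq> carrier G" using H subgroup.subset by blast
  have mH: "a \<otimes> b \<in> H" if "a \<in> H" "b \<in> H" for a b
    using that subgroup.m_closed[OF H(1)] by blast
  have xp: "x [^] p \<in> H" using pow_in x H by blast
  define f where "f = (\<lambda>(h, i). h \<otimes> x [^] (i::nat))"
  let ?T = "f ` (H \<times> {..<p})"
  have red: "h \<otimes> x [^] k \<in> ?T" if h: "h \<in> H" for h and k :: nat
  proof -
    have "x [^] k = (x [^] p) [^] (k div p) \<otimes> x [^] (k mod p)"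
      using x by (simp add: nat_pow_pow nat_pow_mult)
    moreover have "(x [^] p) [^] m \<in> H" for m :: nat
      by (induction m) (use xp mH H(1) subgroup.one_closed in auto)
    then have xk: "(x [^] p) [^] (k div p) \<in> H" .
    ultimately have "h \<otimes> x [^] k = f (h \<otimes> (x [^] p) [^] (k div p), k mod p)"
      using h Hc x by (simp add: f_def m_assoc subset_iff)
    moreover have "h \<otimes> (x [^] p) [^] (k div p) \<in> H"
      using mH h xk by blast
    ultimately show ?thesis using p_gt_1 by (auto intro!: image_eqI)
  qed
  have Tc: "?T \<subseteq> carrier G" using Hc x by (auto simp: f_def)
  have HT: "H \<subseteq> ?T"
  proof
    fix h assume "h \<in> H" then show "h \<in> ?T" using red[of h 0] Hc by auto
  qed
  have xT: "x \<in> ?T" using red[of "\<one>" 1] x H(1) subgroup.one_closed by force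
  have subT: "subgroup ?T G"
  proof (rule finite_submonoid_is_subgroup[OF finite_carrier Tc])
    show "\<one> \<in> ?T" using HT H(1) subgroup.one_closed by blast
    fix a b assume "a \<in> ?T" "b \<in> ?T"
    then obtain h i h' j where a: "a = h \<otimes> x [^] (i::nat)" "h \<in> H" and b: "b = h' \<otimes> x [^] (j::nat)" "h' \<in> H"
      by (auto simp: f_def)
    have c: "h \<in> carrier G" "h' \<in> carrier G" using a b Hc by auto
    let ?y = "x [^] i"
    have y: "?y \<in> carrier G" using x by simp
    have n: "?y \<otimes> h' \<otimes> inv ?y \<in> H"
      using normal_supergroup[OF H] normal_inv_iff y b by blast
    have "a \<otimes> b = (h \<otimes> (?y \<otimes> h' \<otimes> inv ?y)) \<otimes> x [^] (i + j)"
      using c y x by (simp add: a b m_assoc nat_pow_mult[symmetric] inv_solve_left)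
    then show "a \<otimes> b \<in> ?T" using red mH[OF a(2) n] by simp
  qed
  have "generate G (insert x H) = ?T"
  proof
    show "generate G (insert x H) \<subseteq> ?T"
      using generate_subgroup_incl[OF _ subT] HT xT by blast
    have ic: "insert x H \<subseteq> carrier G" using Hc x by blast
    have "h \<otimes> x [^] i \<in> generate G (insert x H)" if "h \<in> H" for h and i::nat
    proof -
      interpret K: subgroup "generate G (insert x H)" G
        using generate_is_subgroup[OF ic] .
      have "x [^] i \<in> generate G (insert x H)"
        by (induction i) (auto intro: K.m_closed generate.incl)
      then show ?thesis using that by (auto intro: K.m_closed generate.incl)
    qed
    then show "?T \<subseteq> generate G (insert x H)" by (auto simp: f_def)
  qed
  then show ?thesis by (simp add: f_def)
qed

text \<open>The coordinates of \<open>generate_insert\<close> are unique. Two different pairs for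
  one element would put \<open>x [^] d\<close> into \<open>H\<close> for some \<open>d\<close>
  strictly between \<open>0\<close> and \<open>p\<close>, and Bezout for \<open>d\<close> and
  \<open>p\<close> would then put \<open>x\<close> itself into \<open>H\<close>.\<close>

lemma card_generate_insert:
  assumes H: "subgroup H G" "F \<subseteq> H" and x: "x \<in> carrier G" "x \<notin> H"
  shows "card (generate G (insert x H)) = p * card H"
proof -
  have Hc: "H \<subseteq> carrier G" using H subgroup.subset by blast
  have mH: "a \<otimes> b \<in> H" if "a \<in> H" "b \<in> H" for a b
    using that subgroup.m_closed[OF H(1)] by blast
  have xp: "x [^] p \<in> H" using pow_in x H by blast
  define f where "f = (\<lambda>(h, i). h \<otimes> x [^] (i::nat))"
  have nopow: False if d: "0 < d" "d < p" "x [^] (d::nat) \<in> H" for d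
  proof -
    have "coprime d p" using d prime_p
      by (metis coprime_commute nat_dvd_not_less prime_imp_coprime_nat)
    then obtain u v where uv: "u * int d + v * int p = 1"
      using bezout_int[of "int d" "int p"] by (auto simp: coprime_iff_gcd_eq_1)
    have "x = x [^] (int d * u + int p * v)"
      using uv x by (simp add: mult.commute)
    also have "\<dots> = (x [^] d) [^] u \<otimes> (x [^] p) [^] v"
      using x by (simp add: int_pow_mult int_pow_pow[symmetric] int_pow_int)
    also have "\<dots> \<in> H"
      using d xp H(1) by (intro mH subgroup_int_pow_closed)
    finally show False using x by simp
  qed
  have key: False if "h \<in> H" "h' \<in> H" "i < j" "j < p" "h \<otimes> x [^] i = h' \<otimes> x [^] (j::nat)" for h h' i j
  proof -
    have c: "h \<in> carrier G" "h' \<in> carrier G" using that Hc by auto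
    have "x [^] j = x [^] (j - i) \<otimes> x [^] i" using x that by (simp add: nat_pow_mult)
    then have "h \<otimes> x [^] i = (h' \<otimes> x [^] (j - i)) \<otimes> x [^] i" using that x c by (simp add: m_assoc)
    then have "h = h' \<otimes> x [^] (j - i)" using x c by (simp add: right_cancel)
    then have "x [^] (j - i) = inv h' \<otimes> h" using x c by (simp add: inv_solve_left)
    also have "\<dots> \<in> H" using mH[OF subgroup.m_inv_closed[OF H(1) that(2)] that(1)] .
    finally have "x [^] (j - i) \<in> H" .
    moreover have "0 < j - i" "j - i < p" using that(3,4) by auto
    ultimately show False using nopow by blast
  qed
  have "inj_on f (H \<times> {..<p})"
  proof (rule inj_onI, clarsimp simp: f_def)
    fix h i h' j assume A: "h \<in> H" "h' \<in> H" "i < p" "j < p" "h \<otimes> x [^] (i::nat) = h' \<otimes> x [^] (j::nat)"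
    have "\<not> i < j" using key[OF A(1,2) _ A(4,5)] by blast
    moreover have "\<not> j < i" using key[OF A(2,1) _ A(3) A(5)[symmetric]] by blast
    ultimately have "i = j" by simp
    moreover have "h = h'"
      using A(5) subsetD[OF Hc A(1)] subsetD[OF Hc A(2)] x by (simp add: \<open>i = j\<close>)
    ultimately show "h = h' \<and> i = j" by simp
  qed
  then have "card (f ` (H \<times> {..<p})) = card (H \<times> {..<p})" by (rule card_image)
  then show ?thesis using generate_insert[OF H x(1)] by (simp add: f_def card_cartesian_product)
qed

text \<open>Plays the part of the linear span in the quotient by \<open>F\<close>: it is the full
  preimage of the subgroup generated there by the image of \<open>S\<close>.\<close>

definition span :: "'a set \<Rightarrow> 'a set" where "span S = generate G (F \<union> S)"

lemma F_carrier: "F \<subseteq> carrier G" using subgroup_F subgroup.subset by blast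

lemma span_subgroup: "S \<subseteq> carrier G \<Longrightarrow> subgroup (span S) G"
  using F_carrier by (simp add: span_def generate_is_subgroup)

lemma F_subset_span: "F \<subseteq> span S" and subset_span: "S \<subseteq> span S"
  by (auto simp: span_def intro: generate.incl)

lemma span_least: "\<lbrakk>subgroup H G; F \<subseteq> H; S \<subseteq> H\<rbrakk> \<Longrightarrow> span S \<subseteq> H"
  by (simp add: span_def generate_subgroup_incl)

lemma span_empty: "span {} = F"
  using span_least[OF subgroup_F] F_subset_span[of "{}"] by blast

lemma span_carrier: "S \<subseteq> carrier G \<Longrightarrow> span S \<subseteq> carrier G"
  using span_subgroup subgroup.subset by blast

lemma generate_insert_span:
  assumes "S \<subseteq> carrier G" "x \<in> carrier G"
  shows "generate G (insert x (span S)) = span (insert x S)"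
proof
  have c: "insert x S \<subseteq> carrier G" "insert x (span S) \<subseteq> carrier G"
    using assms span_carrier by auto
  have "span S \<subseteq> span (insert x S)"
    using span_least[OF span_subgroup[OF c(1)] F_subset_span] subset_span[of "insert x S"] by blast
  then show "generate G (insert x (span S)) \<subseteq> span (insert x S)"
    using generate_subgroup_incl[OF _ span_subgroup[OF c(1)]] subset_span[of "insert x S"] by blast
  show "span (insert x S) \<subseteq> generate G (insert x (span S))"
    using F_subset_span[of S] subset_span[of S]
    by (intro span_least generate_is_subgroup[OF c(2)]) (auto intro: generate.incl)
qed

lemma card_span_insert:
  assumes "S \<subseteq> carrier G" "x \<in> carrier G" "x \<notin> span S"
  shows "card (span (insert x S)) = p * card (span S)"
  using card_generate_insert[OF span_subgroup F_subset_span] generate_insert_span assms by metis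

text \<open>An element multiplies the order by \<open>p\<close> or leaves it unchanged, independent
  or not. This bounds the number of generators from below in \<open>group_rank_eq\<close>.\<close>

lemma card_span_le:
  assumes "finite S" "S \<subseteq> carrier G"
  shows "card (span S) \<le> p ^ card S * card F"
  using assms
proof (induction S rule: finite_induct)
  case empty
  then show ?case by (simp add: span_empty)
next
  case (insert x S)
  have "card (span (insert x S)) \<le> p * card (span S)"
  proof (cases "x \<in> span S")
    case True
    then have "span (insert x S) \<subseteq> span S"
      using insert subset_span by (intro span_least span_subgroup F_subset_span) auto
    then have "card (span (insert x S)) \<le> card (span S)"
      using insert by (intro card_mono finite_subgroup span_subgroup) auto
    also have "\<dots> \<le> p * card (span S)" using p_gt_1 by simp
    finally show ?thesis .
  next
    case False
    then show ?thesis using card_span_insert insert by simp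
  qed
  then show ?case using insert by (simp add: mult.assoc) (meson le_trans mult_le_mono2)
qed

text \<open>Linear independence modulo \<open>F\<close>, tested from the tail of the list upwards.
  Lists rather than sets are used because ordered bases are what can be counted one choice at a
  time.\<close>

primrec independent :: "'a list \<Rightarrow> bool" where
  "independent [] \<longleftrightarrow> True"
| "independent (x # xs) \<longleftrightarrow> x \<notin> span (set xs) \<and> independent xs"

definition independent_lists :: "'a set \<Rightarrow> nat \<Rightarrow> 'a list set" where
  "independent_lists H k = {xs. length xs = k \<and> set xs \<subseteq> H \<and> independent xs}"

lemma card_span_independent:
  "\<lbrakk>independent xs; set xs \<subseteq> carrier G\<rbrakk> \<Longrightarrow> card (span (set xs)) = p ^ length xs * card F"
  by (induction xs) (auto simp: span_empty card_span_insert)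

lemma independent_distinct: "independent xs \<Longrightarrow> distinct xs"
  using subset_span by (induction xs) auto

lemma finite_independent_lists: "subgroup H G \<Longrightarrow> finite (independent_lists H k)"
  unfolding independent_lists_def
  by (rule finite_subset[OF _ finite_lists_length_eq[OF finite_subgroup, of H k]]) auto

text \<open>A tail of length \<open>i\<close> spans \<open>p ^ i * card F\<close> elements of
  \<open>H\<close>, and the next head may be anything else in \<open>H\<close>. For \<open>k\<close>
  beyond the dimension of \<open>H\<close> a factor vanishes, in accordance with the absence of such
  lists.\<close>

lemma card_independent_lists:
  assumes H: "subgroup H G" "F \<subseteq> H"
  shows "card (independent_lists H k) = (\<Prod>i<k. card H - p ^ i * card F)"
proof (induction k)
  case 0
  have "independent_lists H 0 = {[]}" by (auto simp: independent_lists_def)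
  then show ?case by simp
next
  case (Suc k)
  have Hc: "H \<subseteq> carrier G" using H subgroup.subset by blast
  let ?D = "SIGMA xs : independent_lists H k. H - span (set xs)"
  have "independent_lists H (Suc k) = (\<lambda>(xs, x). x # xs) ` ?D"
    by (fastforce simp: independent_lists_def image_iff length_Suc_conv)
  moreover have "inj_on (\<lambda>(xs, x). x # xs) ?D" by (auto simp: inj_on_def)
  ultimately have "card (independent_lists H (Suc k)) = card ?D"
    by (simp add: card_image)
  also have "\<dots> = (\<Sum>xs\<in>independent_lists H k. card (H - span (set xs)))"
    using finite_independent_lists[OF H(1)] finite_subgroup[OF H(1)] by (intro card_SigmaI) auto
  also have "\<dots> = (\<Sum>xs\<in>independent_lists H k. card H - p ^ k * card F)"
  proof (rule sum.cong[OF refl])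
    fix xs assume "xs \<in> independent_lists H k"
    then have xs: "length xs = k" "set xs \<subseteq> H" "independent xs" by (auto simp: independent_lists_def)
    have "span (set xs) \<subseteq> H" using span_least H xs by blast
    then show "card (H - span (set xs)) = card H - p ^ k * card F"
      using card_span_independent[of xs] xs Hc finite_subgroup[OF H(1)]
      by (subst card_Diff_subset) (auto intro: finite_subset)
  qed
  finally show ?case using Suc by simp
qed

text \<open>A longest independent list in \<open>H\<close> works: an element of \<open>H\<close>
  outside its span could be put in front. Lengths are bounded since independent lists are
  distinct.\<close>

lemma ex_independent_span:
  assumes H: "subgroup H G" "F \<subseteq> H"
  shows "\<exists>xs. independent xs \<and> set xs \<subseteq> H \<and> span (set xs) = H"
proof -
  have Hc: "H \<subseteq> carrier G" using H subgroup.subset by blast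
  define P where "P k \<longleftrightarrow> (\<exists>xs. independent xs \<and> set xs \<subseteq> H \<and> length xs = k)" for k
  have bound: "k \<le> card H" if Pk: "P k" for k
  proof -
    obtain xs where xs: "independent xs" "set xs \<subseteq> H" "length xs = k" using Pk by (auto simp: P_def)
    have "k = card (set xs)" using independent_distinct xs distinct_card by metis
    also have "\<dots> \<le> card H" using xs finite_subgroup[OF H(1)] by (simp add: card_mono)
    finally show ?thesis .
  qed
  have "P 0" by (auto simp: P_def)
  then obtain k where k: "P k" "\<And>j. P j \<Longrightarrow> j \<le> k"
    using bound GreatestI_nat[of P 0 "card H"] Greatest_le_nat[of P _ "card H"] by blast
  then obtain xs where xs: "independent xs" "set xs \<subseteq> H" "length xs = k" by (auto simp: P_def)
  have "H \<subseteq> span (set xs)"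
  proof (rule ccontr)
    assume "\<not> H \<subseteq> span (set xs)"
    then obtain x where "x \<in> H" "x \<notin> span (set xs)" by blast
    then have "P (Suc k)" unfolding P_def using xs by (intro exI[of _ "x # xs"]) auto
    then show False using k(2) by force
  qed
  then show ?thesis using xs span_least[OF H] by blast
qed

lemma card_supergroup:
  assumes H: "subgroup H G" "F \<subseteq> H"
  obtains k where "card H = p ^ k * card F"
proof -
  obtain xs where xs: "independent xs" "set xs \<subseteq> H" "span (set xs) = H"
    using ex_independent_span[OF H] by blast
  moreover have "set xs \<subseteq> carrier G" using xs H subgroup.subset by blast
  ultimately show ?thesis using that card_span_independent by metis
qed

section \<open>Gaussian binomials as numbers of subgroups above \<open>F\<close>\<close>

definition supergroups :: "nat \<Rightarrow> 'a set set" where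
  "supergroups k = {H. subgroup H G \<and> F \<subseteq> H \<and> card H = p ^ k * card F}"

lemma finite_subgroups: "finite {H. subgroup H G}"
proof -
  have "{H. subgroup H G} \<subseteq> Pow (carrier G)" using subgroup.subset by blast
  then show ?thesis using finite_carrier finite_subset by blast
qed

lemma finite_supergroups: "finite (supergroups k)"
  by (rule finite_subset[OF _ finite_subgroups]) (auto simp: supergroups_def)

text \<open>Double counting: an independent list of length \<open>k\<close> lies in exactly one
  member of \<open>supergroups k\<close>, namely its span, and all members contain equally many such
  lists. The quotient of the two products is the Gaussian binomial.\<close>

lemma card_supergroups:
  assumes n: "order G = p ^ n * card F" and k: "k \<le> n"
  shows "real (card (supergroups k)) = gauss_binomial p n k"
proof -
  have Fpos: "0 < card F" using subgroup_card_pos subgroup_F by blast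
  have car: "subgroup (carrier G) G" using subgroup_self .
  have part: "independent_lists (carrier G) k = (\<Union>H\<in>supergroups k. independent_lists H k)"
  proof (intro equalityI subsetI)
    fix xs assume "xs \<in> independent_lists (carrier G) k"
    then have xs: "length xs = k" "set xs \<subseteq> carrier G" "independent xs" by (auto simp: independent_lists_def)
    then have "span (set xs) \<in> supergroups k"
      using span_subgroup F_subset_span card_span_independent by (auto simp: supergroups_def)
    then show "xs \<in> (\<Union>H\<in>supergroups k. independent_lists H k)"
      using xs subset_span by (auto simp: independent_lists_def)
  next
    fix xs assume "xs \<in> (\<Union>H\<in>supergroups k. independent_lists H k)"
    then obtain H where "subgroup H G" "xs \<in> independent_lists H k" by (auto simp: supergroups_def)
    then show "xs \<in> independent_lists (carrier G) k"
      using subgroup.subset[of H G] by (auto simp: independent_lists_def)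
  qed
  have uniq: "H = span (set xs)" if "H \<in> supergroups k" "xs \<in> independent_lists H k" for H xs
  proof -
    have H: "subgroup H G" "F \<subseteq> H" "card H = p ^ k * card F" using that by (auto simp: supergroups_def)
    have xs: "length xs = k" "set xs \<subseteq> H" "independent xs" using that by (auto simp: independent_lists_def)
    have "set xs \<subseteq> carrier G" using xs H subgroup.subset by blast
    then have "card (span (set xs)) = card H" using xs H card_span_independent by simp
    then show ?thesis using card_subset_eq[OF finite_subgroup[OF H(1)] span_least[OF H(1,2) xs(2)]] by simp
  qed
  have "card (independent_lists (carrier G) k) = (\<Sum>H\<in>supergroups k. card (independent_lists H k))"
    unfolding part
  proof (intro card_UN_disjoint finite_supergroups ballI impI)
    fix H H' assume "H \<in> supergroups k" "H' \<in> supergroups k" "H \<noteq> H'"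
    then show "independent_lists H k \<inter> independent_lists H' k = {}" using uniq by blast
  qed (auto simp: finite_independent_lists supergroups_def)
  also have "\<dots> = (\<Sum>H\<in>supergroups k. \<Prod>i<k. p ^ k * card F - p ^ i * card F)"
    by (intro sum.cong refl) (simp add: supergroups_def card_independent_lists)
  finally have eq: "(\<Prod>i<k. p ^ n * card F - p ^ i * card F)
      = card (supergroups k) * (\<Prod>i<k. p ^ k * card F - p ^ i * card F)"
    using card_independent_lists[OF car F_carrier, of k] n by (simp add: order_def)
  \<comment> \<open>For \<open>k \<le> m\<close> no difference is truncated, so the product may be
    taken over the reals, where a factor \<open>card F\<close> splits off each of the
    \<open>k\<close> terms.\<close>
  have cv: "real (\<Prod>i<k. p ^ m * card F - p ^ i * card F)
      = (\<Prod>i<k. real p ^ m - real p ^ i) * real (card F) ^ k" if "k \<le> m" for m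
  proof -
    have "real (p ^ m * card F - p ^ i * card F) = (real p ^ m - real p ^ i) * real (card F)" if "i < k" for i
      using that \<open>k \<le> m\<close> p_gt_1 by (simp add: of_nat_diff left_diff_distrib power_increasing)
    then have "real (\<Prod>i<k. p ^ m * card F - p ^ i * card F)
        = (\<Prod>i<k. (real p ^ m - real p ^ i) * real (card F))"
      by (simp add: of_nat_prod)
    then show ?thesis by (simp add: prod.distrib)
  qed
  have "real p ^ k \<noteq> real p ^ i" if "i < k" for i
    using that p_gt_1 power_strict_increasing[of i k "real p"] by simp
  then have nz: "(\<Prod>i<k. real p ^ k - real p ^ i) \<noteq> 0" by simp
  have "(\<Prod>i<k. real p ^ n - real p ^ i) * real (card F) ^ k
     = (real (card (supergroups k)) * (\<Prod>i<k. real p ^ k - real p ^ i)) * real (card F) ^ k"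
    using arg_cong[OF eq, of real] by (simp only: cv[OF k] cv[OF order_refl] of_nat_mult mult.assoc)
  then have "(\<Prod>i<k. real p ^ n - real p ^ i) = real (card (supergroups k)) * (\<Prod>i<k. real p ^ k - real p ^ i)"
    using Fpos by simp
  then show ?thesis using nz by (simp only: gauss_binomial_def nonzero_eq_divide_eq[OF nz])
qed

lemma supergroup_exponent_le:
  assumes n: "order G = p ^ n * card F" and H: "H \<in> supergroups k"
  shows "k \<le> n"
proof -
  have "p ^ k * card F \<le> p ^ n * card F"
    using H n finite_carrier card_mono[of "carrier G" H] subgroup.subset
    by (auto simp: supergroups_def order_def)
  then show ?thesis using subgroup_card_pos[OF subgroup_F] p_gt_1 by simp
qed

lemma disjoint_supergroups: "H \<in> supergroups i \<Longrightarrow> H \<in> supergroups j \<Longrightarrow> i = j"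
  using subgroup_card_pos[OF subgroup_F] p_gt_1 by (auto simp: supergroups_def)

lemma card_all_supergroups:
  assumes n: "order G = p ^ n * card F"
  shows "real (card {H. subgroup H G \<and> F \<subseteq> H}) = gauss_sum p n"
proof -
  have "{H. subgroup H G \<and> F \<subseteq> H} = (\<Union>k\<in>{0..n}. supergroups k)"
  proof (intro equalityI subsetI)
    fix H assume "H \<in> {H. subgroup H G \<and> F \<subseteq> H}"
    then obtain k where "H \<in> supergroups k"
      using card_supergroup by (auto simp: supergroups_def)
    then show "H \<in> (\<Union>k\<in>{0..n}. supergroups k)" using supergroup_exponent_le[OF n] by auto
  qed (auto simp: supergroups_def)
  then have "card {H. subgroup H G \<and> F \<subseteq> H} = (\<Sum>k\<in>{0..n}. card (supergroups k))"
    using disjoint_supergroups by (auto intro!: card_UN_disjoint finite_supergroups)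
  then show ?thesis using card_supergroups[OF n] by (simp add: gauss_sum_def)
qed

text \<open>The assumption \<open>gen\<close> is the property of Burnside's theorem that generating
  modulo \<open>F\<close> is generating. A basis modulo \<open>F\<close> then generates with
  \<open>n\<close> elements, and \<open>m\<close> generators cannot span more than
  \<open>p ^ m * card F\<close> elements.\<close>

lemma group_rank_eq:
  assumes n: "order G = p ^ n * card F"
    and gen: "\<And>S. S \<subseteq> carrier G \<Longrightarrow> span S = carrier G \<Longrightarrow> generate G S = carrier G"
  shows "group_rank G = n"
  unfolding group_rank_def
proof (rule Least_equality)
  obtain xs where xs: "independent xs" "set xs \<subseteq> carrier G" "span (set xs) = carrier G"
    using ex_independent_span[OF subgroup_self F_carrier] by blast
  have "p ^ length xs * card F = p ^ n * card F"
    using card_span_independent[OF xs(1,2)] xs(3) n by (simp add: order_def)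
  then have "length xs = n" using subgroup_card_pos[OF subgroup_F] p_gt_1 by simp
  then show "\<exists>S\<subseteq>carrier G. finite S \<and> card S = n \<and> generate G S = carrier G"
    using xs gen independent_distinct[OF xs(1)] distinct_card
    by (intro exI[of _ "set xs"]) auto
next
  fix m assume "\<exists>S\<subseteq>carrier G. finite S \<and> card S = m \<and> generate G S = carrier G"
  then obtain S where S: "S \<subseteq> carrier G" "finite S" "card S = m" "generate G S = carrier G" by blast
  have "carrier G \<subseteq> span S"
    using mono_generate[of S "F \<union> S"] S unfolding span_def by blast
  then have "span S = carrier G" using span_carrier[OF S(1)] by blast
  then have "p ^ n * card F \<le> p ^ m * card F"
    using card_span_le[OF S(2,1)] S n by (simp add: order_def)
  then show "n \<le> m" using subgroup_card_pos[OF subgroup_F] p_gt_1 by simp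
qed

section \<open>Intersections of maximal subgroups and codimension\<close>

lemma card_le_Int_maximal:
  assumes M: "maximal_subgroup M G" "F \<subseteq> M" and K: "subgroup K G"
  shows "card K \<le> p * card (K \<inter> M)"
proof (cases "K \<subseteq> M")
  case True
  then show ?thesis using p_gt_1 by (simp add: inf_absorb1)
next
  case False
  then obtain x where x: "x \<in> K" "x \<notin> M" by blast
  have Ms: "subgroup M G" using M maximal_subgroup_def by blast
  have xc: "x \<in> carrier G" using subgroup.mem_carrier[OF K x(1)] .
  have ic: "insert x M \<subseteq> carrier G" using xc Ms subgroup.subset by blast
  have "subgroup (generate G (insert x M)) G" "M \<subseteq> generate G (insert x M)" "x \<in> generate G (insert x M)"
    using generate_is_subgroup[OF ic] by (auto intro: generate.incl)
  then have gen: "generate G (insert x M) = carrier G"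
    using M x unfolding maximal_subgroup_def by blast
  let ?T = "(\<lambda>(h, i). h \<otimes> x [^] i) ` ((K \<inter> M) \<times> {..<p})"
  have "K \<subseteq> ?T"
  proof
    fix y assume y: "y \<in> K"
    then have yc: "y \<in> carrier G" using subgroup.mem_carrier[OF K] by blast
    then obtain h i where hi: "h \<in> M" "i < p" "y = h \<otimes> x [^] i"
      using generate_insert[OF Ms M(2) xc] gen by auto
    have hc: "h \<in> carrier G" using subgroup.mem_carrier[OF Ms hi(1)] .
    have "x [^] i \<in> K"
      by (induction i) (use x K subgroup.one_closed subgroup.m_closed in auto)
    \<comment> \<open>Since \<open>x\<close> was taken from \<open>K\<close>, an element of
      \<open>K\<close> has its coordinate \<open>h\<close> in \<open>K\<close> too, so
      \<open>p\<close> translates of \<open>K \<inter> M\<close> cover \<open>K\<close>.\<close>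
    moreover have "h = y \<otimes> inv (x [^] i)"
      using hi hc xc by (simp add: m_assoc)
    ultimately have "h \<in> K" using y K by (simp add: subgroup.m_closed subgroup.m_inv_closed)
    then show "y \<in> ?T" using hi by auto
  qed
  moreover have fin: "finite ((K \<inter> M) \<times> {..<p})" using finite_subgroup[OF K] by simp
  ultimately have "card K \<le> card ?T" by (intro card_mono) auto
  also have "\<dots> \<le> card ((K \<inter> M) \<times> {..<p})" using fin by (rule card_image_le)
  finally show ?thesis by (simp add: card_cartesian_product mult.commute)
qed

lemma subgroup_Int_list:
  "\<forall>M\<in>set Ms. subgroup M G \<Longrightarrow> subgroup (foldr (\<inter>) Ms (carrier G)) G"
  by (induction Ms) (auto simp: subgroup_self subgroups_Inter_pair)

text \<open>Each hyperplane costs at most one factor \<open>p\<close>. This is the lower bound for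
  the join number.\<close>

lemma card_Int_list:
  assumes "\<forall>M\<in>set Ms. maximal_subgroup M G \<and> F \<subseteq> M"
  shows "order G \<le> p ^ length Ms * card (foldr (\<inter>) Ms (carrier G))"
  using assms
proof (induction Ms)
  case Nil
  then show ?case by (simp add: order_def)
next
  case (Cons M Ms)
  let ?K = "foldr (\<inter>) Ms (carrier G)"
  have "subgroup ?K G" using Cons.prems by (intro subgroup_Int_list) (auto simp: maximal_subgroup_def)
  then have "card ?K \<le> p * card (?K \<inter> M)" using card_le_Int_maximal Cons.prems by auto
  then have "p ^ length Ms * card ?K \<le> p ^ length Ms * (p * card (?K \<inter> M))" by (rule mult_le_mono2)
  moreover have "order G \<le> p ^ length Ms * card ?K" using Cons by simp
  ultimately have "order G \<le> p ^ length Ms * (p * card (?K \<inter> M))" by (rule le_trans[rotated])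
  then show ?case by (simp add: Int_commute mult.assoc mult.left_commute)
qed

text \<open>
  A subgroup \<open>M\<close> that is maximal among those above \<open>H\<close> avoiding \<open>x\<close> is a maximal subgroup: for
  \<open>y\<close> outside \<open>M\<close> the subgroup generated by \<open>M\<close> and \<open>y\<close> contains \<open>x\<close>, so by counting it is the one
  generated by \<open>M\<close> and \<open>x\<close>.
\<close>

lemma ex_maximal_avoiding:
  assumes H: "subgroup H G" "F \<subseteq> H" and x: "x \<in> carrier G" "x \<notin> H"
  obtains M where "maximal_subgroup M G" "H \<subseteq> M" "x \<notin> M"
proof -
  define A where "A = {K. subgroup K G \<and> H \<subseteq> K \<and> x \<notin> K}"
  have "finite A" unfolding A_def by (rule finite_subset[OF _ finite_subgroups]) auto
  moreover have "H \<in> A" using H x by (simp add: A_def)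
  ultimately obtain M where M: "M \<in> A" and max': "\<forall>K\<in>A. M \<subseteq> K \<longrightarrow> M = K"
    using finite_has_maximal2[of A H] by blast
  have max: "K = M" if "subgroup K G" "M \<subseteq> K" "x \<notin> K" for K
    using max' M that by (auto simp: A_def)
  have Ms: "subgroup M G" "F \<subseteq> M" "x \<notin> M" "H \<subseteq> M" using M H by (auto simp: A_def)
  have ins: "subgroup (generate G (insert y M)) G" "M \<subseteq> generate G (insert y M)" "y \<in> generate G (insert y M)"
    if "y \<in> carrier G" for y
    using that generate_is_subgroup[of "insert y M"] subgroup.subset[OF Ms(1)]
    by (auto intro: generate.incl)
  have all: "y \<in> generate G (insert x M)" if y: "y \<in> carrier G" "y \<notin> M" for y
  proof -
    let ?Y = "generate G (insert y M)" and ?X = "generate G (insert x M)"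
    have "x \<in> ?Y" using max[of ?Y] ins[OF y(1)] y by blast
    then have "?X \<subseteq> ?Y" using ins[OF y(1)] by (intro generate_subgroup_incl) auto
    moreover have "card ?X = card ?Y"
      using card_generate_insert[OF Ms(1,2)] y x Ms by simp
    ultimately show ?thesis
      using card_subset_eq finite_subgroup[OF ins(1)[OF y(1)]] ins(3)[OF y(1)] by metis
  qed
  have "maximal_subgroup M G"
    unfolding maximal_subgroup_def
  proof (intro conjI allI impI)
    fix K assume K: "subgroup K G \<and> M \<subseteq> K"
    show "K = M \<or> K = carrier G"
    proof (cases "K = M")
      case False
      then have "x \<in> K" using max[of K] K by blast
      then have "generate G (insert x M) \<subseteq> K" using K by (intro generate_subgroup_incl) auto
      then have "carrier G \<subseteq> K" using all K by blast
      then show ?thesis using K subgroup.subset by blast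
    qed simp
  qed (use Ms x in auto)
  then show ?thesis using that Ms by blast
qed

text \<open>Induction on the codimension \<open>m\<close>. Adjoining some \<open>x\<close> to
  \<open>H\<close> lowers the codimension by one, and a maximal subgroup that contains
  \<open>H\<close> but not \<open>x\<close> cuts the enlarged subgroup back to
  \<open>H\<close>.\<close>

lemma ex_maximal_Int_list:
  assumes "subgroup H G" "F \<subseteq> H" "order G = p ^ m * card H"
  shows "\<exists>Ms. length Ms = m \<and> (\<forall>M\<in>set Ms. maximal_subgroup M G) \<and> foldr (\<inter>) Ms (carrier G) = H"
  using assms
proof (induction m arbitrary: H)
  case 0
  then have "card H = card (carrier G)" by (simp add: order_def)
  then have "H = carrier G"
    using card_subset_eq[OF finite_carrier subgroup.subset[OF 0(1)]] by blast
  then show ?case by (intro exI[of _ "[]"]) simp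
next
  case (Suc m)
  have "1 < p ^ Suc m" using p_gt_1 one_less_power by blast
  then have "1 * card H < p ^ Suc m * card H"
    using subgroup_card_pos[OF Suc.prems(1)] by (simp only: mult_less_cancel2)
  then have "card H < card (carrier G)" using Suc.prems(3) by (simp add: order_def)
  then have "H \<noteq> carrier G" by auto
  then obtain x where x: "x \<in> carrier G" "x \<notin> H"
    using subgroup.subset[OF Suc.prems(1)] by blast
  let ?K = "generate G (insert x H)"
  have ic: "insert x H \<subseteq> carrier G" using x subgroup.subset[OF Suc.prems(1)] by blast
  have K: "subgroup ?K G" "H \<subseteq> ?K" "x \<in> ?K"
    using generate_is_subgroup[OF ic] by (auto intro: generate.incl)
  have cK: "card ?K = p * card H" using card_generate_insert[OF Suc.prems(1,2) x] .
  obtain Ms where Ms: "length Ms = m" "\<forall>M\<in>set Ms. maximal_subgroup M G" "foldr (\<inter>) Ms (carrier G) = ?K"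
    using Suc.IH[OF K(1)] K(2) Suc.prems(2,3) cK by (auto simp: mult.assoc mult.left_commute)
  obtain M where M: "maximal_subgroup M G" "H \<subseteq> M" "x \<notin> M"
    using ex_maximal_avoiding[OF Suc.prems(1,2) x] .
  \<comment> \<open>No subgroup lies strictly between \<open>H\<close> and \<open>?K\<close>: an
    element of \<open>M \<inter> ?K\<close> outside \<open>H\<close> would, by cardinality, generate
    \<open>?K\<close> together with \<open>H\<close>, which forces \<open>x\<close> into
    \<open>M\<close>.\<close>
  have "M \<inter> ?K \<subseteq> H"
  proof
    fix y assume y: "y \<in> M \<inter> ?K"
    show "y \<in> H"
    proof (rule ccontr)
      assume "y \<notin> H"
      have yc: "y \<in> carrier G" using subgroup.mem_carrier[OF K(1)] y by blast
      let ?Y = "generate G (insert y H)"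
      have "?Y \<subseteq> ?K" using y K by (intro generate_subgroup_incl) auto
      moreover have "card ?Y = card ?K"
        using card_generate_insert[OF Suc.prems(1,2) yc \<open>y \<notin> H\<close>] cK by simp
      ultimately have "?Y = ?K" using finite_subgroup[OF K(1)] by (simp add: card_subset_eq)
      moreover have "?Y \<subseteq> M" using y M unfolding maximal_subgroup_def by (intro generate_subgroup_incl) auto
      ultimately show False using K M by blast
    qed
  qed
  then have "M \<inter> ?K = H" using M K by blast
  then show ?case using Ms M by (intro exI[of _ "M # Ms"]) auto
qed

end


section \<open>Maximal subgroups of p-groups\<close>

text \<open>Orbit sizes are powers of \<open>p\<close>, hence divisible by \<open>p\<close> unless
  the orbit is a fixed point. With \<open>x\<close> as the only fixed point, \<open>card E\<close>
  would be congruent to \<open>1\<close> modulo \<open>p\<close>.\<close>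

lemma (in group_action) ex_other_fixed_point:
  assumes fin: "finite E" and p: "prime p" and ord: "order G = p ^ m" and dvd: "p dvd card E"
    and x: "x \<in> E" "orbit G \<phi> x = {x}"
  shows "\<exists>y\<in>E. y \<noteq> x \<and> orbit G \<phi> y = {y}"
proof (rule ccontr)
  assume none: "\<not> ?thesis"
  have fin_orb: "finite (orbits G E \<phi>)" using fin by (simp add: orbits_def)
  have x_orb: "{x} \<in> orbits G E \<phi>" using x by (force simp: orbits_def)
  have div: "p dvd card Y" if Y: "Y \<in> orbits G E \<phi>" "Y \<noteq> {x}" for Y
  proof -
    obtain y where y: "y \<in> E" "Y = orbit G \<phi> y" using Y by (auto simp: orbits_def)
    have "card Y dvd p ^ m" using orbit_stabilizer_theorem[OF y(1)] y(2) ord dvd_triv_left by metis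
    then obtain j where j: "card Y = p ^ j" using divides_primepow_nat[OF p] by auto
    have "j \<noteq> 0"
    proof
      assume "j = 0"
      then obtain z where "Y = {z}" using j card_1_singletonE by auto
      moreover have "y \<in> Y" using orbit_refl y by blast
      ultimately have "orbit G \<phi> y = {y}" using y by auto
      then show False using none y Y by auto
    qed
    then show ?thesis using j by (simp add: dvd_power)
  qed
  have "card E = (\<Sum>Y\<in>orbits G E \<phi>. card Y)"
    using disjoint_sum[OF fin, of "\<lambda>_. 1::nat"] by simp
  also have "\<dots> = 1 + (\<Sum>Y\<in>orbits G E \<phi> - {{x}}. card Y)"
    using sum.remove[OF fin_orb x_orb, of card] by simp
  finally have "card E = 1 + (\<Sum>Y\<in>orbits G E \<phi> - {{x}}. card Y)" .
  moreover have "p dvd (\<Sum>Y\<in>orbits G E \<phi> - {{x}}. card Y)"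
    using div by (intro dvd_sum) auto
  ultimately have "p dvd 1" using dvd by (metis dvd_add_left_iff)
  then show False using p by simp
qed

text \<open>Multiplication on the right reverses the order of a product; the inverse restores it and
  makes this a left action.\<close>

lemma (in group) action_on_rcosets:
  assumes M: "subgroup M G"
  shows "group_action (G\<lparr>carrier := M\<rparr>) (rcosets M) (\<lambda>m. \<lambda>C\<in>rcosets M. C #> inv m)"
proof -
  let ?E = "rcosets M" and ?\<phi> = "\<lambda>m. \<lambda>C\<in>rcosets M. C #> inv m"
  have Mc: "M \<subseteq> carrier G" using M subgroup.subset by blast
  have Ec: "C \<subseteq> carrier G" if "C \<in> ?E" for C
    using rcosets_part_G[OF M] that by blast
  have closed: "C #> g \<in> ?E" if C: "C \<in> ?E" and g: "g \<in> carrier G" for C g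
  proof -
    obtain a where a: "a \<in> carrier G" "C = M #> a" using C by (auto simp: RCOSETS_def)
    then have "C #> g = M #> (a \<otimes> g)" using coset_mult_assoc Mc g by simp
    then show ?thesis using a g Mc rcosetsI by simp
  qed
  have bij: "?\<phi> m \<in> Bij ?E" if m: "m \<in> M" for m
  proof -
    have mc: "m \<in> carrier G" using m Mc by blast
    have "bij_betw (?\<phi> m) ?E ?E"
      by (rule bij_betw_byWitness[where f' = "\<lambda>C. C #> m"])
        (use closed mc Ec in \<open>auto simp: coset_mult_assoc\<close>)
    then show ?thesis by (simp add: Bij_def)
  qed
  have "?\<phi> \<in> hom (G\<lparr>carrier := M\<rparr>) (BijGroup ?E)"
  proof (rule homI)
    fix m m' assume "m \<in> carrier (G\<lparr>carrier := M\<rparr>)" "m' \<in> carrier (G\<lparr>carrier := M\<rparr>)"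
    then have m: "m \<in> M" "m' \<in> M" by auto
    then have mc: "m \<in> carrier G" "m' \<in> carrier G" using Mc by auto
    have "?\<phi> (m \<otimes> m') C = compose ?E (?\<phi> m) (?\<phi> m') C" for C
      using closed mc Ec by (auto simp: compose_def coset_mult_assoc inv_mult_group)
    then show "?\<phi> (m \<otimes>\<^bsub>G\<lparr>carrier := M\<rparr>\<^esub> m') = ?\<phi> m \<otimes>\<^bsub>BijGroup ?E\<^esub> ?\<phi> m'"
      using bij[OF m(1)] bij[OF m(2)] by (auto simp: BijGroup_def)
  qed (use bij in \<open>auto simp: BijGroup_def\<close>)
  then show ?thesis
    unfolding group_action_def group_hom_def group_hom_axioms_def
    using subgroup_imp_group[OF M] group_BijGroup by blast
qed

locale p_group = group G for G (structure) +
  fixes p m :: nat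
  assumes fin: "finite (carrier G)" and p: "prime p" and ord: "order G = p ^ m"
begin

text \<open>
  By the fixed point lemma, \<open>M\<close> acting on its cosets fixes a coset other than \<open>M\<close> itself, whose
  elements normalise \<open>M\<close>.
\<close>

lemma maximal_subgroup_normal:
  assumes M: "maximal_subgroup M G"
  shows "M \<lhd> G"
proof -
  have Ms: "subgroup M G" and Mne: "M \<noteq> carrier G" using M by (auto simp: maximal_subgroup_def)
  have Mc: "M \<subseteq> carrier G" using Ms subgroup.subset by blast
  let ?P = "G\<lparr>carrier := M\<rparr>"
  let ?\<phi> = "\<lambda>m. \<lambda>C\<in>rcosets M. C #> inv m"
  interpret A: group_action ?P "rcosets M" ?\<phi> by (rule action_on_rcosets[OF Ms])
  have lag: "card (rcosets M) * card M = p ^ m" using lagrange[OF Ms] ord by simp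
  obtain i where i: "card M = p ^ i"
    using lag divides_primepow_nat[OF p] by (metis dvd_triv_right)
  obtain j where j: "card (rcosets M) = p ^ j"
    using lag divides_primepow_nat[OF p] by (metis dvd_triv_left)
  have "j \<noteq> 0"
  proof
    assume "j = 0"
    then have "card M = card (carrier G)" using lag j ord by (simp add: order_def)
    then show False using card_subset_eq[OF fin Mc] Mne by simp
  qed
  then have dvd: "p dvd card (rcosets M)" using j by (simp add: dvd_power)
  have finE: "finite (rcosets M)" using fin by (simp add: RCOSETS_def)
  have ME: "M \<in> rcosets M" by (rule subgroup.subgroup_in_rcosets[OF Ms is_group])
  have orbM: "orbit ?P ?\<phi> M = {M}"
  proof -
    have "M #> inv a = M" if "a \<in> M" for a
      using that Ms by (simp add: coset_join2 subgroup.m_inv_closed subsetD[OF Mc])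
    then show ?thesis using ME subgroup.one_closed[OF Ms] by (auto simp: orbit_def)
  qed
  obtain C where C: "C \<in> rcosets M" "C \<noteq> M" "orbit ?P ?\<phi> C = {C}"
    using A.ex_other_fixed_point[OF finE p _ dvd ME orbM, of i] i by (auto simp: order_def)
  obtain a where a: "a \<in> carrier G" "C = M #> a" using C by (auto simp: RCOSETS_def)
  have anM: "a \<notin> M" using C a coset_join2[OF a(1) Ms] by blast
  have fixC: "C #> inv b = C" if "b \<in> M" for b
  proof -
    have "?\<phi> b C \<in> orbit ?P ?\<phi> C" using that by (auto simp: orbit_def)
    then show ?thesis using C by auto
  qed
  \<comment> \<open>The normaliser of \<open>M\<close>, with one inclusion instead of an equality,
    which finiteness allows. Maximality of \<open>M\<close> leaves only \<open>M\<close> and the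
    whole group, and \<open>a\<close> excludes \<open>M\<close>.\<close>
  define K where "K = {g \<in> carrier G. \<forall>b\<in>M. g \<otimes> b \<otimes> inv g \<in> M}"
  have "subgroup K G"
  proof (rule finite_submonoid_is_subgroup[OF fin])
    show "\<one> \<in> K" using Mc by (auto simp: K_def)
    fix g h assume gh: "g \<in> K" "h \<in> K"
    have "g \<otimes> h \<otimes> b \<otimes> inv (g \<otimes> h) \<in> M" if b: "b \<in> M" for b
    proof -
      have "g \<otimes> (h \<otimes> b \<otimes> inv h) \<otimes> inv g \<in> M" using gh b by (auto simp: K_def)
      moreover have "g \<otimes> (h \<otimes> b \<otimes> inv h) \<otimes> inv g = g \<otimes> h \<otimes> b \<otimes> inv (g \<otimes> h)"
        using gh b Mc by (auto simp: K_def inv_mult_group m_assoc subset_iff)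
      ultimately show ?thesis by simp
    qed
    then show "g \<otimes> h \<in> K" using gh by (auto simp: K_def)
  qed (auto simp: K_def)
  moreover have "M \<subseteq> K"
    using Mc subgroup.m_closed[OF Ms] subgroup.m_inv_closed[OF Ms] by (auto simp: K_def)
  moreover have "a \<in> K"
  proof -
    have "a \<otimes> b \<otimes> inv a \<in> M" if b: "b \<in> M" for b
    proof -
      have bc: "b \<in> carrier G" using b Mc by blast
      \<comment> \<open>That right multiplication by \<open>b\<close> fixes the coset of
        \<open>a\<close> means exactly that conjugation by \<open>a\<close> sends \<open>b\<close>
        into \<open>M\<close>.\<close>
      have "M #> (a \<otimes> b) = M #> a"
        using fixC[of "inv b"] subgroup.m_inv_closed[OF Ms b] a bc Mc
        by (simp add: coset_mult_assoc)
      moreover have "a \<otimes> b \<in> M #> (a \<otimes> b)" using rcos_self[OF _ Ms] a bc by simp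
      ultimately obtain c where c: "c \<in> M" "a \<otimes> b = c \<otimes> a" by (auto simp: r_coset_def)
      have "a \<otimes> b \<otimes> inv a = c" using c a subsetD[OF Mc c(1)] by (simp add: m_assoc)
      then show ?thesis using c by simp
    qed
    then show ?thesis using a by (simp add: K_def)
  qed
  ultimately have "K = carrier G" using M anM unfolding maximal_subgroup_def by blast
  then show ?thesis using Ms by (auto simp: normal_inv_iff K_def)
qed

text \<open>By maximality, a subgroup of \<open>G\<close> that contains \<open>M\<close> and one
  element outside it is everything. Applied to the elements commuting with \<open>b\<close> modulo
  \<open>M\<close>, this makes the quotient commutative; then the elements whose \<open>p\<close>-th
  power dies modulo \<open>M\<close> form a subgroup as well, and the same argument applies to
  it.\<close>

lemma
  assumes M: "maximal_subgroup M G" and x: "x \<in> carrier G"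
  shows maximal_commutator_in: "y \<in> carrier G \<Longrightarrow> x \<otimes> y \<otimes> inv x \<otimes> inv y \<in> M"
    and maximal_pow_in: "x [^] p \<in> M"
proof -
  have Ms: "subgroup M G" and Mmax: "\<And>K. subgroup K G \<Longrightarrow> M \<subseteq> K \<Longrightarrow> K = M \<or> K = carrier G"
    using M by (auto simp: maximal_subgroup_def)
  have Mc: "M \<subseteq> carrier G" using Ms subgroup.subset by blast
  interpret N: normal M G by (rule maximal_subgroup_normal[OF M])
  interpret Q: group "G Mod M" by (rule N.factorgroup_is_group)
  define \<pi> where "\<pi> = (\<lambda>a. M #> a)"
  interpret \<pi>: group_hom G "G Mod M" \<pi>
    unfolding group_hom_def group_hom_axioms_def \<pi>_def using N.r_coset_hom_Mod Q.is_group is_group by blast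
  \<comment> \<open>Keeps the operations of the quotient abstract, so that the group laws of
    \<open>Q\<close> apply instead of coset arithmetic.\<close>
  note [simp del] = mult_FactGroup one_FactGroup
  have ker: "\<pi> a = \<one>\<^bsub>G Mod M\<^esub> \<longleftrightarrow> a \<in> M" if "a \<in> carrier G" for a
    using coset_join1[OF _ that Ms] coset_join2[OF that Ms] by (auto simp: \<pi>_def one_FactGroup)
  have ker_in: "\<pi> a = \<one>\<^bsub>G Mod M\<^esub>" if "a \<in> M" for a
    using ker that Mc by blast
  have comm: "\<pi> a \<otimes>\<^bsub>G Mod M\<^esub> \<pi> b = \<pi> b \<otimes>\<^bsub>G Mod M\<^esub> \<pi> a" if ab: "a \<in> carrier G" "b \<in> carrier G" for a b
  proof (cases "b \<in> M")
    case True
    then show ?thesis using ab by (simp add: ker_in)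
  next
    case False
    define K where "K = {g \<in> carrier G. \<pi> g \<otimes>\<^bsub>G Mod M\<^esub> \<pi> b = \<pi> b \<otimes>\<^bsub>G Mod M\<^esub> \<pi> g}"
    have "subgroup K G"
    proof (rule finite_submonoid_is_subgroup[OF fin])
      show "\<one> \<in> K" using ab by (simp add: K_def)
      fix g h assume "g \<in> K" "h \<in> K"
      then have g: "g \<in> carrier G" "h \<in> carrier G"
        and e: "\<pi> g \<otimes>\<^bsub>G Mod M\<^esub> \<pi> b = \<pi> b \<otimes>\<^bsub>G Mod M\<^esub> \<pi> g" "\<pi> h \<otimes>\<^bsub>G Mod M\<^esub> \<pi> b = \<pi> b \<otimes>\<^bsub>G Mod M\<^esub> \<pi> h"
        by (auto simp: K_def)
      have c: "\<pi> g \<in> carrier (G Mod M)" "\<pi> h \<in> carrier (G Mod M)" "\<pi> b \<in> carrier (G Mod M)"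
        using g ab by auto
      have "\<pi> (g \<otimes> h) \<otimes>\<^bsub>G Mod M\<^esub> \<pi> b = \<pi> g \<otimes>\<^bsub>G Mod M\<^esub> (\<pi> h \<otimes>\<^bsub>G Mod M\<^esub> \<pi> b)"
        using g c by (simp add: Q.m_assoc)
      also have "\<dots> = (\<pi> g \<otimes>\<^bsub>G Mod M\<^esub> \<pi> b) \<otimes>\<^bsub>G Mod M\<^esub> \<pi> h"
        unfolding e(2) using c by (simp add: Q.m_assoc)
      also have "\<dots> = \<pi> b \<otimes>\<^bsub>G Mod M\<^esub> \<pi> (g \<otimes> h)"
        unfolding e(1) using g c by (simp add: Q.m_assoc)
      finally show "g \<otimes> h \<in> K" using g by (simp add: K_def)
    qed (auto simp: K_def)
    moreover have "M \<subseteq> K" using Mc ab by (auto simp: K_def ker_in)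
    moreover have "b \<in> K" using ab by (simp add: K_def)
    ultimately have "K = carrier G" using Mmax False by blast
    then show ?thesis using ab by (auto simp: K_def)
  qed
  show "x \<otimes> y \<otimes> inv x \<otimes> inv y \<in> M" if y: "y \<in> carrier G"
  proof -
    have c: "\<pi> x \<in> carrier (G Mod M)" "\<pi> y \<in> carrier (G Mod M)" using x y by auto
    have "\<pi> (x \<otimes> y \<otimes> inv x \<otimes> inv y) = (\<pi> x \<otimes>\<^bsub>G Mod M\<^esub> \<pi> y) \<otimes>\<^bsub>G Mod M\<^esub> inv\<^bsub>G Mod M\<^esub> \<pi> x \<otimes>\<^bsub>G Mod M\<^esub> inv\<^bsub>G Mod M\<^esub> \<pi> y"
      using x y by simp
    also have "\<dots> = \<one>\<^bsub>G Mod M\<^esub>"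
      unfolding comm[OF x y] using c by (simp add: Q.m_assoc)
    finally show ?thesis by (rule iffD1[OF ker, rotated]) (use x y in simp)
  qed
  show "x [^] p \<in> M"
  proof (cases "x \<in> M")
    case True
    have "x [^] k \<in> M" for k :: nat
      by (induction k) (use True Ms in \<open>auto simp: subgroup.one_closed subgroup.m_closed\<close>)
    then show ?thesis .
  next
    case False
    \<comment> \<open>Yields an element outside \<open>M\<close> with \<open>p\<close>-th power in
      \<open>M\<close>: the iterated \<open>p\<close>-th power of \<open>x\<close> just before the
      first one in \<open>M\<close>. There is one before it since \<open>x\<close> itself, at
      exponent \<open>p ^ 0\<close>, is outside.\<close>
    define i where "i = (LEAST i. x [^] (p ^ i) \<in> M)"
    have "x [^] (p ^ m) \<in> M" using pow_order_eq_1[OF x] ord subgroup.one_closed[OF Ms] by simp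
    then have i: "x [^] (p ^ i) \<in> M" unfolding i_def by (rule LeastI)
    have "i \<noteq> 0" using i False x by (cases "i = 0") auto
    then obtain i' where i': "i = Suc i'" using not0_implies_Suc by blast
    define z where "z = x [^] (p ^ i')"
    have z: "z \<in> carrier G" "z \<notin> M"
      using x not_less_Least[of i' "\<lambda>i. x [^] (p ^ i) \<in> M"] i' by (auto simp: z_def i_def)
    have zp: "z [^] p \<in> M" using i i' x by (simp add: z_def nat_pow_pow mult.commute)
    define K where "K = {g \<in> carrier G. \<pi> g [^]\<^bsub>G Mod M\<^esub> p = \<one>\<^bsub>G Mod M\<^esub>}"
    have "subgroup K G"
    proof (rule finite_submonoid_is_subgroup[OF fin])
      show "\<one> \<in> K" by (simp add: K_def)
      fix g h assume "g \<in> K" "h \<in> K"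
      then show "g \<otimes> h \<in> K" using comm[of g h] by (auto simp: K_def Q.pow_mult_distrib)
    qed (auto simp: K_def)
    moreover have "M \<subseteq> K" using Mc by (auto simp: K_def ker_in)
    moreover have "z \<in> K" using z zp ker_in[OF zp] by (simp add: K_def \<pi>.hom_nat_pow)
    ultimately have "K = carrier G" using Mmax z by blast
    then have "\<pi> (x [^] p) = \<one>\<^bsub>G Mod M\<^esub>" using x by (auto simp: K_def \<pi>.hom_nat_pow)
    then show ?thesis by (rule iffD1[OF ker, rotated]) (use x in simp)
  qed
qed

lemma elementary_quotient_frattini: "elementary_quotient G p (frattini G)"
proof (intro elementary_quotient.intro elementary_quotient_axioms.intro)
  show "subgroup (frattini G) G"
  proof (rule finite_submonoid_is_subgroup[OF fin])
    show "\<one> \<in> frattini G"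
      by (auto simp: frattini_def maximal_subgroup_def subgroup.one_closed)
    show "x \<otimes> y \<in> frattini G" if "x \<in> frattini G" "y \<in> frattini G" for x y
      using that by (auto simp: frattini_def maximal_subgroup_def subgroup.m_closed)
  qed (auto simp: frattini_def)
qed (auto simp: frattini_def fin p is_group maximal_commutator_in maximal_pow_in)

sublocale elementary_quotient G p "frattini G" by (rule elementary_quotient_frattini)

lemma frattini_subset_maximal: "maximal_subgroup M G \<Longrightarrow> frattini G \<subseteq> M"
  by (auto simp: frattini_def)

lemma ex_maximal_supergroup:
  assumes "subgroup H G" "H \<noteq> carrier G"
  shows "\<exists>M. maximal_subgroup M G \<and> H \<subseteq> M"
proof -
  define A where "A = {K. subgroup K G \<and> K \<noteq> carrier G}"
  have "finite A" unfolding A_def by (rule finite_subset[OF _ finite_subgroups]) auto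
  moreover have "H \<in> A" using assms by (simp add: A_def)
  ultimately obtain M where M: "M \<in> A" "H \<subseteq> M" and max: "\<forall>K\<in>A. M \<subseteq> K \<longrightarrow> M = K"
    using finite_has_maximal2[of A H] by blast
  have "maximal_subgroup M G" unfolding maximal_subgroup_def using M max by (auto simp: A_def)
  then show ?thesis using M by blast
qed

text \<open>Elements of the Frattini subgroup are non-generators: a proper subgroup generated by
  \<open>S\<close> lies in a maximal one, which contains the Frattini subgroup and hence all of
  \<open>span S\<close>.\<close>

lemma generate_eq_if_span_eq:
  assumes S: "S \<subseteq> carrier G" "span S = carrier G"
  shows "generate G S = carrier G"
proof (rule ccontr)
  assume "generate G S \<noteq> carrier G"
  then obtain M where M: "maximal_subgroup M G" "generate G S \<subseteq> M"
    using ex_maximal_supergroup generate_is_subgroup[OF S(1)] by blast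
  have "S \<subseteq> M" using M by (auto intro: generate.incl)
  then have "span S \<subseteq> M"
    using M frattini_subset_maximal by (intro span_least) (auto simp: maximal_subgroup_def)
  moreover have Ms: "subgroup M G" using M(1) by (simp add: maximal_subgroup_def)
  ultimately have "M = carrier G" using S(2) subgroup.subset[OF Ms] by blast
  then show False using M by (simp add: maximal_subgroup_def)
qed

text \<open>The exponent delivered by \<open>card_supergroup\<close> is the dimension of the
  Frattini quotient; Burnside's property identifies it with the rank of \<open>G\<close>.\<close>

lemma order_eq: "order G = p ^ group_rank G * card (frattini G)"
proof -
  obtain n where n: "order G = p ^ n * card (frattini G)"
    using card_supergroup[OF subgroup_self F_carrier] by (auto simp: order_def)
  then show ?thesis using group_rank_eq[OF n generate_eq_if_span_eq] by simp
qed

end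

text \<open>The quotient of \<open>H\<close> by \<open>F\<close> is itself an elementary quotient
  over its trivial subgroup. Generating modulo the trivial subgroup is plain generating, so
  \<open>group_rank_eq\<close> applies to it.\<close>

lemma (in elementary_quotient) group_rank_quotient:
  assumes H: "subgroup H G" "F \<subseteq> H" and k: "card H = p ^ k * card F"
  shows "group_rank (G\<lparr>carrier := H\<rparr> Mod F) = k"
proof -
  let ?K = "G\<lparr>carrier := H\<rparr>" and ?Q = "G\<lparr>carrier := H\<rparr> Mod F"
  have Hc: "H \<subseteq> carrier G" using H subgroup.subset by blast
  interpret K: group ?K by (rule subgroup_imp_group[OF H(1)])
  have sub: "subgroup F ?K" using subgroup_incl[OF subgroup_F H(1,2)] .
  have invK: "inv\<^bsub>?K\<^esub> x = inv x" if "x \<in> H" for x using m_inv_consistent[OF H(1) that] .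
  interpret N: normal F ?K
  proof -
    have "x \<otimes> h \<otimes> inv x \<in> F" if "x \<in> H" "h \<in> F" for x h
      using normal_supergroup[OF subgroup_F] that Hc by (auto simp: normal_inv_iff)
    then show "normal F ?K" using sub invK by (auto simp: K.normal_inv_iff)
  qed
  interpret Q: group ?Q by (rule N.factorgroup_is_group)
  define \<pi> where "\<pi> = (\<lambda>a. F #>\<^bsub>?K\<^esub> a)"
  interpret \<pi>: group_hom ?K ?Q \<pi>
    unfolding group_hom_def group_hom_axioms_def \<pi>_def using N.r_coset_hom_Mod Q.is_group K.is_group by blast
  note [simp del] = mult_FactGroup one_FactGroup
  have ker: "\<pi> a = \<one>\<^bsub>?Q\<^esub>" if "a \<in> F" for a
    using K.coset_join2[OF _ sub that] that H by (auto simp: \<pi>_def one_FactGroup)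
  have carQ: "carrier ?Q = \<pi> ` H" by (auto simp: \<pi>_def FactGroup_def RCOSETS_def)
  have finQ: "finite (carrier ?Q)" using finite_subgroup[OF H(1)] by (simp add: carQ)
  have powK: "x [^]\<^bsub>?K\<^esub> (i::nat) = x [^] i" for x i by (simp add: nat_pow_def)
  interpret E: elementary_quotient ?Q p "{\<one>\<^bsub>?Q\<^esub>}"
  proof (intro elementary_quotient.intro elementary_quotient_axioms.intro)
    fix X Y assume "X \<in> carrier ?Q" "Y \<in> carrier ?Q"
    then obtain x y where xy: "x \<in> H" "y \<in> H" "X = \<pi> x" "Y = \<pi> y" by (auto simp: carQ)
    have "X \<otimes>\<^bsub>?Q\<^esub> Y \<otimes>\<^bsub>?Q\<^esub> inv\<^bsub>?Q\<^esub> X \<otimes>\<^bsub>?Q\<^esub> inv\<^bsub>?Q\<^esub> Y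
        = \<pi> (x \<otimes>\<^bsub>?K\<^esub> y \<otimes>\<^bsub>?K\<^esub> inv\<^bsub>?K\<^esub> x \<otimes>\<^bsub>?K\<^esub> inv\<^bsub>?K\<^esub> y)"
    proof -
      have c: "x \<in> carrier ?K" "y \<in> carrier ?K" using xy by auto
      show ?thesis unfolding xy(3,4)
        using c K.m_closed K.inv_closed \<pi>.hom_mult \<pi>.hom_inv by presburger
    qed
    also have "\<dots> = \<one>\<^bsub>?Q\<^esub>"
      using xy Hc by (intro ker) (auto simp: invK subset_iff intro!: commutator_in)
    finally show "X \<otimes>\<^bsub>?Q\<^esub> Y \<otimes>\<^bsub>?Q\<^esub> inv\<^bsub>?Q\<^esub> X \<otimes>\<^bsub>?Q\<^esub> inv\<^bsub>?Q\<^esub> Y \<in> {\<one>\<^bsub>?Q\<^esub>}" by simp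
  next
    fix X assume "X \<in> carrier ?Q"
    then obtain x where x: "x \<in> H" "X = \<pi> x" by (auto simp: carQ)
    have "X [^]\<^bsub>?Q\<^esub> p = \<pi> (x [^]\<^bsub>?K\<^esub> p)" using x by (simp add: \<pi>.hom_nat_pow)
    also have "\<dots> = \<one>\<^bsub>?Q\<^esub>" unfolding powK using x Hc by (intro ker pow_in) auto
    finally show "X [^]\<^bsub>?Q\<^esub> p \<in> {\<one>\<^bsub>?Q\<^esub>}" by simp
  qed (use finQ prime_p Q.triv_subgroup Q.is_group in auto)
  have "card (rcosets\<^bsub>?K\<^esub> F) * card F = card H"
    using K.lagrange[OF sub] by (simp add: order_def)
  then have "order ?Q = p ^ k * card {\<one>\<^bsub>?Q\<^esub>}"
    using k subgroup_card_pos[OF subgroup_F] by (simp add: order_def FactGroup_def)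
  then show ?thesis
  proof (rule E.group_rank_eq)
    fix S assume S: "S \<subseteq> carrier ?Q" "E.span S = carrier ?Q"
    have "E.span S \<subseteq> generate ?Q S"
      using S by (intro E.span_least Q.generate_is_subgroup) (auto intro: generate.incl generate.one)
    then show "generate ?Q S = carrier ?Q"
      using S Q.generate_incl[OF S(1)] by blast
  qed
qed

text \<open>The group-theoretic mirror of \<open>join_of_minimal\<close>. The empty list gives the
  whole group, as the empty join gives the trivial cover.\<close>

definition Int_of_maximals :: "('a, 'b) monoid_scheme \<Rightarrow> 'a set \<Rightarrow> nat \<Rightarrow> bool" where
  "Int_of_maximals G H m \<longleftrightarrow>
     (\<exists>Ms. length Ms = m \<and> (\<forall>M\<in>set Ms. maximal_subgroup M G) \<and> foldr (\<inter>) Ms (carrier G) = H)"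

context p_group
begin

text \<open>The codimension is attained by \<open>ex_maximal_Int_list\<close>, and
  \<open>card_Int_list\<close> shows that fewer maximal subgroups leave too large an
  intersection.\<close>

lemma Int_number_iff:
  assumes H: "H \<in> supergroups k"
  shows "Int_of_maximals G H j \<and> (\<forall>i<j. \<not> Int_of_maximals G H i) \<longleftrightarrow> j = group_rank G - k"
proof -
  have H': "subgroup H G" "frattini G \<subseteq> H" and cH: "card H = p ^ k * card (frattini G)"
    using H by (auto simp: supergroups_def)
  have Fpos: "0 < card (frattini G)" using subgroup_card_pos subgroup_F by blast
  have kn: "k \<le> group_rank G" using supergroup_exponent_le[OF order_eq H] .
  have "order G = p ^ (group_rank G - k) * card H"
    using order_eq kn cH by (simp add: power_add[symmetric] mult.assoc[symmetric])
  then have ex: "Int_of_maximals G H (group_rank G - k)"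
    using ex_maximal_Int_list[OF H'] unfolding Int_of_maximals_def by blast
  have min: "group_rank G - k \<le> i" if i: "Int_of_maximals G H i" for i
  proof -
    obtain Ms where Ms: "length Ms = i" "\<forall>M\<in>set Ms. maximal_subgroup M G" "foldr (\<inter>) Ms (carrier G) = H"
      using i unfolding Int_of_maximals_def by blast
    have "order G \<le> p ^ i * card H"
      using card_Int_list[of Ms] Ms frattini_subset_maximal by blast
    then have "p ^ group_rank G * card (frattini G) \<le> p ^ (i + k) * card (frattini G)"
      using cH order_eq by (simp add: power_add mult.assoc)
    then have "group_rank G \<le> i + k" using Fpos p_gt_1 by simp
    then show ?thesis by simp
  qed
  show ?thesis using ex min by (metis linorder_neqE_nat not_less)
qed

lemma supergroups_group_rank_eq:
  "{H. subgroup H G \<and> frattini G \<subseteq> H \<and> group_rank (G\<lparr>carrier := H\<rparr> Mod frattini G) = k} = supergroups k"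
proof (intro equalityI subsetI)
  fix H assume "H \<in> {H. subgroup H G \<and> frattini G \<subseteq> H \<and> group_rank (G\<lparr>carrier := H\<rparr> Mod frattini G) = k}"
  then have H: "subgroup H G" "frattini G \<subseteq> H" "group_rank (G\<lparr>carrier := H\<rparr> Mod frattini G) = k" by auto
  obtain j where j: "card H = p ^ j * card (frattini G)" using card_supergroup[OF H(1,2)] .
  then show "H \<in> supergroups k" using H group_rank_quotient[OF H(1,2) j] by (simp add: supergroups_def)
next
  fix H assume "H \<in> supergroups k"
  then show "H \<in> {H. subgroup H G \<and> frattini G \<subseteq> H \<and> group_rank (G\<lparr>carrier := H\<rparr> Mod frattini G) = k}"
    using group_rank_quotient by (simp add: supergroups_def)
qed

lemma supergroups_Int_number_eq:
  assumes "k \<le> group_rank G"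
  shows "{H. subgroup H G \<and> frattini G \<subseteq> H \<and> Int_of_maximals G H (group_rank G - k) \<and>
     (\<forall>i<group_rank G - k. \<not> Int_of_maximals G H i)} = supergroups k"
proof (intro equalityI subsetI)
  fix H assume "H \<in> {H. subgroup H G \<and> frattini G \<subseteq> H \<and> Int_of_maximals G H (group_rank G - k) \<and>
     (\<forall>i<group_rank G - k. \<not> Int_of_maximals G H i)}"
  then have H: "subgroup H G" "frattini G \<subseteq> H" and I: "Int_of_maximals G H (group_rank G - k)"
     "\<forall>i<group_rank G - k. \<not> Int_of_maximals G H i" by auto
  obtain j where "card H = p ^ j * card (frattini G)" using card_supergroup[OF H] .
  then have j: "H \<in> supergroups j" using H by (simp add: supergroups_def)
  then have "group_rank G - k = group_rank G - j" using I Int_number_iff by blast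
  then have "j = k" using assms supergroup_exponent_le[OF order_eq j] by simp
  then show "H \<in> supergroups k" using j by simp
next
  fix H assume H: "H \<in> supergroups k"
  then show "H \<in> {H. subgroup H G \<and> frattini G \<subseteq> H \<and> Int_of_maximals G H (group_rank G - k) \<and>
     (\<forall>i<group_rank G - k. \<not> Int_of_maximals G H i)}"
    using Int_number_iff[OF H, of "group_rank G - k"] by (simp add: supergroups_def)
qed

end


section \<open>Path homotopy\<close>

text \<open>The end points are read off the first path instead of being parameters, so that one
  relation serves loops, lifts and paths between arbitrary points.\<close>

definition path_homotopic :: "'a topology \<Rightarrow> (real \<Rightarrow> 'a) \<Rightarrow> (real \<Rightarrow> 'a) \<Rightarrow> bool" where
  "path_homotopic X g h \<longleftrightarrow>
     homotopic_with (\<lambda>k. k 0 = g 0 \<and> k 1 = g 1) (top_of_set {0..1}) X g h"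

definition path_rev :: "(real \<Rightarrow> 'a) \<Rightarrow> real \<Rightarrow> 'a" where
  "path_rev g = (\<lambda>t. g (1 - t))"

lemma pathin_in_topspace: "\<lbrakk>pathin X g; 0 \<le> t; t \<le> 1\<rbrakk> \<Longrightarrow> g t \<in> topspace X"
  by (auto simp: pathin_def continuous_map_def)

lemma path_homotopic_pathin: "path_homotopic X g h \<Longrightarrow> pathin X g \<and> pathin X h"
  unfolding path_homotopic_def pathin_def by (rule homotopic_with_imp_continuous_maps)

lemma path_homotopic_ends: "path_homotopic X g h \<Longrightarrow> h 0 = g 0 \<and> h 1 = g 1"
  unfolding path_homotopic_def by (drule homotopic_with_imp_property) auto

lemma path_homotopic_refl [simp]: "path_homotopic X g g \<longleftrightarrow> pathin X g"
  by (simp add: path_homotopic_def pathin_def)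

lemma path_homotopic_sym: "path_homotopic X g h \<Longrightarrow> path_homotopic X h g"
  using path_homotopic_ends[of X g h] unfolding path_homotopic_def by (auto intro: homotopic_with_symD)

lemma path_homotopic_trans [trans]:
  "\<lbrakk>path_homotopic X f g; path_homotopic X g h\<rbrakk> \<Longrightarrow> path_homotopic X f h"
  using path_homotopic_ends[of X f g] unfolding path_homotopic_def by (auto intro: homotopic_with_trans)

text \<open>Paths are total functions on the reals, and lifts are controlled only on
  \<open>[0, 1]\<close>. This absorbs the difference in arbitrary values outside the
  interval.\<close>

lemma path_homotopic_cong:
  assumes "pathin X g" "\<And>t. t \<in> {0..1} \<Longrightarrow> g t = h t"
  shows "path_homotopic X g h"
  unfolding path_homotopic_def
  using assms by (intro homotopic_with_equal) (auto simp: pathin_def)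

lemma path_homotopic_map:
  assumes "path_homotopic X g h" "continuous_map X Y f"
  shows "path_homotopic Y (f \<circ> g) (f \<circ> h)"
  unfolding path_homotopic_def
  by (rule homotopic_with_compose_continuous_map_left[OF assms(1)[unfolded path_homotopic_def] assms(2)]) auto

text \<open>All the groupoid laws below arise from this by comparing two reparametrisations of one path.\<close>

lemma path_homotopic_reparam:
  assumes g: "pathin X g"
    and cont: "continuous_on {0..1} \<phi>" "continuous_on {0..1} \<psi>"
    and ran: "\<phi> \<in> {0..1} \<rightarrow> {0..1}" "\<psi> \<in> {0..1} \<rightarrow> {0..1}"
    and ends: "\<phi> 0 = \<psi> 0" "\<phi> 1 = \<psi> 1"
  shows "path_homotopic X (g \<circ> \<phi>) (g \<circ> \<psi>)"
proof -
  let ?I = "top_of_set {0..1::real}"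
  have "homotopic_with (\<lambda>k. k 0 = \<phi> 0 \<and> k 1 = \<phi> 1) ?I ?I \<phi> \<psi>"
    unfolding homotopic_with_def
  proof (intro exI[of _ "\<lambda>(s, t). (1 - s) * \<phi> t + s * \<psi> t"] conjI ballI)
    have "continuous_on ({0..1} \<times> {0..1}) (\<lambda>z::real \<times> real. (1 - fst z) * \<phi> (snd z) + fst z * \<psi> (snd z))"
      by (intro continuous_intros continuous_on_compose2[OF cont(1)] continuous_on_compose2[OF cont(2)]) auto
    moreover have "(1 - s) * \<phi> t + s * \<psi> t \<in> {0..1}" if "s \<in> {0..1}" "t \<in> {0..1}" for s t :: real
      using that ran convexD_alt[of "{0..1::real}" "\<phi> t" "\<psi> t" s] by (auto simp: Pi_iff)
    ultimately show "continuous_map (prod_topology ?I ?I) ?I (\<lambda>(s, t). (1 - s) * \<phi> t + s * \<psi> t)"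
      by (auto simp: case_prod_unfold continuous_map_in_subtopology)
  qed (auto simp: ends algebra_simps)
  then show ?thesis
    unfolding path_homotopic_def
    by (rule homotopic_with_compose_continuous_map_left[OF _ g[unfolded pathin_def]]) (auto simp: o_def)
qed

text \<open>The two homotopies are glued along the line where the path parameter is
  \<open>1/2\<close>; there both are constant at the common point \<open>g 1 = h 0\<close>.\<close>

lemma path_homotopic_concat:
  assumes g: "path_homotopic X g g'" and h: "path_homotopic X h h'" and gh: "g 1 = h 0"
  shows "path_homotopic X (path_concat g h) (path_concat g' h')"
proof -
  let ?I = "top_of_set {0..1::real}"
  obtain K where K: "continuous_map (prod_topology ?I ?I) X K" "\<And>t. K (0, t) = g t" "\<And>t. K (1, t) = g' t"
      "\<And>s. s \<in> {0..1} \<Longrightarrow> K (s, 0) = g 0 \<and> K (s, 1) = g 1"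
    using g unfolding path_homotopic_def homotopic_with_def by auto
  obtain L where L: "continuous_map (prod_topology ?I ?I) X L" "\<And>t. L (0, t) = h t" "\<And>t. L (1, t) = h' t"
      "\<And>s. s \<in> {0..1} \<Longrightarrow> L (s, 0) = h 0 \<and> L (s, 1) = h 1"
    using h unfolding path_homotopic_def homotopic_with_def by auto
  let ?Q = "top_of_set ({0..1::real} \<times> {0..1::real})"
  have cK: "continuous_map ?Q X K" and cL: "continuous_map ?Q X L" using K L by auto
  let ?M = "\<lambda>z::real \<times> real. if snd z \<le> 1/2 then K (fst z, 2 * snd z) else L (fst z, 2 * snd z - 1)"
  have "continuous_map ?Q X ?M"
  proof (rule continuous_map_cases_le)
    show "continuous_map ?Q euclideanreal snd" "continuous_map ?Q euclideanreal (\<lambda>_. 1/2)"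
      by (auto intro: continuous_intros)
    have "continuous_map (subtopology ?Q {z \<in> topspace ?Q. snd z \<le> 1/2}) X (K \<circ> (\<lambda>z. (fst z, 2 * snd z)))"
      by (rule continuous_map_compose[OF _ cK])
         (auto simp: continuous_map_in_subtopology subtopology_subtopology intro!: continuous_intros)
    then show "continuous_map (subtopology ?Q {z \<in> topspace ?Q. snd z \<le> 1/2}) X (\<lambda>z. K (fst z, 2 * snd z))"
      by (simp add: o_def)
    have "continuous_map (subtopology ?Q {z \<in> topspace ?Q. 1/2 \<le> snd z}) X (L \<circ> (\<lambda>z. (fst z, 2 * snd z - 1)))"
      by (rule continuous_map_compose[OF _ cL])
         (auto simp: continuous_map_in_subtopology subtopology_subtopology intro!: continuous_intros)
    then show "continuous_map (subtopology ?Q {z \<in> topspace ?Q. 1/2 \<le> snd z}) X (\<lambda>z. L (fst z, 2 * snd z - 1))"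
      by (simp add: o_def)
    show "K (fst z, 2 * snd z) = L (fst z, 2 * snd z - 1)" if "z \<in> topspace ?Q" "snd z = 1/2" for z
    proof -
      obtain s where "z = (s, 1/2)" using \<open>snd z = 1/2\<close> by (cases z) auto
      then show ?thesis using that K(4)[of s] L(4)[of s] gh by auto
    qed
  qed
  then show ?thesis
    unfolding path_homotopic_def homotopic_with_def
    by (intro exI[of _ ?M]) (use K L in \<open>auto simp: path_concat_def\<close>)
qed

lemma pathin_concat:
  "\<lbrakk>pathin X g; pathin X h; g 1 = h 0\<rbrakk> \<Longrightarrow> pathin X (path_concat g h)"
  using path_homotopic_concat[of X g g h h] by simp

lemma path_concat_ends [simp]: "path_concat g h 0 = g 0" "path_concat g h 1 = h 1"
  by (auto simp: path_concat_def)

lemma pathin_reparam: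
  assumes "pathin X g" "continuous_on {0..1} \<phi>" "\<phi> \<in> {0..1} \<rightarrow> {0..1}"
  shows "pathin X (g \<circ> \<phi>)"
  using path_homotopic_reparam[OF assms(1) assms(2,2) assms(3,3)] by simp

lemma path_rev_ends [simp]: "path_rev g 0 = g 1" "path_rev g 1 = g 0"
  by (auto simp: path_rev_def)

lemma path_rev_rev [simp]: "path_rev (path_rev g) = g"
  by (simp add: path_rev_def)

lemma pathin_rev: "pathin X g \<Longrightarrow> pathin X (path_rev g)"
  using pathin_reparam[of X g "\<lambda>t. 1 - t", OF _ continuous_on_diff[OF continuous_on_const continuous_on_id]]
  by (auto simp: path_rev_def o_def)

lemma path_rev_map: "f \<circ> path_rev g = path_rev (f \<circ> g)"
  by (auto simp: path_rev_def)

lemma path_concat_map: "f \<circ> path_concat g h = path_concat (f \<circ> g) (f \<circ> h)"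
  by (auto simp: path_concat_def)

lemma path_homotopic_assoc:
  assumes f: "pathin X f" and g: "pathin X g" and h: "pathin X h" and e: "f 1 = g 0" "g 1 = h 0"
  shows "path_homotopic X (path_concat (path_concat f g) h) (path_concat f (path_concat g h))"
proof -
  \<comment> \<open>The piecewise linear map that sends \<open>[0, 1/2]\<close>,
    \<open>[1/2, 3/4]\<close>, \<open>[3/4, 1]\<close> to \<open>[0, 1/4]\<close>,
    \<open>[1/4, 1/2]\<close>, \<open>[1/2, 1]\<close>. Its slopes \<open>1/2\<close>,
    \<open>1\<close>, \<open>2\<close> increase, so it is the maximum of its three linear pieces and
    its continuity is immediate.\<close>
  let ?k = "path_concat (path_concat f g) h" and ?\<phi> = "\<lambda>t::real. max (t/2) (max (t - 1/4) (2 * t - 1))"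
  have k: "pathin X ?k" using assms by (intro pathin_concat) auto
  have "path_homotopic X (?k \<circ> (\<lambda>t. t)) (?k \<circ> ?\<phi>)"
    by (rule path_homotopic_reparam[OF k]) (auto intro!: continuous_intros simp: le_max_iff_disj)
  moreover have "?k \<circ> ?\<phi> = path_concat f (path_concat g h)"
  proof
    fix t :: real
    consider "t < 1/2" | "t = 1/2" | "1/2 < t" "t < 3/4" | "t = 3/4" | "3/4 < t" by linarith
    then show "(?k \<circ> ?\<phi>) t = path_concat f (path_concat g h) t"
    proof cases
      case 1
      then have "?\<phi> t = t / 2" by auto
      then show ?thesis using 1 by (simp add: path_concat_def)
    next
      case 2
      then show ?thesis using e by (simp add: path_concat_def)
    next
      case 3
      then have "?\<phi> t = t - 1/4" by auto
      then show ?thesis using 3 by (simp add: path_concat_def algebra_simps)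
    next
      case 4
      then show ?thesis using e by (simp add: path_concat_def)
    next
      case 5
      then have "?\<phi> t = 2 * t - 1" by auto
      then show ?thesis using 5 by (simp add: path_concat_def algebra_simps)
    qed
  qed
  ultimately show ?thesis by (simp add: o_def)
qed

lemma path_homotopic_const_right:
  assumes g: "pathin X g"
  shows "path_homotopic X (path_concat g (\<lambda>_. g 1)) g"
proof -
  have "path_homotopic X (g \<circ> (\<lambda>t. min (2 * t) 1)) (g \<circ> (\<lambda>t. t))"
    by (rule path_homotopic_reparam[OF g]) (auto intro!: continuous_intros)
  moreover have "g \<circ> (\<lambda>t. min (2 * t) 1) = path_concat g (\<lambda>_. g 1)"
    by (auto simp: path_concat_def min_def fun_eq_iff)
  ultimately show ?thesis by (simp add: o_def)
qed

lemma path_homotopic_const_left: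
  assumes g: "pathin X g"
  shows "path_homotopic X (path_concat (\<lambda>_. g 0) g) g"
proof -
  have "path_homotopic X (g \<circ> (\<lambda>t. max 0 (2 * t - 1))) (g \<circ> (\<lambda>t. t))"
    by (rule path_homotopic_reparam[OF g]) (auto intro!: continuous_intros)
  moreover have "g \<circ> (\<lambda>t. max 0 (2 * t - 1)) = path_concat (\<lambda>_. g 0) g"
  proof
    fix t show "(g \<circ> (\<lambda>t. max 0 (2 * t - 1))) t = path_concat (\<lambda>_. g 0) g t"
    proof (cases "t \<le> 1/2")
      case True
      then have "max 0 (2 * t - 1) = 0" by simp
      then show ?thesis using True by (simp add: path_concat_def)
    qed (simp add: path_concat_def max_def)
  qed
  ultimately show ?thesis by (simp add: o_def)
qed

text \<open>The concatenation is \<open>g\<close> run along a tent function, and inside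
  \<open>[0, 1]\<close> the tent deforms to the constant \<open>0\<close>.\<close>

lemma path_homotopic_rev_right:
  assumes g: "pathin X g"
  shows "path_homotopic X (path_concat g (path_rev g)) (\<lambda>_. g 0)"
proof -
  have "path_homotopic X (g \<circ> (\<lambda>t. min (2 * t) (2 - 2 * t))) (g \<circ> (\<lambda>t. 0))"
  proof (rule path_homotopic_reparam[OF g])
    show "continuous_on {0..1} (\<lambda>t::real. min (2 * t) (2 - 2 * t))" by (intro continuous_intros)
  qed (auto simp: min_def)
  moreover have "g \<circ> (\<lambda>t. min (2 * t) (2 - 2 * t)) = path_concat g (path_rev g)"
    by (auto simp: path_concat_def path_rev_def min_def fun_eq_iff intro!: arg_cong[of _ _ g])
  ultimately show ?thesis by (simp add: o_def)
qed

lemma path_homotopic_rev_left: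
  assumes g: "pathin X g"
  shows "path_homotopic X (path_concat (path_rev g) g) (\<lambda>_. g 1)"
  using path_homotopic_rev_right[OF pathin_rev[OF g]] by (simp add: path_rev_def)

lemma path_homotopic_rev_cancel_right:
  assumes "pathin X f" "pathin X g" "f 1 = g 0"
  shows "path_homotopic X (path_concat (path_concat f g) (path_rev g)) f"
proof -
  have "path_homotopic X (path_concat (path_concat f g) (path_rev g)) (path_concat f (path_concat g (path_rev g)))"
    using assms by (intro path_homotopic_assoc pathin_rev) auto
  also have "path_homotopic X \<dots> (path_concat f (\<lambda>_. g 0))"
    using assms by (intro path_homotopic_concat path_homotopic_rev_right) auto
  also have "path_homotopic X \<dots> f"
    using path_homotopic_const_right[OF assms(1)] assms(3) by simp
  finally show ?thesis .
qed

lemma path_homotopic_rev_cancel_left: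
  assumes "pathin X f" "pathin X g" "f 1 = g 0"
  shows "path_homotopic X (path_concat (path_rev f) (path_concat f g)) g"
    (is "path_homotopic X ?L g")
proof -
  have "path_homotopic X ?L (path_concat (path_concat (path_rev f) f) g)"
    using assms by (intro path_homotopic_sym[OF path_homotopic_assoc] pathin_rev) auto
  also have "path_homotopic X \<dots> (path_concat (\<lambda>_. f 1) g)"
    using assms by (intro path_homotopic_concat path_homotopic_rev_left) auto
  also have "path_homotopic X \<dots> g"
    using path_homotopic_const_left[OF assms(2)] assms(3) by simp
  finally show ?thesis .
qed


section \<open>Path lifting and monodromy\<close>


lemma continuous_map_metric_nbhd:
  fixes x :: "'b::metric_space"
  assumes "continuous_map (top_of_set S) X w" "openin X U" "x \<in> S" "w x \<in> U"
  shows "\<exists>d>0. \<forall>t\<in>S. dist t x < d \<longrightarrow> w t \<in> U"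
proof -
  let ?A = "{t \<in> topspace (top_of_set S). w t \<in> U}"
  have "openin (top_of_set S) ?A" using assms by (intro openin_continuous_map_preimage)
  moreover have "x \<in> ?A" using assms by simp
  ultimately have "\<exists>d>0. \<forall>t\<in>S. dist t x < d \<longrightarrow> t \<in> ?A"
    unfolding openin_euclidean_subtopology_iff by blast
  then show ?thesis by auto
qed

lemma covering_map_evenly_covered:
  assumes "covering_map E q X" "x \<in> topspace X"
  obtains U \<V> where "x \<in> U" "openin X U" "\<Union>\<V> = topspace E \<inter> q -` U"
    "\<And>S. S \<in> \<V> \<Longrightarrow> openin E S" "pairwise disjnt \<V>"
    "\<And>S. S \<in> \<V> \<Longrightarrow> homeomorphic_map (subtopology E S) (subtopology X U) q"
  using assms unfolding covering_map_def by meson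

lemma covering_map_continuous: "covering_map E q X \<Longrightarrow> continuous_map E X q"
  by (simp add: covering_map_def)

lemma sheet_inj_on:
  assumes "openin E S" "homeomorphic_map (subtopology E S) Y q"
  shows "inj_on q S"
  using assms(2) openin_subset[OF assms(1)]
  by (simp add: homeomorphic_map_def inf_absorb2)

text \<open>The other sheets together form an open set disjoint from \<open>S\<close>, and the
  connected image of the interval cannot meet both.\<close>

lemma connected_path_in_sheet:
  assumes "\<Union>\<V> = topspace E \<inter> q -` U" "\<And>S. S \<in> \<V> \<Longrightarrow> openin E S" "pairwise disjnt \<V>"
    and S: "S \<in> \<V>" and k: "continuous_map (top_of_set {a..b::real}) E k"
    and U: "\<And>t. t \<in> {a..b} \<Longrightarrow> q (k t) \<in> U" and a: "k a \<in> S" and t: "t \<in> {a..b}"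
  shows "k t \<in> S"
proof (rule ccontr)
  assume "k t \<notin> S"
  let ?T = "\<Union>(\<V> - {S})"
  have oT: "openin E ?T" using assms(2) by (intro openin_Union) auto
  have conn: "connectedin E (k ` {a..b})"
    by (rule connectedin_continuous_map_image[OF k]) (auto simp: connectedin_iff_connected connectedin_subtopology)
  have im: "k ` {a..b} \<subseteq> topspace E" using k by (auto simp: continuous_map_def)
  have "k ` {a..b} \<subseteq> S \<union> ?T" using im U assms(1) by blast
  moreover have "S \<inter> ?T = {}" using S assms(3) by (auto simp: pairwise_def disjnt_def)
  moreover have "k a \<in> k ` {a..b}" "k t \<in> k ` {a..b}" using t by auto
  ultimately have "S \<inter> ?T \<inter> k ` {a..b} = {}" "S \<inter> k ` {a..b} \<noteq> {}" "?T \<inter> k ` {a..b} \<noteq> {}"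
    using a \<open>k t \<notin> S\<close> by blast+
  then show False
    using connectedinD[OF conn assms(2)[OF S] oT] \<open>k ` {a..b} \<subseteq> S \<union> ?T\<close> by blast
qed

text \<open>Bisection. On a short interval the path stays in one evenly covered set, and the inverse
  of the projection on the right sheet lifts it; lifts over adjacent intervals are glued.\<close>

lemma path_lift_exists:
  assumes cov: "covering_map E q X" and w: "pathin X w" and e: "e \<in> topspace E" "q e = w 0"
  shows "\<exists>g. pathin E g \<and> g 0 = e \<and> (\<forall>t\<in>{0..1}. q (g t) = w t)"
proof -
  define P where "P a b \<longleftrightarrow> (0 \<le> a \<longrightarrow> b \<le> 1 \<longrightarrow> a \<le> b \<longrightarrow> (\<forall>e\<in>topspace E. q e = w a \<longrightarrow>
      (\<exists>g. continuous_map (top_of_set {a..b}) E g \<and> g a = e \<and> (\<forall>t\<in>{a..b}. q (g t) = w t))))" for a b :: real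
  have "P 0 1"
  proof (rule Bolzano[of 0 1 P])
    fix a b c assume ab: "P a b" and bc: "P b c" and le: "a \<le> b" "b \<le> c"
    show "P a c"
      unfolding P_def
    proof (intro impI ballI)
      fix e assume r: "0 \<le> a" "c \<le> 1" and e: "e \<in> topspace E" "q e = w a"
      obtain g where g: "continuous_map (top_of_set {a..b}) E g" "g a = e" "\<forall>t\<in>{a..b}. q (g t) = w t"
        using ab r le e unfolding P_def by (meson order_trans)
      have "g b \<in> topspace E" using g(1) le by (auto simp: continuous_map_def)
      moreover have "q (g b) = w b" using g(3) le by auto
      ultimately obtain h where h: "continuous_map (top_of_set {b..c}) E h" "h b = g b" "\<forall>t\<in>{b..c}. q (h t) = w t"
        using bc r le unfolding P_def by (meson order_trans)
      let ?k = "\<lambda>t. if t \<le> b then g t else h t"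
      have "continuous_map (top_of_set {a..c}) E ?k"
      proof (rule continuous_map_cases_le)
        have "{a..c} \<inter> {x \<in> {a..c}. x \<le> b} = {a..b}" "{a..c} \<inter> {x \<in> {a..c}. b \<le> x} = {b..c}"
          using le by auto
        then show "continuous_map (subtopology (top_of_set {a..c}) {x \<in> topspace (top_of_set {a..c}). x \<le> b}) E g"
          "continuous_map (subtopology (top_of_set {a..c}) {x \<in> topspace (top_of_set {a..c}). b \<le> x}) E h"
          using g(1) h(1) by (simp_all add: subtopology_subtopology)
      qed (use h in auto)
      then show "\<exists>g. continuous_map (top_of_set {a..c}) E g \<and> g a = e \<and> (\<forall>t\<in>{a..c}. q (g t) = w t)"
        using g h le by (intro exI[of _ ?k]) auto
    qed
  next
    fix x :: real assume x: "0 \<le> x" "x \<le> 1"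
    have "w x \<in> topspace X" using pathin_in_topspace[OF w x] .
    from covering_map_evenly_covered[OF cov this] obtain U \<V> where U: "w x \<in> U" "openin X U"
      and V: "\<Union>\<V> = topspace E \<inter> q -` U" "\<And>S. S \<in> \<V> \<Longrightarrow> openin E S"
        "\<And>S. S \<in> \<V> \<Longrightarrow> homeomorphic_map (subtopology E S) (subtopology X U) q" by metis
    obtain d where d: "d > 0" "\<And>t. t \<in> {0..1} \<Longrightarrow> dist t x < d \<Longrightarrow> w t \<in> U"
      using continuous_map_metric_nbhd[OF w[unfolded pathin_def] U(2) _ U(1)] x by auto
    show "\<exists>d>0. \<forall>a b. a \<le> x \<and> x \<le> b \<and> b - a < d \<longrightarrow> P a b"
    proof (intro exI[of _ d] conjI allI impI d(1))
      fix a b assume ab: "a \<le> x \<and> x \<le> b \<and> b - a < d"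
      show "P a b"
        unfolding P_def
      proof (intro impI ballI)
        fix e assume r: "0 \<le> a" "b \<le> 1" and e: "e \<in> topspace E" "q e = w a"
        have wU: "w t \<in> U" if "t \<in> {a..b}" for t
          using that ab r by (intro d(2)) (auto simp: dist_real_def)
        have "e \<in> \<Union>\<V>" unfolding V(1) using e wU[of a] ab by auto
        then obtain S where S: "S \<in> \<V>" "e \<in> S" by blast
        obtain r where "homeomorphic_maps (subtopology E S) (subtopology X U) q r"
          using V(3)[OF S(1)] homeomorphic_map_maps by blast
        then have r: "continuous_map (subtopology X U) (subtopology E S) r"
          "\<And>y. y \<in> topspace (subtopology E S) \<Longrightarrow> r (q y) = y"
          "\<And>z. z \<in> topspace (subtopology X U) \<Longrightarrow> q (r z) = z"
          by (auto simp: homeomorphic_maps_def)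
        have "continuous_map (top_of_set {a..b}) X w"
          using w continuous_map_from_subtopology_mono[of euclidean "{0..1}" X w "{a..b}"] \<open>0 \<le> a\<close> \<open>b \<le> 1\<close>
          unfolding pathin_def by auto
        then have w': "continuous_map (top_of_set {a..b}) (subtopology X U) w"
          using wU by (auto simp: continuous_map_in_subtopology)
        then have "continuous_map (top_of_set {a..b}) (subtopology E S) (r \<circ> w)"
          using r(1) continuous_map_compose by blast
        then have "continuous_map (top_of_set {a..b}) E (r \<circ> w)"
          by (simp add: continuous_map_in_subtopology)
        moreover have "(r \<circ> w) a = e" using r(2)[of e] S e by auto
        moreover have "q ((r \<circ> w) t) = w t" if "t \<in> {a..b}" for t
          using w' that by (auto intro!: r(3) simp: continuous_map_def)
        ultimately show "\<exists>g. continuous_map (top_of_set {a..b}) E g \<and> g a = e \<and> (\<forall>t\<in>{a..b}. q (g t) = w t)"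
          by blast
      qed
    qed
  qed simp
  then show ?thesis using e by (auto simp: P_def pathin_def)
qed

text \<open>
  The end point of the lift of the \<open>s\<close>-th path of the homotopy is locally constant in \<open>s\<close>. To see
  this, \<open>R a b\<close> below expresses that the value of the lift at \<open>b\<close> depends continuously on \<open>s\<close> and on its
  value at \<open>a\<close>; it holds on short intervals, and bisection extends it to \<open>[0, 1]\<close>.
\<close>

lemma monodromy:
  assumes cov: "covering_map E q X" and k: "pathin E k" and k': "pathin E k'" and k0: "k 0 = k' 0"
    and hom: "path_homotopic X (q \<circ> k) (q \<circ> k')"
  shows "k 1 = k' 1"
proof -
  let ?I = "top_of_set {0..1::real}"
  obtain h where h: "continuous_map (prod_topology ?I ?I) X h" "\<And>t. h (0, t) = q (k t)" "\<And>t. h (1, t) = q (k' t)"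
      "\<And>s. s \<in> {0..1} \<Longrightarrow> h (s, 0) = q (k 0) \<and> h (s, 1) = q (k 1)"
    using hom unfolding path_homotopic_def homotopic_with_def by auto
  have h': "continuous_map (top_of_set ({0..1} \<times> {0..1})) X h" using h(1) by simp
  \<comment> \<open>The intermediate paths are lifted one at a time; no joint continuity of these
    lifts is claimed at this stage.\<close>
  have "\<forall>s\<in>{0..1}. \<exists>g. pathin E g \<and> g 0 = k 0 \<and> (\<forall>t\<in>{0..1}. q (g t) = h (s, t))"
  proof
    fix s :: real assume s: "s \<in> {0..1}"
    have "pathin X (h \<circ> Pair s)" unfolding pathin_def
      using s by (intro continuous_map_o_Pair[OF h(1)]) auto
    moreover have "k 0 \<in> topspace E" using pathin_in_topspace[OF k] by simp
    ultimately show "\<exists>g. pathin E g \<and> g 0 = k 0 \<and> (\<forall>t\<in>{0..1}. q (g t) = h (s, t))"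
      using path_lift_exists[OF cov, of "h \<circ> Pair s" "k 0"] h(4)[OF s] by simp
  qed
  then obtain L where L: "\<And>s. s \<in> {0..1} \<Longrightarrow> pathin E (L s)" "\<And>s. s \<in> {0..1} \<Longrightarrow> L s 0 = k 0"
      "\<And>s t. s \<in> {0..1} \<Longrightarrow> t \<in> {0..1} \<Longrightarrow> q (L s t) = h (s, t)"
    by metis
  have ends: "L 0 1 = k 1" "L 1 1 = k' 1"
    using covering_map_unique_lift[OF cov L(1) k, of 0] covering_map_unique_lift[OF cov L(1) k', of 1]
      L(2,3) h(2,3) k0 by auto
  have local: "\<exists>d>0. \<forall>s\<in>{0..1}. \<bar>s - s0\<bar> < d \<longrightarrow> L s 1 = L s0 1" if s0: "s0 \<in> {0..1}" for s0
  proof -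
    define R where "R a b \<longleftrightarrow> (0 \<le> a \<longrightarrow> b \<le> 1 \<longrightarrow> a \<le> b \<longrightarrow> (\<forall>N. openin E N \<and> L s0 b \<in> N \<longrightarrow>
        (\<exists>M d. openin E M \<and> L s0 a \<in> M \<and> 0 < d \<and>
           (\<forall>s\<in>{0..1}. \<bar>s - s0\<bar> < d \<longrightarrow> L s a \<in> M \<longrightarrow> L s b \<in> N))))" for a b :: real
    have "R 0 1"
    proof (rule Bolzano[of 0 1 R])
      fix a b c assume ab: "R a b" and bc: "R b c" and le: "a \<le> b" "b \<le> c"
      show "R a c"
        unfolding R_def
      proof (intro impI allI)
        fix N assume r: "0 \<le> a" "c \<le> 1" and N: "openin E N \<and> L s0 c \<in> N"
        obtain M d where M: "openin E M" "L s0 b \<in> M" "0 < d"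
          "\<forall>s\<in>{0..1}. \<bar>s - s0\<bar> < d \<longrightarrow> L s b \<in> M \<longrightarrow> L s c \<in> N"
          using bc r le N unfolding R_def by (meson order_trans)
        obtain M' d' where M': "openin E M'" "L s0 a \<in> M'" "0 < d'"
          "\<forall>s\<in>{0..1}. \<bar>s - s0\<bar> < d' \<longrightarrow> L s a \<in> M' \<longrightarrow> L s b \<in> M"
          using ab r le M(1,2) unfolding R_def by (meson order_trans)
        show "\<exists>M d. openin E M \<and> L s0 a \<in> M \<and> 0 < d \<and>
           (\<forall>s\<in>{0..1}. \<bar>s - s0\<bar> < d \<longrightarrow> L s a \<in> M \<longrightarrow> L s c \<in> N)"
          using M M' by (intro exI[of _ M'] exI[of _ "min d d'"]) auto
      qed
    next
      fix t0 :: real assume t0: "0 \<le> t0" "t0 \<le> 1"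
      have "h (s0, t0) \<in> topspace X" using h' s0 t0 by (auto simp: continuous_map_def)
      from covering_map_evenly_covered[OF cov this] obtain U \<V> where U: "h (s0, t0) \<in> U" "openin X U"
        and V: "\<Union>\<V> = topspace E \<inter> q -` U" "\<And>S. S \<in> \<V> \<Longrightarrow> openin E S" "pairwise disjnt \<V>"
          "\<And>S. S \<in> \<V> \<Longrightarrow> homeomorphic_map (subtopology E S) (subtopology X U) q" by metis
      obtain d where d: "d > 0" "\<forall>z\<in>{0..1} \<times> {0..1}. dist z (s0, t0) < d \<longrightarrow> h z \<in> U"
        using continuous_map_metric_nbhd[OF h' U(2) _ U(1)] s0 t0 by auto
      have near: "h (s, t) \<in> U" if "s \<in> {0..1}" "t \<in> {0..1}" "\<bar>s - s0\<bar> < d/2" "\<bar>t - t0\<bar> < d/2" for s t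
      proof -
        have "dist (s, t) (s0, t0) \<le> \<bar>s - s0\<bar> + \<bar>t - t0\<bar>"
          unfolding dist_Pair_Pair dist_real_def using sqrt_sum_squares_le_sum_abs by (metis abs_idempotent power2_abs)
        then show ?thesis using that d by force
      qed
      show "\<exists>d>0. \<forall>a b. a \<le> t0 \<and> t0 \<le> b \<and> b - a < d \<longrightarrow> R a b"
      proof (intro exI[of _ "d/2"] conjI allI impI)
        show "0 < d/2" using d by simp
        fix a b assume ab: "a \<le> t0 \<and> t0 \<le> b \<and> b - a < d/2"
        show "R a b"
          unfolding R_def
        proof (intro impI allI)
          fix N assume r: "0 \<le> a" "b \<le> 1" "a \<le> b" and N: "openin E N \<and> L s0 b \<in> N"
          have inU: "q (L s t) \<in> U" if "s \<in> {0..1}" "\<bar>s - s0\<bar> < d/2" "t \<in> {a..b}" for s t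
          proof -
            have t: "t \<in> {0..1}" using that r by auto
            have "\<bar>t - t0\<bar> < d/2" using that(3) ab unfolding atLeastAtMost_iff by linarith
            note t = t this
            show ?thesis using near[OF that(1) t(1) that(2) t(2)] L(3)[OF that(1) t(1)] by simp
          qed
          have in_E: "L s t \<in> topspace E" if "s \<in> {0..1}" "t \<in> {a..b}" for s t
            using pathin_in_topspace[OF L(1)[OF that(1)]] that r by auto
          have s0d: "\<bar>s0 - s0\<bar> < d/2" using d by simp
          have "L s0 a \<in> \<Union>\<V>" unfolding V(1) using inU[OF s0 s0d, of a] in_E[OF s0, of a] r by auto
          then obtain S where S: "S \<in> \<V>" "L s0 a \<in> S" by blast
          have stay: "L s b \<in> S" if "s \<in> {0..1}" "\<bar>s - s0\<bar> < d/2" "L s a \<in> S" for s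
          proof (rule connected_path_in_sheet[where k = "L s" and t = b and b = b, OF V(1-3) S(1) _ _ that(3)])
            show "continuous_map (top_of_set {a..b}) E (L s)"
              using L(1)[OF that(1)] r continuous_map_from_subtopology_mono[of euclidean "{0..1}" E "L s" "{a..b}"]
              unfolding pathin_def by auto
          qed (use inU that r in auto)
          have inj: "inj_on q S" using sheet_inj_on[OF V(2,4)] S by blast
          \<comment> \<open>As \<open>q\<close> is injective on \<open>S\<close>, a point of
            \<open>S\<close> over \<open>?O\<close> lies in \<open>N\<close>. So it suffices that
            the lift stays in \<open>S\<close> up to \<open>b\<close> and that
            \<open>h (s, b)\<close> stays in the open set \<open>?O\<close> for \<open>s\<close>
            near \<open>s0\<close>.\<close>
          let ?O = "q ` (N \<inter> S)"
          have "openin (subtopology E S) (N \<inter> S)"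
            using N by (auto simp: openin_subtopology)
          then have "openin (subtopology X U) ?O"
            using homeomorphic_map_openness[OF V(4)[OF S(1)], of "N \<inter> S"] openin_subset by blast
          then have oO: "openin X ?O" using openin_trans_full U(2) by blast
          have "L s0 b \<in> S" using stay[OF s0 s0d S(2)] .
          then have "h (s0, b) \<in> ?O" using L(3)[OF s0, of b] N r by (intro image_eqI[of _ _ "L s0 b"]) auto
          moreover have cb: "continuous_map ?I X (\<lambda>s. h (s, b))"
          proof -
            have "continuous_map ?I X (h \<circ> (\<lambda>s. (s, b)))"
              by (rule continuous_map_compose[OF _ h'])
                 (use r in \<open>auto simp: continuous_map_in_subtopology intro!: continuous_intros\<close>)
            then show ?thesis by (simp add: o_def)
          qed
          ultimately obtain d2 where d2: "d2 > 0" "\<forall>s\<in>{0..1}. dist s s0 < d2 \<longrightarrow> h (s, b) \<in> ?O"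
            using continuous_map_metric_nbhd[OF cb oO s0] by auto
          show "\<exists>M d. openin E M \<and> L s0 a \<in> M \<and> 0 < d \<and>
            (\<forall>s\<in>{0..1}. \<bar>s - s0\<bar> < d \<longrightarrow> L s a \<in> M \<longrightarrow> L s b \<in> N)"
          proof (intro exI[of _ S] exI[of _ "min (d/2) d2"] conjI ballI impI)
            fix s assume s: "s \<in> {0..1}" "\<bar>s - s0\<bar> < min (d/2) d2" "L s a \<in> S"
            have sb: "L s b \<in> S" using stay[OF s(1) _ s(3)] s(2) by simp
            have "q (L s b) \<in> ?O" using d2(2) s L(3)[OF s(1), of b] r by (auto simp: dist_real_def)
            then obtain e where "e \<in> N" "e \<in> S" "q (L s b) = q e" by blast
            then show "L s b \<in> N" using inj_onD[OF inj, of "L s b" e] sb by simp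
          qed (use V(2)[OF S(1)] S d d2 in auto)
        qed
      qed
    qed simp
    let ?x = "L s0 1"
    have xE: "?x \<in> topspace E" using pathin_in_topspace[OF L(1)[OF s0]] by simp
    then have "q ?x \<in> topspace X" using covering_map_continuous[OF cov] by (auto simp: continuous_map_def)
    from covering_map_evenly_covered[OF cov this] obtain U \<V> where U: "q ?x \<in> U"
      and V: "\<Union>\<V> = topspace E \<inter> q -` U" "\<And>S. S \<in> \<V> \<Longrightarrow> openin E S"
        "\<And>S. S \<in> \<V> \<Longrightarrow> homeomorphic_map (subtopology E S) (subtopology X U) q" by metis
    have "?x \<in> \<Union>\<V>" unfolding V(1) using xE U by auto
    then obtain S where S: "S \<in> \<V>" "?x \<in> S" by blast
    obtain M d where M: "openin E M" "L s0 0 \<in> M" "0 < d"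
      "\<forall>s\<in>{0..1}. \<bar>s - s0\<bar> < d \<longrightarrow> L s 0 \<in> M \<longrightarrow> L s 1 \<in> S"
      using \<open>R 0 1\<close> V(2)[OF S(1)] S(2) unfolding R_def by (metis order_refl zero_le_one)
    \<comment> \<open>The homotopy fixes the end points, so both points lie over the same point of
      \<open>X\<close>; two such points in one sheet are equal.\<close>
    have "L s 1 = ?x" if s: "s \<in> {0..1}" "\<bar>s - s0\<bar> < d" for s
    proof -
      have "L s 1 \<in> S" using M(2,4) s L(2)[OF s(1)] L(2)[OF s0] by auto
      moreover have "q (L s 1) = q ?x" using L(3)[OF s(1), of 1] L(3)[OF s0, of 1] h(4)[OF s(1)] h(4)[OF s0] by simp
      ultimately show ?thesis using inj_onD[OF sheet_inj_on[OF V(2,3)[OF S(1)]]] S by blast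
    qed
    then show ?thesis using M(3) by blast
  qed
  \<comment> \<open>Bisection once more: what is locally constant on \<open>[0, 1]\<close> takes the
    same value at both ends.\<close>
  define P where "P a b \<longleftrightarrow> (0 \<le> a \<longrightarrow> b \<le> 1 \<longrightarrow> a \<le> b \<longrightarrow> L a 1 = L b 1)" for a b
  have "P 0 1"
  proof (rule Bolzano[of 0 1 P])
    fix x :: real assume x: "0 \<le> x" "x \<le> 1"
    obtain d where d: "d > 0" "\<forall>s\<in>{0..1}. \<bar>s - x\<bar> < d \<longrightarrow> L s 1 = L x 1"
      using local[of x] x by auto
    show "\<exists>d>0. \<forall>a b. a \<le> x \<and> x \<le> b \<and> b - a < d \<longrightarrow> P a b"
    proof (intro exI[of _ d] conjI allI impI d(1))
      fix a b assume ab: "a \<le> x \<and> x \<le> b \<and> b - a < d"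
      show "P a b" unfolding P_def
      proof (intro impI)
        assume r: "0 \<le> a" "b \<le> 1"
        have "L a 1 = L x 1" "L b 1 = L x 1" using ab r by (auto intro!: d(2)[rule_format])
        then show "L a 1 = L b 1" by simp
      qed
    qed
  qed (auto simp: P_def)
  then show ?thesis using ends by (simp add: P_def)
qed


section \<open>Covers and subgroups of the fundamental group\<close>


lemma loop_homotopic_iff:
  "loop_at X x0 g \<Longrightarrow> loop_homotopic X x0 g h \<longleftrightarrow> path_homotopic X g h"
  by (simp add: loop_homotopic_def path_homotopic_def loop_at_def)

lemma mem_loop_class: "loop_at X x0 g \<Longrightarrow> h \<in> loop_class X x0 g \<longleftrightarrow> path_homotopic X g h"
  by (simp add: loop_class_def loop_homotopic_iff)

lemma loop_at_if_homotopic: "loop_at X x0 g \<Longrightarrow> path_homotopic X g h \<Longrightarrow> loop_at X x0 h"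
  using path_homotopic_ends[of X g h] path_homotopic_pathin[of X g h] by (simp add: loop_at_def)

lemma loop_class_eq_iff:
  assumes "loop_at X x0 g" "loop_at X x0 h"
  shows "loop_class X x0 g = loop_class X x0 h \<longleftrightarrow> path_homotopic X g h"
proof
  assume "loop_class X x0 g = loop_class X x0 h"
  then have "h \<in> loop_class X x0 g" using assms by (simp add: mem_loop_class loop_at_def)
  then show "path_homotopic X g h" using assms by (simp add: mem_loop_class)
next
  assume gh: "path_homotopic X g h"
  show "loop_class X x0 g = loop_class X x0 h"
    using path_homotopic_trans[OF gh] path_homotopic_trans[OF path_homotopic_sym[OF gh]] assms
    by (auto simp: mem_loop_class)
qed

lemma loop_at_concat: "loop_at X x0 g \<Longrightarrow> loop_at X x0 h \<Longrightarrow> loop_at X x0 (path_concat g h)"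
  by (simp add: loop_at_def pathin_concat)

lemma loop_at_rev: "loop_at X x0 g \<Longrightarrow> loop_at X x0 (path_rev g)"
  by (simp add: loop_at_def pathin_rev)

lemma loop_at_const: "x0 \<in> topspace X \<Longrightarrow> loop_at X x0 (\<lambda>_. x0)"
  by (simp add: loop_at_def)

lemma loop_at_map: "loop_at E b k \<Longrightarrow> continuous_map E X q \<Longrightarrow> q b = x0 \<Longrightarrow> loop_at X x0 (q \<circ> k)"
  by (auto simp: loop_at_def pathin_compose)

lemma carrier_fundamental_group: "a \<in> carrier (fundamental_group X x0) \<longleftrightarrow> (\<exists>g. loop_at X x0 g \<and> a = loop_class X x0 g)"
  by (auto simp: fundamental_group_def)

text \<open>The product is a union over all pairs of representatives. Homotopy invariance of
  concatenation makes all sets in this union the same class.\<close>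

lemma mult_fundamental_group:
  assumes g: "loop_at X x0 g" and h: "loop_at X x0 h"
  shows "loop_class X x0 g \<otimes>\<^bsub>fundamental_group X x0\<^esub> loop_class X x0 h = loop_class X x0 (path_concat g h)"
proof -
  have key: "loop_class X x0 (path_concat g' h') = loop_class X x0 (path_concat g h)"
    if "g' \<in> loop_class X x0 g" "h' \<in> loop_class X x0 h" for g' h'
  proof -
    have gh': "path_homotopic X g g'" "path_homotopic X h h'" using that g h by (auto simp: mem_loop_class)
    then have "path_homotopic X (path_concat g h) (path_concat g' h')"
      using g h by (intro path_homotopic_concat) (auto simp: loop_at_def)
    moreover have "loop_at X x0 (path_concat g' h')"
      using loop_at_concat[OF loop_at_if_homotopic[OF g gh'(1)] loop_at_if_homotopic[OF h gh'(2)]] .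
    ultimately show ?thesis using loop_class_eq_iff[OF loop_at_concat[OF g h]] by metis
  qed
  have "(\<Union>g'\<in>loop_class X x0 g. \<Union>h'\<in>loop_class X x0 h. loop_class X x0 (path_concat g' h'))
      = (\<Union>g'\<in>loop_class X x0 g. \<Union>h'\<in>loop_class X x0 h. loop_class X x0 (path_concat g h))"
    by (intro SUP_cong refl key)
  also have "g \<in> loop_class X x0 g" "h \<in> loop_class X x0 h"
    using g h by (auto simp: mem_loop_class loop_at_def)
  then have "(\<Union>g'\<in>loop_class X x0 g. \<Union>h'\<in>loop_class X x0 h. loop_class X x0 (path_concat g h))
      = loop_class X x0 (path_concat g h)" by blast
  finally show ?thesis by (simp add: fundamental_group_def)
qed

lemma one_fundamental_group: "\<one>\<^bsub>fundamental_group X x0\<^esub> = loop_class X x0 (\<lambda>_. x0)"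
  by (simp add: fundamental_group_def)

lemma induced_hom_loop_class:
  assumes q: "continuous_map E X q" "q b = x0" and k: "loop_at E b k"
  shows "induced_hom X x0 q (loop_class E b k) = loop_class X x0 (q \<circ> k)"
proof -
  have key: "loop_class X x0 (q \<circ> k') = loop_class X x0 (q \<circ> k)" if "k' \<in> loop_class E b k" for k'
  proof -
    have "path_homotopic E k k'" using that k by (simp add: mem_loop_class)
    then have "path_homotopic X (q \<circ> k) (q \<circ> k')" using path_homotopic_map q by blast
    then show ?thesis
      using loop_class_eq_iff[OF loop_at_map[OF k q] loop_at_if_homotopic[OF loop_at_map[OF k q]]] by metis
  qed
  have "(\<Union>k'\<in>loop_class E b k. loop_class X x0 (q \<circ> k')) = (\<Union>k'\<in>loop_class E b k. loop_class X x0 (q \<circ> k))"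
    by (intro SUP_cong refl key)
  also have "k \<in> loop_class E b k" using k by (simp add: mem_loop_class loop_at_def)
  then have "(\<Union>k'\<in>loop_class E b k. loop_class X x0 (q \<circ> k)) = loop_class X x0 (q \<circ> k)" by blast
  finally show ?thesis by (simp add: induced_hom_def)
qed

lemma pc_coverD:
  assumes "pc_cover X x0 C"
  shows "covering_map (total_space C) (proj C) X" "path_connected_space (total_space C)"
    "base_point C \<in> topspace (total_space C)" "proj C (base_point C) = x0"
    "continuous_map (total_space C) X (proj C)"
  using assms by (auto simp: pc_cover_def covering_map_def)

lemma cover_subgroup_eq:
  assumes C: "pc_cover X x0 C"
  shows "cover_subgroup X x0 C = {loop_class X x0 (proj C \<circ> k) | k. loop_at (total_space C) (base_point C) k}"
proof -
  note q = induced_hom_loop_class[OF pc_coverD(5,4)[OF C]]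
  have "cover_subgroup X x0 C = (\<lambda>k. induced_hom X x0 (proj C) (loop_class (total_space C) (base_point C) k)) `
      {k. loop_at (total_space C) (base_point C) k}"
    unfolding cover_subgroup_def fundamental_group_def by (simp add: setcompr_eq_image image_image)
  also have "\<dots> = (\<lambda>k. loop_class X x0 (proj C \<circ> k)) ` {k. loop_at (total_space C) (base_point C) k}"
    by (rule image_cong[OF refl]) (simp add: q)
  finally show ?thesis by (simp add: setcompr_eq_image)
qed

lemma cover_subgroupI:
  "\<lbrakk>pc_cover X x0 C; loop_at (total_space C) (base_point C) k\<rbrakk> \<Longrightarrow> loop_class X x0 (proj C \<circ> k) \<in> cover_subgroup X x0 C"
  unfolding cover_subgroup_eq by blast

lemma loop_class_in_cover_subgroup:
  assumes C: "pc_cover X x0 C" and w: "loop_at X x0 w"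
  shows "loop_class X x0 w \<in> cover_subgroup X x0 C \<longleftrightarrow>
    (\<exists>k. loop_at (total_space C) (base_point C) k \<and> path_homotopic X w (proj C \<circ> k))"
  unfolding cover_subgroup_eq[OF C]
  using loop_class_eq_iff[OF w loop_at_map[OF _ pc_coverD(5,4)[OF C]]] by auto

lemma cover_subgroup_subset: "pc_cover X x0 C \<Longrightarrow> cover_subgroup X x0 C \<subseteq> carrier (fundamental_group X x0)"
  using loop_at_map pc_coverD(4,5) by (fastforce simp: cover_subgroup_eq carrier_fundamental_group)

lemma cover_subgroup_mult_closed:
  assumes C: "pc_cover X x0 C" and ab: "a \<in> cover_subgroup X x0 C" "b \<in> cover_subgroup X x0 C"
  shows "a \<otimes>\<^bsub>fundamental_group X x0\<^esub> b \<in> cover_subgroup X x0 C"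
proof -
  obtain k l where kl: "loop_at (total_space C) (base_point C) k" "a = loop_class X x0 (proj C \<circ> k)"
     "loop_at (total_space C) (base_point C) l" "b = loop_class X x0 (proj C \<circ> l)"
    using ab by (auto simp: cover_subgroup_eq[OF C])
  have "a \<otimes>\<^bsub>fundamental_group X x0\<^esub> b = loop_class X x0 (proj C \<circ> path_concat k l)"
    unfolding kl path_concat_map
    using kl loop_at_map[OF _ pc_coverD(5,4)[OF C]] by (intro mult_fundamental_group) auto
  then show ?thesis using cover_subgroupI[OF C loop_at_concat[OF kl(1,3)]] by simp
qed

lemma one_in_cover_subgroup:
  assumes C: "pc_cover X x0 C"
  shows "\<one>\<^bsub>fundamental_group X x0\<^esub> \<in> cover_subgroup X x0 C"
proof -
  have "loop_at (total_space C) (base_point C) (\<lambda>_. base_point C)"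
    using pc_coverD(3)[OF C] by (rule loop_at_const)
  from cover_subgroupI[OF C this] show ?thesis
    by (simp add: one_fundamental_group o_def pc_coverD(4)[OF C])
qed

lemma covers_imp_subgroup_le:
  assumes C1: "pc_cover X x0 C1" and C2: "pc_cover X x0 C2" and c: "C1 \<succ> C2"
  shows "cover_subgroup X x0 C1 \<subseteq> cover_subgroup X x0 C2"
proof
  fix a assume "a \<in> cover_subgroup X x0 C1"
  then obtain k where k: "loop_at (total_space C1) (base_point C1) k" "a = loop_class X x0 (proj C1 \<circ> k)"
    by (auto simp: cover_subgroup_eq[OF C1])
  obtain f where f: "continuous_map (total_space C1) (total_space C2) f" "f (base_point C1) = base_point C2"
      "\<forall>e\<in>topspace (total_space C1). proj C1 e = proj C2 (f e)"
    using c unfolding covers_def by blast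
  have l: "loop_at (total_space C2) (base_point C2) (f \<circ> k)" by (rule loop_at_map[OF k(1) f(1,2)])
  have w: "loop_at X x0 (proj C1 \<circ> k)" by (rule loop_at_map[OF k(1) pc_coverD(5,4)[OF C1]])
  have "path_homotopic X (proj C1 \<circ> k) (proj C2 \<circ> (f \<circ> k))"
    using w k(1) f(3) by (intro path_homotopic_cong) (auto simp: loop_at_def pathin_in_topspace)
  then show "a \<in> cover_subgroup X x0 C2"
    unfolding k(2) loop_class_in_cover_subgroup[OF C2 w] using l by blast
qed

text \<open>Path connectedness together with the condition behind semilocal simple connectedness:
  the homotopy between two paths in \<open>V\<close> may run through all of
  \<open>X\<close>.\<close>

definition simple_open :: "'a topology \<Rightarrow> 'a set \<Rightarrow> bool" where
  "simple_open X V \<longleftrightarrow> openin X V \<and>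
     (\<forall>y\<in>V. \<forall>z\<in>V. \<exists>u. pathin (subtopology X V) u \<and> u 0 = y \<and> u 1 = z) \<and>
     (\<forall>u v. pathin (subtopology X V) u \<longrightarrow> pathin (subtopology X V) v \<longrightarrow> u 0 = v 0 \<longrightarrow> u 1 = v 1 \<longrightarrow>
        path_homotopic X u v)"

lemma ex_simple_open_subset:
  assumes "neighbourhood_base_of (simple_open X) X" "openin X W" "x \<in> W"
  shows "\<exists>V. simple_open X V \<and> x \<in> V \<and> V \<subseteq> W"
proof -
  have "\<forall>S. simple_open X S \<longrightarrow> openin X S" by (simp add: simple_open_def)
  then show ?thesis using assms open_neighbourhood_base_of by blast
qed

lemma sheet_path_lift:
  assumes S: "homeomorphic_map (subtopology E S) (subtopology X U) q" "e \<in> S" "e \<in> topspace E"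
    and u: "pathin (subtopology X U) u" "u 0 = q e"
  obtains k where "pathin E k" "k 0 = e" "\<And>t. t \<in> {0..1} \<Longrightarrow> k t \<in> S" "\<And>t. t \<in> {0..1} \<Longrightarrow> q (k t) = u t"
proof -
  obtain r where "homeomorphic_maps (subtopology E S) (subtopology X U) q r"
    using S(1) homeomorphic_map_maps by blast
  then have r: "continuous_map (subtopology X U) (subtopology E S) r"
    "\<And>y. y \<in> topspace (subtopology E S) \<Longrightarrow> r (q y) = y"
    "\<And>z. z \<in> topspace (subtopology X U) \<Longrightarrow> q (r z) = z"
    by (auto simp: homeomorphic_maps_def)
  have "pathin (subtopology E S) (r \<circ> u)" using pathin_compose[OF u(1) r(1)] .
  then have "pathin E (r \<circ> u)" "\<And>t. t \<in> {0..1} \<Longrightarrow> (r \<circ> u) t \<in> S" by (auto simp: pathin_subtopology)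
  moreover have "(r \<circ> u) 0 = e" using r(2)[of e] S u by simp
  moreover have "q ((r \<circ> u) t) = u t" if "t \<in> {0..1}" for t
    using that pathin_in_topspace[OF u(1)] by (auto intro!: r(3))
  ultimately show ?thesis using that by blast
qed

text \<open>The lifting criterion. A point \<open>e\<close> is sent to the end of the lift to
  \<open>C2\<close> of the projection of any path from the base point to \<open>e\<close>; the
  inclusion of subgroups makes this independent of the path, and small path connected sets make it
  continuous.\<close>

lemma covers_if_subgroup_le:
  assumes X: "neighbourhood_base_of (simple_open X) X"
    and C1: "pc_cover X x0 C1" and C2: "pc_cover X x0 C2"
    and le: "cover_subgroup X x0 C1 \<subseteq> cover_subgroup X x0 C2"
  shows "C1 \<succ> C2"
proof -
  let ?E1 = "total_space C1" and ?q1 = "proj C1" and ?b1 = "base_point C1"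
  let ?E2 = "total_space C2" and ?q2 = "proj C2" and ?b2 = "base_point C2"
  note c1 = pc_coverD[OF C1] and c2 = pc_coverD[OF C2]
  define R where "R e g k \<longleftrightarrow> pathin ?E1 g \<and> g 0 = ?b1 \<and> g 1 = e \<and> pathin ?E2 k \<and> k 0 = ?b2 \<and>
     (\<forall>t\<in>{0..1}. ?q2 (k t) = ?q1 (g t))" for e g k
  have ex: "\<exists>g k. R e g k" if "e \<in> topspace ?E1" for e
  proof -
    obtain g where g: "pathin ?E1 g" "g 0 = ?b1" "g 1 = e"
      using c1(2,3) \<open>e \<in> topspace ?E1\<close> unfolding path_connected_space_def by blast
    have "pathin X (?q1 \<circ> g)" using pathin_compose[OF g(1) c1(5)] .
    moreover have "?q2 ?b2 = (?q1 \<circ> g) 0" using g c1(4) c2(4) by simp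
    ultimately obtain k where "pathin ?E2 k" "k 0 = ?b2" "\<forall>t\<in>{0..1}. ?q2 (k t) = (?q1 \<circ> g) t"
      using path_lift_exists[OF c2(1) _ c2(3)] by blast
    then have "R e g k" using g by (simp add: R_def)
    then show ?thesis by blast
  qed
  have uniq: "k 1 = k' 1" if R1: "R e g k" and R2: "R e g' k'" for e g k g' k'
  proof -
    have g: "pathin ?E1 g" "g 0 = ?b1" "g 1 = e" and k: "pathin ?E2 k" "k 0 = ?b2" "\<forall>t\<in>{0..1}. ?q2 (k t) = ?q1 (g t)"
      using R1 by (auto simp: R_def)
    have g': "pathin ?E1 g'" "g' 0 = ?b1" "g' 1 = e" and k': "pathin ?E2 k'" "k' 0 = ?b2" "\<forall>t\<in>{0..1}. ?q2 (k' t) = ?q1 (g' t)"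
      using R2 by (auto simp: R_def)
    \<comment> \<open>Two paths to \<open>e\<close> differ by this loop. Its projection is homotopic
      to that of a loop \<open>m\<close> in the second cover, so \<open>k\<close> and
      \<open>m\<close> followed by \<open>k'\<close> have homotopic projections, and monodromy
      equates their end points.\<close>
    let ?l = "path_concat g (path_rev g')"
    have l: "loop_at ?E1 ?b1 ?l" using g g' by (simp add: loop_at_def pathin_concat pathin_rev)
    have w: "loop_at X x0 (?q1 \<circ> ?l)" by (rule loop_at_map[OF l c1(5,4)])
    have "loop_class X x0 (?q1 \<circ> ?l) \<in> cover_subgroup X x0 C2"
      using cover_subgroupI[OF C1 l] le by blast
    then obtain m where m: "loop_at ?E2 ?b2 m" "path_homotopic X (?q1 \<circ> ?l) (?q2 \<circ> m)"
      unfolding loop_class_in_cover_subgroup[OF C2 w] by blast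
    let ?K = "path_concat m k'"
    have K: "pathin ?E2 ?K" "?K 0 = k 0" "?K 1 = k' 1"
      using m k k' by (auto simp: loop_at_def pathin_concat)
    have q1g: "pathin X (?q1 \<circ> g)" and q1g': "pathin X (?q1 \<circ> g')" and q2k: "pathin X (?q2 \<circ> k)" and q2k': "pathin X (?q2 \<circ> k')"
      using g g' k k' c1(5) c2(5) by (auto intro: pathin_compose)
    have "path_homotopic X (?q2 \<circ> k) (?q1 \<circ> g)"
      using k(3) by (intro path_homotopic_cong[OF q2k]) auto
    also have "path_homotopic X \<dots> (path_concat (path_concat (?q1 \<circ> g) (path_rev (?q1 \<circ> g'))) (path_rev (path_rev (?q1 \<circ> g'))))"
      using g g' by (intro path_homotopic_sym[OF path_homotopic_rev_cancel_right] q1g pathin_rev q1g') simp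
    also have "\<dots> = path_concat (?q1 \<circ> ?l) (?q1 \<circ> g')"
      by (simp add: path_concat_map path_rev_map)
    also have "path_homotopic X \<dots> (path_concat (?q2 \<circ> m) (?q2 \<circ> k'))"
    proof (intro path_homotopic_concat m path_homotopic_sym[OF path_homotopic_cong[OF q2k']])
      show "(?q1 \<circ> ?l) 1 = (?q1 \<circ> g') 0" using g g' by simp
    qed (use k' in auto)
    also have "\<dots> = ?q2 \<circ> ?K" by (simp add: path_concat_map)
    finally have "path_homotopic X (?q2 \<circ> k) (?q2 \<circ> ?K)" .
    then show ?thesis using monodromy[OF c2(1) k(1) K(1)] K by simp
  qed
  define f where "f e = (SOME y. \<exists>g k. R e g k \<and> k 1 = y)" for e
  have f: "f e = k 1" if Rk: "R e g k" for e g k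
  proof -
    have "\<exists>y g k. R e g k \<and> k 1 = y" using Rk by blast
    from someI_ex[OF this] obtain g' k' where "R e g' k'" "k' 1 = f e" unfolding f_def by blast
    then show ?thesis using uniq[OF Rk, of g' k'] by simp
  qed
  have f_in: "f e \<in> topspace ?E2" "?q2 (f e) = ?q1 e" if e: "e \<in> topspace ?E1" for e
  proof -
    obtain g k where Rk: "R e g k" using ex[OF e] by blast
    then show "f e \<in> topspace ?E2" "?q2 (f e) = ?q1 e"
      using f[OF Rk] by (auto simp: R_def pathin_in_topspace)
  qed
  have fb: "f ?b1 = ?b2"
  proof -
    have "R ?b1 (\<lambda>_. ?b1) (\<lambda>_. ?b2)" using c1 c2 by (simp add: R_def)
    from f[OF this] show ?thesis .
  qed
  have "continuous_map ?E1 ?E2 f"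
    unfolding continuous_map_def
  proof (intro conjI allI impI)
    show "f \<in> topspace ?E1 \<rightarrow> topspace ?E2" using f_in by blast
    fix N assume N: "openin ?E2 N"
    show "openin ?E1 {e \<in> topspace ?E1. f e \<in> N}"
    proof (subst openin_subopen, intro ballI)
      fix e0 assume "e0 \<in> {e \<in> topspace ?E1. f e \<in> N}"
      then have e0: "e0 \<in> topspace ?E1" "f e0 \<in> N" by auto
      let ?x = "?q1 e0"
      have x: "?x \<in> topspace X" using c1(5) e0 by (auto simp: continuous_map_def)
      from covering_map_evenly_covered[OF c1(1) x] obtain U1 V1 where U1: "?x \<in> U1" "openin X U1"
        and V1: "\<Union>V1 = topspace ?E1 \<inter> ?q1 -` U1" "\<And>S. S \<in> V1 \<Longrightarrow> openin ?E1 S"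
          "\<And>S. S \<in> V1 \<Longrightarrow> homeomorphic_map (subtopology ?E1 S) (subtopology X U1) ?q1" by metis
      from covering_map_evenly_covered[OF c2(1) x] obtain U2 V2 where U2: "?x \<in> U2" "openin X U2"
        and V2: "\<Union>V2 = topspace ?E2 \<inter> ?q2 -` U2" "\<And>S. S \<in> V2 \<Longrightarrow> openin ?E2 S"
          "\<And>S. S \<in> V2 \<Longrightarrow> homeomorphic_map (subtopology ?E2 S) (subtopology X U2) ?q2" by metis
      have "e0 \<in> \<Union>V1" unfolding V1(1) using e0 U1 by auto
      then obtain S1 where S1: "S1 \<in> V1" "e0 \<in> S1" by blast
      have "f e0 \<in> \<Union>V2" unfolding V2(1) using f_in[OF e0(1)] U2 by auto
      then obtain S2 where S2: "S2 \<in> V2" "f e0 \<in> S2" by blast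
      let ?O = "?q2 ` (N \<inter> S2)"
      have "openin (subtopology ?E2 S2) (N \<inter> S2)" using N by (auto simp: openin_subtopology)
      then have "openin (subtopology X U2) ?O"
        using homeomorphic_map_openness[OF V2(3)[OF S2(1)], of "N \<inter> S2"] openin_subset by blast
      then have oO: "openin X ?O" and OU2: "?O \<subseteq> U2"
        using openin_trans_full U2(2) openin_subset by (blast, fastforce)
      have "?x \<in> ?O" using f_in(2)[OF e0(1)] e0 S2 by (intro image_eqI[of _ _ "f e0"]) auto
      then have "openin X (U1 \<inter> ?O)" "?x \<in> U1 \<inter> ?O" using oO U1 by auto
      \<comment> \<open>A point \<open>e\<close> of \<open>S1\<close> over \<open>V\<close> is
        joined to \<open>e0\<close> by the lift of a path in \<open>V\<close>. The same path lifts
        into \<open>S2\<close> from \<open>f e0\<close>, and these lifts prolong the paths defining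
        \<open>f e0\<close>; so \<open>f e\<close> lies in \<open>S2\<close> over \<open>?O\<close>,
        hence in \<open>N\<close>.\<close>
      then obtain V where V: "simple_open X V" "?x \<in> V" "V \<subseteq> U1 \<inter> ?O"
        using ex_simple_open_subset[OF X] by blast
      have oV: "openin X V" using V by (simp add: simple_open_def)
      let ?T = "S1 \<inter> {e \<in> topspace ?E1. ?q1 e \<in> V}"
      have "openin ?E1 ?T"
        using V1(2)[OF S1(1)] openin_continuous_map_preimage[OF c1(5) oV] by blast
      moreover have "e0 \<in> ?T" using e0 S1 V by simp
      moreover have "?T \<subseteq> {e \<in> topspace ?E1. f e \<in> N}"
      proof
        fix e assume e: "e \<in> ?T"
        then have eV: "?q1 e \<in> V" by blast
        obtain v where v: "pathin (subtopology X V) v" "v 0 = ?x" "v 1 = ?q1 e"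
          using V eV unfolding simple_open_def by blast
        have "V \<subseteq> U1" "V \<subseteq> U2" using V(3) OU2 by auto
        then have v1: "pathin (subtopology X U1) v" and v2: "pathin (subtopology X U2) v"
          using v(1) by (auto simp: pathin_subtopology)
        obtain a where a: "pathin ?E1 a" "a 0 = e0" "\<And>t. t \<in> {0..1} \<Longrightarrow> a t \<in> S1" "\<And>t. t \<in> {0..1} \<Longrightarrow> ?q1 (a t) = v t"
          using sheet_path_lift[OF V1(3)[OF S1(1)] S1(2) e0(1) v1] v by auto
        obtain b where b: "pathin ?E2 b" "b 0 = f e0" "\<And>t. t \<in> {0..1} \<Longrightarrow> b t \<in> S2" "\<And>t. t \<in> {0..1} \<Longrightarrow> ?q2 (b t) = v t"
          using sheet_path_lift[OF V2(3)[OF S2(1)] S2(2) f_in(1)[OF e0(1)] v2] v f_in(2)[OF e0(1)] by auto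
        have inj1: "inj_on ?q1 S1" using sheet_inj_on[OF V1(2,3)] S1 by blast
        have a1: "a 1 = e" using inj_onD[OF inj1, of "a 1" e] a(3)[of 1] a(4)[of 1] v e by auto
        obtain g k where Rk: "R e0 g k" using ex[OF e0(1)] by blast
        have k1: "k 1 = f e0" using f[OF Rk] by simp
        have "R e (path_concat g a) (path_concat k b)"
          using Rk a b a1 k1 unfolding R_def
          by (auto intro!: pathin_concat) (auto simp: path_concat_def)
        from f[OF this] have fe: "f e = b 1" by simp
        have "f e \<in> S2" "?q2 (f e) \<in> ?O" using fe b(3)[of 1] b(4)[of 1] v V eV by auto
        then obtain y where y: "y \<in> N" "y \<in> S2" "?q2 (f e) = ?q2 y" by blast
        have inj2: "inj_on ?q2 S2" using sheet_inj_on[OF V2(2,3)] S2 by blast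
        have "f e = y" using inj_onD[OF inj2 y(3) \<open>f e \<in> S2\<close> y(2)] .
        then show "e \<in> {e \<in> topspace ?E1. f e \<in> N}" using y e by simp
      qed
      ultimately show "\<exists>T. openin ?E1 T \<and> e0 \<in> T \<and> T \<subseteq> {e \<in> topspace ?E1. f e \<in> N}" by blast
    qed
  qed
  then show ?thesis unfolding covers_def using fb f_in by (intro exI[of _ f]) auto
qed

text \<open>A path from the base point and its image under \<open>f\<close> are two lifts of one
  path with the same start, so unique lifting applies.\<close>

lemma covers_endo_id:
  assumes C: "pc_cover X x0 C" and f: "continuous_map (total_space C) (total_space C) f"
    "f (base_point C) = base_point C" "\<forall>e\<in>topspace (total_space C). proj C e = proj C (f e)"
    and e: "e \<in> topspace (total_space C)"
  shows "f e = e"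
proof -
  note c = pc_coverD[OF C]
  obtain g where g: "pathin (total_space C) g" "g 0 = base_point C" "g 1 = e"
    using c(2,3) e unfolding path_connected_space_def by blast
  have "(f \<circ> g) 1 = g 1"
    using g f by (intro covering_map_unique_lift[OF c(1) pathin_compose[OF g(1) f(1)] g(1)])
      (auto simp: pathin_in_topspace)
  then show ?thesis using g by simp
qed

text \<open>Antisymmetry of \<open>\<succ>\<close> up to isomorphism: both composites are based
  endomorphisms of a cover and therefore identities.\<close>

lemma cover_iso_iff_covers:
  assumes C1: "pc_cover X x0 C1" and C2: "pc_cover X x0 C2"
  shows "cover_iso C1 C2 \<longleftrightarrow> C1 \<succ> C2 \<and> C2 \<succ> C1"
proof
  assume "cover_iso C1 C2"
  then obtain f where f: "homeomorphic_map (total_space C1) (total_space C2) f" "f (base_point C1) = base_point C2"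
     "\<forall>e\<in>topspace (total_space C1). proj C1 e = proj C2 (f e)" unfolding cover_iso_def by blast
  obtain g where "homeomorphic_maps (total_space C1) (total_space C2) f g"
    using f(1) homeomorphic_map_maps by blast
  then have g: "continuous_map (total_space C1) (total_space C2) f" "continuous_map (total_space C2) (total_space C1) g"
    "\<And>x. x \<in> topspace (total_space C1) \<Longrightarrow> g (f x) = x" "\<And>y. y \<in> topspace (total_space C2) \<Longrightarrow> f (g y) = y"
    by (auto simp: homeomorphic_maps_def)
  have "C1 \<succ> C2" unfolding covers_def using f g by blast
  moreover have "C2 \<succ> C1" unfolding covers_def
  proof (intro exI[of _ g] conjI ballI g(2))
    show "g (base_point C2) = base_point C1" using g(3) pc_coverD(3)[OF C1] f(2) by metis
    fix e assume e: "e \<in> topspace (total_space C2)"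
    then have "g e \<in> topspace (total_space C1)" using g(2) by (auto simp: continuous_map_def)
    then show "proj C2 e = proj C1 (g e)" using f(3) g(4)[OF e] by simp
  qed
  ultimately show "C1 \<succ> C2 \<and> C2 \<succ> C1" by simp
next
  assume "C1 \<succ> C2 \<and> C2 \<succ> C1"
  then obtain f g where f: "continuous_map (total_space C1) (total_space C2) f" "f (base_point C1) = base_point C2"
      "\<forall>e\<in>topspace (total_space C1). proj C1 e = proj C2 (f e)"
    and g: "continuous_map (total_space C2) (total_space C1) g" "g (base_point C2) = base_point C1"
      "\<forall>e\<in>topspace (total_space C2). proj C2 e = proj C1 (g e)"
    unfolding covers_def by blast
  have fin: "f e \<in> topspace (total_space C2)" if "e \<in> topspace (total_space C1)" for e
    using f(1) that by (auto simp: continuous_map_def)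
  have gin: "g e \<in> topspace (total_space C1)" if "e \<in> topspace (total_space C2)" for e
    using g(1) that by (auto simp: continuous_map_def)
  have "(g \<circ> f) e = e" if "e \<in> topspace (total_space C1)" for e
    using f g fin by (intro covers_endo_id[OF C1 continuous_map_compose[OF f(1) g(1)] _ _ that]) auto
  moreover have "(f \<circ> g) e = e" if "e \<in> topspace (total_space C2)" for e
    using f g gin by (intro covers_endo_id[OF C2 continuous_map_compose[OF g(1) f(1)] _ _ that]) auto
  ultimately have "homeomorphic_maps (total_space C1) (total_space C2) f g"
    using f g by (simp add: homeomorphic_maps_def)
  then have "homeomorphic_map (total_space C1) (total_space C2) f" using homeomorphic_map_maps by blast
  then show "cover_iso C1 C2" unfolding cover_iso_def using f by blast
qed

lemma covers_iff_subgroup_le: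
  assumes "neighbourhood_base_of (simple_open X) X" "pc_cover X x0 C1" "pc_cover X x0 C2"
  shows "C1 \<succ> C2 \<longleftrightarrow> cover_subgroup X x0 C1 \<subseteq> cover_subgroup X x0 C2"
  using covers_if_subgroup_le covers_imp_subgroup_le assms by metis

lemma cover_iso_iff_subgroup_eq:
  assumes "neighbourhood_base_of (simple_open X) X" "pc_cover X x0 C1" "pc_cover X x0 C2"
  shows "cover_iso C1 C2 \<longleftrightarrow> cover_subgroup X x0 C1 = cover_subgroup X x0 C2"
  using cover_iso_iff_covers[OF assms(2,3)] covers_iff_subgroup_le[OF assms]
    covers_iff_subgroup_le[OF assms(1,3,2)] by (simp add: set_eq_subset)

lemma trivial_cover:
  assumes x0: "x0 \<in> topspace X" and X: "path_connected_space X"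
  shows "pc_cover X x0 (trivial_cover X x0)"
    and "cover_subgroup X x0 (trivial_cover X x0) = carrier (fundamental_group X x0)"
proof -
  have id: "homeomorphic_map Y Y (\<lambda>x. x)" for Y :: "'a topology"
    using homeomorphic_map_id[of Y Y] by (simp add: id_def)
  have "covering_map X (\<lambda>x. x) X"
    unfolding covering_map_def
  proof (intro conjI ballI)
    fix x assume "x \<in> topspace X"
    then show "\<exists>U. x \<in> U \<and> openin X U \<and> (\<exists>\<V>. \<Union>\<V> = topspace X \<inter> (\<lambda>x. x) -` U \<and> (\<forall>S\<in>\<V>. openin X S) \<and>
        pairwise disjnt \<V> \<and> (\<forall>S\<in>\<V>. homeomorphic_map (subtopology X S) (subtopology X U) (\<lambda>x. x)))"
      using id by (intro exI[of _ "topspace X"] conjI exI[of _ "{topspace X}"]) auto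
  qed auto
  then show C: "pc_cover X x0 (trivial_cover X x0)"
    using assms by (simp add: pc_cover_def trivial_cover_def)
  show "cover_subgroup X x0 (trivial_cover X x0) = carrier (fundamental_group X x0)"
    unfolding cover_subgroup_eq[OF C] by (auto simp: trivial_cover_def carrier_fundamental_group o_def)
qed


section \<open>The cover of a subgroup\<close>

text \<open>
  The predicate \<open>L\<close> singles out the loops whose class lies in a given subgroup \<open>H\<close> of the fundamental
  group. Points of the cover are the classes of paths starting at \<open>x0\<close> modulo \<open>w \<mapsto> l \<cdot> w\<close> with \<open>L l\<close>.
\<close>

locale loop_group =
  fixes X :: "'a topology" and x0 :: 'a and L :: "(real \<Rightarrow> 'a) \<Rightarrow> bool"
  assumes simple_base: "neighbourhood_base_of (simple_open X) X"
    and path_conn: "path_connected_space X"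
    and x0_in: "x0 \<in> topspace X"
    and loop: "L l \<Longrightarrow> loop_at X x0 l"
    and const: "L (\<lambda>_. x0)"
    and concat: "L l \<Longrightarrow> L l' \<Longrightarrow> L (path_concat l l')"
    and rev: "L l \<Longrightarrow> L (path_rev l)"
    and homotopic: "L l \<Longrightarrow> path_homotopic X l l' \<Longrightarrow> L l'"
begin

section \<open>Based paths modulo the loops in \<open>L\<close>\<close>

definition based :: "(real \<Rightarrow> 'a) \<Rightarrow> bool" where
  "based w \<longleftrightarrow> pathin X w \<and> w 0 = x0"

definition eqv :: "(real \<Rightarrow> 'a) \<Rightarrow> (real \<Rightarrow> 'a) \<Rightarrow> bool" where
  "eqv w w' \<longleftrightarrow> (\<exists>l. L l \<and> path_homotopic X w' (path_concat l w))"

definition cls :: "(real \<Rightarrow> 'a) \<Rightarrow> (real \<Rightarrow> 'a) set" where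
  "cls w = {w'. eqv w w'}"

text \<open>All paths in a class have the same end point, so the choice of a representative does not
  matter; see \<open>prj_cls\<close>.\<close>

definition prj :: "(real \<Rightarrow> 'a) set \<Rightarrow> 'a" where
  "prj e = (SOME w. w \<in> e) 1"

lemma based_const: "based (\<lambda>_. x0)"
  using x0_in by (simp add: based_def)

lemma loopD: "L l \<Longrightarrow> pathin X l \<and> l 0 = x0 \<and> l 1 = x0"
  using loop[of l] unfolding loop_at_def by blast

lemma based_end: "based w \<Longrightarrow> w 1 \<in> topspace X"
  by (simp add: based_def pathin_in_topspace)

lemma eqv_ends: "based w \<Longrightarrow> eqv w w' \<Longrightarrow> based w' \<and> w' 1 = w 1"
  using path_homotopic_ends path_homotopic_pathin loopD unfolding eqv_def based_def
  by (metis path_concat_ends)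

lemma eqv_if_homotopic:
  assumes w: "based w" and h: "path_homotopic X w w'"
  shows "eqv w w'"
proof -
  have "path_homotopic X w' w" using h by (rule path_homotopic_sym)
  also have "path_homotopic X w (path_concat (\<lambda>_. x0) w)"
    using path_homotopic_sym[OF path_homotopic_const_left[of X w]] w by (simp add: based_def)
  finally show ?thesis using const by (auto simp: eqv_def)
qed

lemma eqv_refl: "based w \<Longrightarrow> eqv w w"
  by (rule eqv_if_homotopic) (auto simp: based_def)

lemma eqv_sym:
  assumes w: "based w" and e: "eqv w w'"
  shows "eqv w' w"
proof -
  obtain l where l: "L l" "path_homotopic X w' (path_concat l w)" using e by (auto simp: eqv_def)
  have l': "pathin X l" "l 0 = x0" "l 1 = x0" and w': "pathin X w" "w 0 = x0"
    using loopD[OF l(1)] w by (auto simp: based_def)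
  have "path_homotopic X (path_concat (path_rev l) w') (path_concat (path_rev l) (path_concat l w))"
    using l l' path_homotopic_ends[OF l(2)] by (intro path_homotopic_concat) (auto simp: pathin_rev)
  also have "path_homotopic X \<dots> w"
    using l' w' by (intro path_homotopic_rev_cancel_left) auto
  finally show ?thesis using rev[OF l(1)] path_homotopic_sym by (auto simp: eqv_def)
qed

lemma eqv_trans:
  assumes w: "based w" and e: "eqv w w'" "eqv w' w''"
  shows "eqv w w''"
proof -
  obtain l where l: "L l" "path_homotopic X w' (path_concat l w)" using e by (auto simp: eqv_def)
  obtain m where m: "L m" "path_homotopic X w'' (path_concat m w')" using e by (auto simp: eqv_def)
  have l': "pathin X l" "l 0 = x0" "l 1 = x0" and m': "pathin X m" "m 0 = x0" "m 1 = x0" and w': "pathin X w" "w 0 = x0"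
    using loopD[OF l(1)] loopD[OF m(1)] w by (auto simp: based_def)
  note m(2)
  also have "path_homotopic X (path_concat m w') (path_concat m (path_concat l w))"
    using l(2) m' l' path_homotopic_ends[OF l(2)] by (intro path_homotopic_concat) auto
  also have "path_homotopic X \<dots> (path_concat (path_concat m l) w)"
    using l' m' w' by (intro path_homotopic_sym[OF path_homotopic_assoc]) auto
  finally show ?thesis using concat[OF m(1) l(1)] by (auto simp: eqv_def)
qed

lemma eqv_concat:
  assumes w: "based w" and e: "eqv w w'" and u: "pathin X u" "u 0 = w 1"
  shows "eqv (path_concat w u) (path_concat w' u)"
proof -
  obtain l where l: "L l" "path_homotopic X w' (path_concat l w)" using e by (auto simp: eqv_def)
  have l': "pathin X l" "l 0 = x0" "l 1 = x0" and w': "pathin X w" "w 0 = x0"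
    using loopD[OF l(1)] w by (auto simp: based_def)
  have "path_homotopic X (path_concat w' u) (path_concat (path_concat l w) u)"
    using l(2) u path_homotopic_ends[OF l(2)] by (intro path_homotopic_concat) auto
  also have "path_homotopic X \<dots> (path_concat l (path_concat w u))"
    using l' w' u by (intro path_homotopic_assoc) auto
  finally show ?thesis using l(1) by (auto simp: eqv_def)
qed

lemma cls_eq_iff:
  assumes "based w" "based w'"
  shows "cls w = cls w' \<longleftrightarrow> eqv w w'"
proof
  assume "cls w = cls w'"
  then have "w' \<in> cls w" using eqv_refl[OF assms(2)] by (simp add: cls_def)
  then show "eqv w w'" by (simp add: cls_def)
next
  assume e: "eqv w w'"
  have "eqv w v \<longleftrightarrow> eqv w' v" for v
    using eqv_trans[OF assms(1) e, of v] eqv_trans[OF assms(2) eqv_sym[OF assms(1) e], of v] by blast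
  then show "cls w = cls w'" by (simp add: cls_def)
qed

lemma prj_cls:
  assumes "based w" shows "prj (cls w) = w 1"
proof -
  have "w \<in> cls w" using eqv_refl[OF assms] by (simp add: cls_def)
  then have "(SOME w'. w' \<in> cls w) \<in> cls w" by (rule someI[of "\<lambda>w'. w' \<in> cls w"])
  then show ?thesis using eqv_ends[OF assms] by (simp add: prj_def cls_def)
qed

section \<open>The topology on the classes of paths\<close>

definition points :: "(real \<Rightarrow> 'a) set set" where "points = cls ` {w. based w}"

text \<open>A set is open if with a class it contains all its prolongations along short paths.
  Stated in this way, for all representatives, the axioms of a topology follow directly and no base
  has to be verified.\<close>

definition cover_open :: "(real \<Rightarrow> 'a) set set \<Rightarrow> bool" where
  "cover_open S \<longleftrightarrow> S \<subseteq> points \<and> (\<forall>w. based w \<longrightarrow> cls w \<in> S \<longrightarrow>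
     (\<exists>V. openin X V \<and> w 1 \<in> V \<and> (\<forall>u. pathin (subtopology X V) u \<longrightarrow> u 0 = w 1 \<longrightarrow> cls (path_concat w u) \<in> S)))"

definition cover_top :: "(real \<Rightarrow> 'a) set topology" where "cover_top = topology cover_open"

lemma openin_cover_top: "openin cover_top = cover_open"
proof -
  have "istopology cover_open"
    unfolding istopology_def
  proof (intro conjI allI impI)
    fix S T assume S: "cover_open S" and T: "cover_open T"
    show "cover_open (S \<inter> T)"
      unfolding cover_open_def
    proof (intro conjI allI impI)
      show "S \<inter> T \<subseteq> points" using S by (auto simp: cover_open_def)
      fix w assume w: "based w" "cls w \<in> S \<inter> T"
      obtain V where V: "openin X V" "w 1 \<in> V" "\<forall>u. pathin (subtopology X V) u \<longrightarrow> u 0 = w 1 \<longrightarrow> cls (path_concat w u) \<in> S"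
        using S w unfolding cover_open_def by blast
      obtain W where W: "openin X W" "w 1 \<in> W" "\<forall>u. pathin (subtopology X W) u \<longrightarrow> u 0 = w 1 \<longrightarrow> cls (path_concat w u) \<in> T"
        using T w unfolding cover_open_def by blast
      show "\<exists>V. openin X V \<and> w 1 \<in> V \<and> (\<forall>u. pathin (subtopology X V) u \<longrightarrow> u 0 = w 1 \<longrightarrow> cls (path_concat w u) \<in> S \<inter> T)"
        using V W by (intro exI[of _ "V \<inter> W"]) (auto simp: pathin_subtopology)
    qed
  next
    fix \<K> assume K: "\<forall>S\<in>\<K>. cover_open S"
    show "cover_open (\<Union>\<K>)"
      unfolding cover_open_def
    proof (intro conjI allI impI)
      show "\<Union>\<K> \<subseteq> points" using K by (auto simp: cover_open_def)
      fix w assume w: "based w" "cls w \<in> \<Union>\<K>"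
      then obtain S where S: "S \<in> \<K>" "cls w \<in> S" by blast
      then obtain V where "openin X V" "w 1 \<in> V" "\<forall>u. pathin (subtopology X V) u \<longrightarrow> u 0 = w 1 \<longrightarrow> cls (path_concat w u) \<in> S"
        using K w(1) unfolding cover_open_def by metis
      then show "\<exists>V. openin X V \<and> w 1 \<in> V \<and> (\<forall>u. pathin (subtopology X V) u \<longrightarrow> u 0 = w 1 \<longrightarrow> cls (path_concat w u) \<in> \<Union>\<K>)"
        using S(1) by blast
    qed
  qed
  then show ?thesis unfolding cover_top_def by (rule topology_inverse')
qed

lemma based_concat: "\<lbrakk>based w; pathin X u; u 0 = w 1\<rbrakk> \<Longrightarrow> based (path_concat w u)"
  by (simp add: based_def pathin_concat)

lemma cls_in_points: "based w \<Longrightarrow> cls w \<in> points"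
  by (simp add: points_def)

lemma topspace_cover_top: "topspace cover_top = points"
proof
  show "topspace cover_top \<subseteq> points"
    using openin_topspace[of cover_top] by (auto simp: openin_cover_top cover_open_def)
  have "cover_open points"
    unfolding cover_open_def
  proof (intro conjI allI impI)
    fix w assume w: "based w"
    then show "\<exists>V. openin X V \<and> w 1 \<in> V \<and> (\<forall>u. pathin (subtopology X V) u \<longrightarrow> u 0 = w 1 \<longrightarrow> cls (path_concat w u) \<in> points)"
      by (intro exI[of _ "topspace X"])
        (auto simp: based_end intro!: cls_in_points based_concat)
  qed simp
  then show "points \<subseteq> topspace cover_top"
    using openin_subset[of cover_top points] by (simp add: openin_cover_top)
qed

text \<open>The usual basic neighbourhood of the class of \<open>w\<close> over \<open>V\<close>.
  For simple open \<open>V\<close> around the end of \<open>w\<close> it becomes a sheet of the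
  covering.\<close>

definition sheet :: "(real \<Rightarrow> 'a) \<Rightarrow> 'a set \<Rightarrow> (real \<Rightarrow> 'a) set set" where
  "sheet w V = {cls (path_concat w u) | u. pathin (subtopology X V) u \<and> u 0 = w 1}"

text \<open>Prolonging within \<open>V\<close> a prolongation of \<open>w\<close> within
  \<open>V\<close> gives, after reassociation, another prolongation of \<open>w\<close> within
  \<open>V\<close>.\<close>

lemma openin_sheet:
  assumes w: "based w" and V: "openin X V"
  shows "openin cover_top (sheet w V)"
  unfolding openin_cover_top cover_open_def
proof (intro conjI allI impI)
  show "sheet w V \<subseteq> points"
    using w by (auto simp: sheet_def pathin_subtopology intro!: cls_in_points based_concat)
  fix w' assume w': "based w'" "cls w' \<in> sheet w V"
  then obtain u where u: "pathin (subtopology X V) u" "u 0 = w 1" "cls w' = cls (path_concat w u)"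
    by (auto simp: sheet_def)
  have uX: "pathin X u" "u 1 \<in> V" using u(1) by (auto simp: pathin_subtopology)
  have bu: "based (path_concat w u)" using based_concat w uX u by blast
  have e: "eqv (path_concat w u) w'" using cls_eq_iff[OF bu w'(1)] u(3) by simp
  have w1: "w' 1 = u 1" using eqv_ends[OF bu e] by simp
  show "\<exists>V'. openin X V' \<and> w' 1 \<in> V' \<and> (\<forall>u. pathin (subtopology X V') u \<longrightarrow> u 0 = w' 1 \<longrightarrow> cls (path_concat w' u) \<in> sheet w V)"
  proof (intro exI[of _ V] conjI allI impI)
    fix v assume v: "pathin (subtopology X V) v" "v 0 = w' 1"
    have vX: "pathin X v" using v by (simp add: pathin_subtopology)
    have uv: "pathin (subtopology X V) (path_concat u v)" using u v w1 by (intro pathin_concat) auto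
    have uvX: "pathin X (path_concat u v)" using uv by (simp add: pathin_subtopology)
    have b1: "based (path_concat w (path_concat u v))" using based_concat[OF w uvX] u(2) by simp
    have b2: "based (path_concat w' v)" using based_concat[OF w'(1) vX v(2)] .
    have "path_homotopic X (path_concat w (path_concat u v)) (path_concat (path_concat w u) v)"
      using w uX vX v w1 u(2) by (intro path_homotopic_sym[OF path_homotopic_assoc]) (auto simp: based_def)
    then have e1: "eqv (path_concat w (path_concat u v)) (path_concat (path_concat w u) v)"
      by (rule eqv_if_homotopic[OF b1])
    have e2: "eqv (path_concat (path_concat w u) v) (path_concat w' v)"
      using eqv_concat[OF bu e vX] v(2) w1 by simp
    have "cls (path_concat w' v) = cls (path_concat w (path_concat u v))"
      using eqv_trans[OF b1 e1 e2] cls_eq_iff[OF b1 b2] by simp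
    then show "cls (path_concat w' v) \<in> sheet w V" using uv u(2) by (auto simp: sheet_def)
  qed (use V uX w1 in auto)
qed

lemma prj_concat: "\<lbrakk>based w; pathin X u; u 0 = w 1\<rbrakk> \<Longrightarrow> prj (cls (path_concat w u)) = u 1"
  using prj_cls[OF based_concat] by simp

lemma prj_in_topspace: "e \<in> points \<Longrightarrow> prj e \<in> topspace X"
  by (auto simp: points_def prj_cls based_end)

lemma continuous_prj: "continuous_map cover_top X prj"
  unfolding continuous_map_def topspace_cover_top
proof (intro conjI allI impI)
  show "prj \<in> points \<rightarrow> topspace X" using prj_in_topspace by blast
  fix W assume W: "openin X W"
  show "openin cover_top {e \<in> points. prj e \<in> W}"
    unfolding openin_cover_top cover_open_def
  proof (intro conjI allI impI)
    fix w assume w: "based w" "cls w \<in> {e \<in> points. prj e \<in> W}"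
    then have "w 1 \<in> W" by (simp add: prj_cls)
    moreover have "cls (path_concat w u) \<in> {e \<in> points. prj e \<in> W}" if "pathin (subtopology X W) u" "u 0 = w 1" for u
      using w(1) that by (auto simp: pathin_subtopology prj_concat intro!: cls_in_points based_concat)
    ultimately show "\<exists>V. openin X V \<and> w 1 \<in> V \<and>
        (\<forall>u. pathin (subtopology X V) u \<longrightarrow> u 0 = w 1 \<longrightarrow> cls (path_concat w u) \<in> {e \<in> points. prj e \<in> W})"
      using W by blast
  qed auto
qed

text \<open>Inside a path connected open subset of the given neighbourhood every point is reached by
  a prolongation, so the image contains that whole subset.\<close>

lemma open_prj:
  assumes S: "openin cover_top S" shows "openin X (prj ` S)"
proof (subst openin_subopen, intro ballI)
  fix x assume "x \<in> prj ` S"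
  then obtain w where w: "based w" "cls w \<in> S" "x = w 1"
    using openin_subset[OF S] prj_cls by (auto simp: topspace_cover_top points_def)
  obtain V where V: "openin X V" "w 1 \<in> V" "\<forall>u. pathin (subtopology X V) u \<longrightarrow> u 0 = w 1 \<longrightarrow> cls (path_concat w u) \<in> S"
    using S w unfolding openin_cover_top cover_open_def by blast
  obtain V' where V': "simple_open X V'" "w 1 \<in> V'" "V' \<subseteq> V"
    using ex_simple_open_subset[OF simple_base V(1,2)] by blast
  have "V' \<subseteq> prj ` S"
  proof
    fix y assume "y \<in> V'"
    then obtain u where u: "pathin (subtopology X V') u" "u 0 = w 1" "u 1 = y"
      using V' unfolding simple_open_def by blast
    have "pathin (subtopology X V) u" "pathin X u" using u V' by (auto simp: pathin_subtopology)
    then have "cls (path_concat w u) \<in> S" "prj (cls (path_concat w u)) = y"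
      using V(3) u prj_concat[OF w(1)] by auto
    then show "y \<in> prj ` S" by force
  qed
  then show "\<exists>T. openin X T \<and> x \<in> T \<and> T \<subseteq> prj ` S"
    using V' w unfolding simple_open_def by blast
qed

text \<open>Both halves of \<open>simple_open\<close> enter: path connectedness of \<open>V\<close>
  gives surjectivity, and the homotopy of paths in \<open>V\<close> with equal ends gives
  injectivity.\<close>

lemma homeomorphic_sheet:
  assumes w: "based w" "w 1 \<in> V" and V: "simple_open X V"
  shows "homeomorphic_map (subtopology cover_top (sheet w V)) (subtopology X V) prj"
proof (rule bijective_open_imp_homeomorphic_map)
  have oV: "openin X V" using V by (simp add: simple_open_def)
  have oS: "openin cover_top (sheet w V)" using openin_sheet w oV by blast
  have top: "topspace (subtopology cover_top (sheet w V)) = sheet w V"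
    using openin_subset[OF oS] by auto
  have topV: "topspace (subtopology X V) = V" using openin_subset[OF oV] by auto
  have prj_sheet: "prj e \<in> V" if "e \<in> sheet w V" for e
    using that w by (auto simp: sheet_def pathin_subtopology prj_concat)
  show "continuous_map (subtopology cover_top (sheet w V)) (subtopology X V) prj"
    using continuous_prj prj_sheet top by (auto simp: continuous_map_in_subtopology continuous_map_from_subtopology)
  show "open_map (subtopology cover_top (sheet w V)) (subtopology X V) prj"
    unfolding open_map_def
  proof (intro allI impI)
    fix O' assume "openin (subtopology cover_top (sheet w V)) O'"
    then have O': "openin cover_top O'" "O' \<subseteq> sheet w V" using oS by (auto simp: openin_open_subtopology)
    then show "openin (subtopology X V) (prj ` O')"
      using open_prj[OF O'(1)] prj_sheet oV by (auto simp: openin_open_subtopology)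
  qed
  show "prj ` topspace (subtopology cover_top (sheet w V)) = topspace (subtopology X V)"
    unfolding top topV
  proof
    show "prj ` sheet w V \<subseteq> V" using prj_sheet by blast
    show "V \<subseteq> prj ` sheet w V"
    proof
      fix y assume "y \<in> V"
      then obtain u where u: "pathin (subtopology X V) u" "u 0 = w 1" "u 1 = y"
        using V w(2) unfolding simple_open_def by blast
      then have "cls (path_concat w u) \<in> sheet w V" "prj (cls (path_concat w u)) = y"
        using prj_concat[OF w(1)] by (auto simp: sheet_def pathin_subtopology)
      then show "y \<in> prj ` sheet w V" by force
    qed
  qed
  show "inj_on prj (topspace (subtopology cover_top (sheet w V)))"
    unfolding top
  proof (rule inj_onI)
    fix e e' assume "e \<in> sheet w V" "e' \<in> sheet w V" and eq: "prj e = prj e'"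
    then obtain u u' where u: "pathin (subtopology X V) u" "u 0 = w 1" "e = cls (path_concat w u)"
      and u': "pathin (subtopology X V) u'" "u' 0 = w 1" "e' = cls (path_concat w u')"
      by (auto simp: sheet_def)
    have X: "pathin X u" "pathin X u'" using u u' by (auto simp: pathin_subtopology)
    have "u 1 = u' 1" using eq u u' X prj_concat[OF w(1)] by simp
    then have "path_homotopic X u u'" using V u u' unfolding simple_open_def by simp
    then have "path_homotopic X (path_concat w u) (path_concat w u')"
      using w u by (intro path_homotopic_concat) (auto simp: based_def)
    then have "eqv (path_concat w u) (path_concat w u')"
      using w X u by (intro eqv_if_homotopic based_concat) auto
    then show "e = e'" using cls_eq_iff[OF based_concat based_concat] w(1) X u u' by simp
  qed
qed

text \<open>If the classes of \<open>w\<close> prolonged by \<open>u\<close> and \<open>w'\<close>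
  prolonged by \<open>u'\<close> agree, then \<open>w\<close> is equivalent to \<open>w'\<close>
  prolonged by \<open>u'\<close> and the reverse of \<open>u\<close>. That detour stays in
  \<open>V\<close>, so every prolongation of \<open>w\<close> is one of \<open>w'\<close>. By
  symmetry, sheets that meet are equal.\<close>

lemma sheet_subset:
  assumes w: "based w" "based w'" and e: "e \<in> sheet w V" "e \<in> sheet w' V"
  shows "sheet w V \<subseteq> sheet w' V"
proof
  obtain u u' where u: "pathin (subtopology X V) u" "u 0 = w 1" "e = cls (path_concat w u)"
    and u': "pathin (subtopology X V) u'" "u' 0 = w' 1" "e = cls (path_concat w' u')"
    using e by (auto simp: sheet_def)
  have X: "pathin X u" "pathin X u'" using u u' by (auto simp: pathin_subtopology)
  have b: "based (path_concat w u)" "based (path_concat w' u')" using based_concat w X u u' by auto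
  have e1: "eqv (path_concat w u) (path_concat w' u')" using cls_eq_iff[OF b] u(3) u'(3) by simp
  have u1: "u' 1 = u 1" using eqv_ends[OF b(1) e1] by simp
  let ?c = "path_concat u' (path_rev u)"
  have c: "pathin (subtopology X V) ?c" "?c 0 = w' 1" "?c 1 = w 1"
    using u u' u1 by (auto intro!: pathin_concat pathin_rev)
  have cX: "pathin X ?c" using c by (simp add: pathin_subtopology)
  have "eqv w (path_concat (path_concat w u) (path_rev u))"
    using w(1) X u by (intro eqv_if_homotopic path_homotopic_sym[OF path_homotopic_rev_cancel_right]) (auto simp: based_def)
  moreover have "eqv (path_concat (path_concat w u) (path_rev u)) (path_concat (path_concat w' u') (path_rev u))"
    using b e1 X by (intro eqv_concat pathin_rev) auto
  moreover have "eqv (path_concat (path_concat w' u') (path_rev u)) (path_concat w' ?c)"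
    using b w X u' u1
    by (intro eqv_if_homotopic path_homotopic_assoc based_concat pathin_rev) (auto simp: based_def)
  ultimately have wc: "eqv w (path_concat w' ?c)" using eqv_trans[OF w(1)] by blast
  fix d assume "d \<in> sheet w V"
  then obtain v where v: "pathin (subtopology X V) v" "v 0 = w 1" "d = cls (path_concat w v)"
    by (auto simp: sheet_def)
  have vX: "pathin X v" using v by (simp add: pathin_subtopology)
  have "eqv (path_concat w v) (path_concat (path_concat w' ?c) v)"
    using eqv_concat[OF w(1) wc vX v(2)] .
  moreover have "eqv (path_concat (path_concat w' ?c) v) (path_concat w' (path_concat ?c v))"
    using w vX cX c v by (intro eqv_if_homotopic path_homotopic_assoc based_concat) (auto simp: based_def)
  ultimately have "eqv (path_concat w v) (path_concat w' (path_concat ?c v))"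
    using eqv_trans[OF based_concat[OF w(1) vX v(2)]] by blast
  moreover have cv: "pathin (subtopology X V) (path_concat ?c v)"
    using pathin_concat[OF c(1) v(1)] c(3) v(2) by simp
  moreover have "based (path_concat w' (path_concat ?c v))"
    using w(2) cv c by (intro based_concat) (auto simp: pathin_subtopology)
  ultimately have "d = cls (path_concat w' (path_concat ?c v))"
    using cls_eq_iff[OF based_concat[OF w(1) vX v(2)]] v(3) by simp
  then show "d \<in> sheet w' V" unfolding sheet_def using cv c(2)
    by (intro CollectI exI[of _ "path_concat ?c v"]) auto
qed

lemma covering_prj: "covering_map cover_top prj X"
  unfolding covering_map_def
proof (intro conjI ballI)
  show "continuous_map cover_top X prj" by (rule continuous_prj)
  show "prj ` topspace cover_top = topspace X"
  proof
    show "prj ` topspace cover_top \<subseteq> topspace X" using prj_in_topspace by (auto simp: topspace_cover_top)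
    show "topspace X \<subseteq> prj ` topspace cover_top"
    proof
      fix x assume "x \<in> topspace X"
      then obtain w where "pathin X w" "w 0 = x0" "w 1 = x"
        using path_conn x0_in unfolding path_connected_space_def by blast
      then have "based w" "prj (cls w) = x" using prj_cls by (auto simp: based_def)
      then show "x \<in> prj ` topspace cover_top" using cls_in_points topspace_cover_top by force
    qed
  qed
  fix x assume "x \<in> topspace X"
  then obtain V where V: "simple_open X V" "x \<in> V"
    using ex_simple_open_subset[OF simple_base openin_topspace] by blast
  have oV: "openin X V" using V by (simp add: simple_open_def)
  let ?\<V> = "{sheet w V | w. based w \<and> w 1 \<in> V}"
  have "\<Union>?\<V> = topspace cover_top \<inter> prj -` V"
  proof
    show "\<Union>?\<V> \<subseteq> topspace cover_top \<inter> prj -` V"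
      using openin_subset[OF openin_sheet[OF _ oV]] by (auto simp: sheet_def pathin_subtopology prj_concat)
    show "topspace cover_top \<inter> prj -` V \<subseteq> \<Union>?\<V>"
    proof
      fix e assume "e \<in> topspace cover_top \<inter> prj -` V"
      then obtain w where w: "based w" "e = cls w" "w 1 \<in> V"
        using prj_cls by (auto simp: topspace_cover_top points_def)
      have c: "pathin (subtopology X V) (\<lambda>_. w 1)" "pathin X (\<lambda>_. w 1)"
        using w openin_subset[OF oV] by auto
      have "path_homotopic X w (path_concat w (\<lambda>_. w 1))"
        using w by (intro path_homotopic_sym[OF path_homotopic_const_right]) (simp add: based_def)
      then have "e = cls (path_concat w (\<lambda>_. w 1))"
        using w cls_eq_iff[OF w(1) based_concat[OF w(1) c(2)]] eqv_if_homotopic by simp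
      then have "e \<in> sheet w V" using c(1) by (auto simp: sheet_def)
      then show "e \<in> \<Union>?\<V>" using w by blast
    qed
  qed
  moreover have "\<forall>S\<in>?\<V>. openin cover_top S" using openin_sheet oV by blast
  moreover have "pairwise disjnt ?\<V>"
  proof (rule pairwiseI)
    fix S T assume ST: "S \<in> ?\<V>" "T \<in> ?\<V>" "S \<noteq> T"
    then obtain w w' where w: "based w" "S = sheet w V" "based w'" "T = sheet w' V" by blast
    show "disjnt S T"
    proof (rule ccontr)
      assume "\<not> disjnt S T"
      then obtain e where "e \<in> S" "e \<in> T" by (auto simp: disjnt_def)
      then have "S = T" using sheet_subset[of w w' e V] sheet_subset[of w' w e V] w by blast
      then show False using ST by simp
    qed
  qed
  moreover have "\<forall>S\<in>?\<V>. homeomorphic_map (subtopology cover_top S) (subtopology X V) prj"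
    using homeomorphic_sheet V by blast
  ultimately show "\<exists>U. x \<in> U \<and> openin X U \<and>
        (\<exists>\<V>. \<Union>\<V> = topspace cover_top \<inter> prj -` U \<and> (\<forall>S\<in>\<V>. openin cover_top S) \<and> pairwise disjnt \<V> \<and>
              (\<forall>S\<in>\<V>. homeomorphic_map (subtopology cover_top S) (subtopology X U) prj))"
    using V oV by blast
qed

section \<open>Lifts of paths and the subgroup of the constructed cover\<close>

definition initial :: "(real \<Rightarrow> 'a) \<Rightarrow> real \<Rightarrow> real \<Rightarrow> 'a" where
  "initial w t = (\<lambda>s. w (t * s))"

lemma based_initial:
  assumes "based w" "t \<in> {0..1}" shows "based (initial w t)"
proof -
  have "pathin X (w \<circ> (\<lambda>s. t * s))"
    using assms by (intro pathin_reparam) (auto simp: based_def mult_le_one intro!: continuous_intros)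
  then show ?thesis using assms(1) by (simp add: based_def initial_def o_def)
qed

text \<open>Running to time \<open>t\<close> and from there along \<open>w\<close> to time
  \<open>t'\<close> is a reparametrisation of running straight to \<open>t'\<close>. As
  \<open>t'\<close> may also precede \<open>t\<close>, continuity of the lift follows from both
  sides at once.\<close>

lemma initial_extend:
  assumes w: "based w" and t: "t \<in> {0..1}" "t' \<in> {0..1}"
  shows "path_homotopic X (path_concat (initial w t) (\<lambda>s. w (t + (t' - t) * s))) (initial w t')"
proof -
  let ?\<phi> = "path_concat (\<lambda>s. t * s) (\<lambda>s. t + (t' - t) * s)"
  have ran: "t + (t' - t) * s \<in> {0..1}" if "s \<in> {0..1}" for s
    using convexD_alt[of "{0..1::real}" t t' s] t that by (auto simp: algebra_simps)
  have "pathin euclideanreal ?\<phi>"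
    by (rule pathin_concat) (auto simp: pathin_def intro!: continuous_intros)
  then have "path_homotopic X (w \<circ> ?\<phi>) (w \<circ> (\<lambda>s. t' * s))"
    using w t ran
    by (intro path_homotopic_reparam)
       (auto simp: based_def pathin_def path_concat_def mult_le_one intro!: continuous_intros)
  moreover have "w \<circ> ?\<phi> = path_concat (initial w t) (\<lambda>s. w (t + (t' - t) * s))"
    by (auto simp: path_concat_def initial_def fun_eq_iff)
  ultimately show ?thesis by (simp add: initial_def o_def)
qed

text \<open>The explicit lift of \<open>w\<close>: at time \<open>t\<close> it is at the class of
  \<open>w\<close> run up to time \<open>t\<close>. For \<open>t'\<close> near \<open>t\<close> the
  class changes by a short stretch of \<open>w\<close>, which is the kind of prolongation that open
  sets absorb.\<close>

lemma pathin_lift: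
  assumes w: "based w" shows "pathin cover_top (\<lambda>t. cls (initial w t))"
  unfolding pathin_def continuous_map_def
proof (intro conjI allI impI)
  show "(\<lambda>t. cls (initial w t)) \<in> topspace (top_of_set {0..1}) \<rightarrow> topspace cover_top"
    using based_initial[OF w] cls_in_points by (auto simp: topspace_cover_top)
  fix S assume S: "openin cover_top S"
  show "openin (top_of_set {0..1}) {t \<in> topspace (top_of_set {0..1}). cls (initial w t) \<in> S}"
    unfolding openin_euclidean_subtopology_iff
  proof (intro conjI ballI)
    fix t assume "t \<in> {t \<in> topspace (top_of_set {0..1}). cls (initial w t) \<in> S}"
    then have t: "t \<in> {0..1}" "cls (initial w t) \<in> S" by auto
    note b = based_initial[OF w t(1)]
    have w1: "initial w t 1 = w t" by (simp add: initial_def)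
    obtain V where V: "openin X V" "w t \<in> V"
      "\<forall>u. pathin (subtopology X V) u \<longrightarrow> u 0 = w t \<longrightarrow> cls (path_concat (initial w t) u) \<in> S"
      using S b t(2) w1 unfolding openin_cover_top cover_open_def by metis
    have cw: "continuous_map (top_of_set {0..1}) X w" using w by (simp add: based_def pathin_def)
    obtain d where d: "d > 0" "\<forall>t'\<in>{0..1}. dist t' t < d \<longrightarrow> w t' \<in> V"
      using continuous_map_metric_nbhd[OF cw V(1) t(1) V(2)] by blast
    have "cls (initial w t') \<in> S" if t': "t' \<in> {0..1}" "dist t' t < d" for t'
    proof -
      let ?u = "\<lambda>s. w (t + (t' - t) * s)"
      have ran: "t + (t' - t) * s \<in> {0..1}" if "s \<in> {0..1}" for s
        using convexD_alt[of "{0..1::real}" t t' s] t(1) t'(1) that by (auto simp: algebra_simps)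
      have "pathin X (w \<circ> (\<lambda>s. t + (t' - t) * s))"
        using w ran by (intro pathin_reparam) (auto simp: based_def intro!: continuous_intros)
      then have uX: "pathin X ?u" by (simp add: o_def)
      have "?u s \<in> V" if s: "s \<in> {0..1}" for s
      proof -
        have "\<bar>(t' - t) * s\<bar> \<le> \<bar>t' - t\<bar>" using s by (simp add: abs_mult mult_left_le)
        then have "dist (t + (t' - t) * s) t < d" using t'(2) by (simp add: dist_real_def)
        then show ?thesis using d(2) ran[OF s] by blast
      qed
      then have "pathin (subtopology X V) ?u" using uX by (simp add: pathin_subtopology)
      then have "cls (path_concat (initial w t) ?u) \<in> S" using V(3) by simp
      moreover have "eqv (path_concat (initial w t) ?u) (initial w t')"
        using initial_extend[OF w t(1) t'(1)] based_concat[OF b uX] w1 by (intro eqv_if_homotopic) auto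
      ultimately show ?thesis
        using cls_eq_iff[OF based_concat[OF b uX] based_initial[OF w t'(1)]] w1 by simp
    qed
    then show "\<exists>e>0. \<forall>x'\<in>{0..1}. dist x' t < e \<longrightarrow> x' \<in> {t \<in> topspace (top_of_set {0..1}). cls (initial w t) \<in> S}"
      using d(1) by auto
  qed auto
qed

definition subgroup_cover :: "'a path_cover" where
  "subgroup_cover = \<lparr>total_space = cover_top, base_point = cls (\<lambda>_. x0), proj = prj\<rparr>"

lemma lift_ends:
  assumes "based w"
  shows "cls (initial w 0) = cls (\<lambda>_. x0)" "cls (initial w 1) = cls w"
  using assms by (auto simp: initial_def based_def)

lemma pc_cover_subgroup_cover: "pc_cover X x0 subgroup_cover"
proof -
  have "path_connected_space cover_top"
    unfolding path_connected_space_def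
  proof (intro ballI)
    fix e e' assume "e \<in> topspace cover_top" "e' \<in> topspace cover_top"
    then obtain w w' where w: "based w" "e = cls w" "based w'" "e' = cls w'"
      by (auto simp: topspace_cover_top points_def)
    let ?g = "path_concat (path_rev (\<lambda>t. cls (initial w t))) (\<lambda>t. cls (initial w' t))"
    have "pathin cover_top ?g"
      using pathin_lift w lift_ends by (intro pathin_concat pathin_rev) auto
    moreover have "?g 0 = e" "?g 1 = e'" using lift_ends w by simp_all
    ultimately show "\<exists>g. pathin cover_top g \<and> g 0 = e \<and> g 1 = e'" by blast
  qed
  then show ?thesis
    using covering_prj cls_in_points[OF based_const] prj_cls[OF based_const]
    by (simp add: pc_cover_def subgroup_cover_def topspace_cover_top)
qed

lemma prj_lift: "\<lbrakk>based w; t \<in> {0..1}\<rbrakk> \<Longrightarrow> prj (cls (initial w t)) = w t"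
  using prj_cls[OF based_initial] by (simp add: initial_def)

lemma cls_loop_iff:
  assumes w: "loop_at X x0 w"
  shows "cls w = cls (\<lambda>_. x0) \<longleftrightarrow> L w"
proof -
  have b: "based w" using w by (simp add: loop_at_def based_def)
  have *: "path_homotopic X (path_concat l (\<lambda>_. x0)) l" if "L l" for l
    using path_homotopic_const_right[of X l] loopD[OF that] by simp
  have "eqv (\<lambda>_. x0) w \<longleftrightarrow> L w"
  proof
    assume "eqv (\<lambda>_. x0) w"
    then obtain l where l: "L l" "path_homotopic X w (path_concat l (\<lambda>_. x0))" by (auto simp: eqv_def)
    then have "path_homotopic X l w" using path_homotopic_trans[OF l(2) *[OF l(1)]] path_homotopic_sym by blast
    then show "L w" using homotopic l(1) by blast
  next
    assume "L w"
    then show "eqv (\<lambda>_. x0) w" using path_homotopic_sym[OF *] unfolding eqv_def by blast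
  qed
  then show ?thesis using cls_eq_iff[OF based_const b] by auto
qed

text \<open>The explicit lift of a loop \<open>w\<close> ends at \<open>cls w\<close>, so it is
  closed exactly when \<open>L w\<close> holds. For the converse inclusion, monodromy compares it
  with any loop of the cover whose projection is homotopic to \<open>w\<close>.\<close>

lemma cover_subgroup_subgroup_cover:
  "cover_subgroup X x0 subgroup_cover = {loop_class X x0 l | l. L l}"
proof -
  note C = pc_cover_subgroup_cover
  have sel: "total_space subgroup_cover = cover_top" "base_point subgroup_cover = cls (\<lambda>_. x0)" "proj subgroup_cover = prj"
    by (simp_all add: subgroup_cover_def)
  have key: "loop_class X x0 w \<in> cover_subgroup X x0 subgroup_cover \<longleftrightarrow> L w" if w: "loop_at X x0 w" for w
  proof -
    have b: "based w" using w by (simp add: loop_at_def based_def)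
    let ?k = "\<lambda>t. cls (initial w t)"
    show ?thesis
    proof
      assume "L w"
      then have "?k 1 = cls (\<lambda>_. x0)" using cls_loop_iff[OF w] lift_ends[OF b] by simp
      then have "loop_at cover_top (cls (\<lambda>_. x0)) ?k"
        using pathin_lift[OF b] lift_ends[OF b] by (simp add: loop_at_def)
      moreover have "path_homotopic X w (prj \<circ> ?k)"
        using b by (intro path_homotopic_cong) (auto simp: based_def prj_lift[OF b])
      ultimately show "loop_class X x0 w \<in> cover_subgroup X x0 subgroup_cover"
        unfolding loop_class_in_cover_subgroup[OF C w] sel by blast
    next
      assume "loop_class X x0 w \<in> cover_subgroup X x0 subgroup_cover"
      then obtain k where k: "loop_at cover_top (cls (\<lambda>_. x0)) k" "path_homotopic X w (prj \<circ> k)"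
        unfolding loop_class_in_cover_subgroup[OF C w] sel by blast
      have kp: "pathin cover_top k" "k 0 = cls (\<lambda>_. x0)" "k 1 = cls (\<lambda>_. x0)" using k(1) by (auto simp: loop_at_def)
      have "path_homotopic X (prj \<circ> ?k) w"
        using b by (intro path_homotopic_sym[OF path_homotopic_cong]) (auto simp: based_def prj_lift[OF b])
      then have "path_homotopic X (prj \<circ> ?k) (prj \<circ> k)" using k(2) path_homotopic_trans by blast
      then have "?k 1 = k 1"
        using monodromy[OF covering_prj pathin_lift[OF b] kp(1)] lift_ends[OF b] kp(2) by simp
      then show "L w" using lift_ends[OF b] kp(3) cls_loop_iff[OF w] by simp
    qed
  qed
  show ?thesis
  proof (intro equalityI subsetI)
    fix a assume a: "a \<in> cover_subgroup X x0 subgroup_cover"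
    then have "a \<in> carrier (fundamental_group X x0)" using cover_subgroup_subset[OF C] by blast
    then obtain w where "loop_at X x0 w" "a = loop_class X x0 w" by (auto simp: carrier_fundamental_group)
    then show "a \<in> {loop_class X x0 l | l. L l}" using key[of w] a by auto
  next
    fix a assume "a \<in> {loop_class X x0 l | l. L l}"
    then obtain l where "L l" "a = loop_class X x0 l" by blast
    then show "a \<in> cover_subgroup X x0 subgroup_cover" using key[OF loop[of l]] by simp
  qed
qed

end

lemma ex_cover_with_subgroup:
  assumes X: "neighbourhood_base_of (simple_open X) X" "path_connected_space X" "x0 \<in> topspace X"
    and G: "group (fundamental_group X x0)" and H: "subgroup H (fundamental_group X x0)"
  shows "\<exists>C :: 'a path_cover. pc_cover X x0 C \<and> cover_subgroup X x0 C = H"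
proof -
  let ?G = "fundamental_group X x0"
  interpret G: group ?G by (rule G)
  define L where "L l \<longleftrightarrow> loop_at X x0 l \<and> loop_class X x0 l \<in> H" for l
  interpret loop_group X x0 L
  proof
    show "L (\<lambda>_. x0)" using subgroup.one_closed[OF H] loop_at_const[OF X(3)] by (simp add: L_def one_fundamental_group)
    show "L (path_concat l l')" if "L l" "L l'" for l l'
      using that subgroup.m_closed[OF H, of "loop_class X x0 l" "loop_class X x0 l'"]
      by (simp add: L_def loop_at_concat mult_fundamental_group)
    show "L (path_rev l)" if "L l" for l
    proof -
      have l: "loop_at X x0 l" "loop_class X x0 l \<in> H" using that by (auto simp: L_def)
      note r = loop_at_rev[OF l(1)]
      have lp: "pathin X l" "l 0 = x0" "l 1 = x0" using l by (auto simp: loop_at_def)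
      have "path_homotopic X (path_concat (path_rev l) l) (\<lambda>_. x0)"
        using path_homotopic_rev_left[OF lp(1)] lp by simp
      then have "loop_class X x0 (path_concat (path_rev l) l) = \<one>\<^bsub>?G\<^esub>"
        unfolding one_fundamental_group
        by (subst loop_class_eq_iff[OF loop_at_concat[OF r l(1)] loop_at_const[OF X(3)]])
      then have "loop_class X x0 (path_rev l) \<otimes>\<^bsub>?G\<^esub> loop_class X x0 l = \<one>\<^bsub>?G\<^esub>"
        by (simp add: mult_fundamental_group[OF r l(1)])
      then have "inv\<^bsub>?G\<^esub> loop_class X x0 l = loop_class X x0 (path_rev l)"
        using l(1) r by (intro G.inv_equality) (auto simp: carrier_fundamental_group)
      then show ?thesis using subgroup.m_inv_closed[OF H l(2)] r by (simp add: L_def)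
    qed
    show "L l'" if "L l" "path_homotopic X l l'" for l l'
    proof -
      have l: "loop_at X x0 l" "loop_class X x0 l \<in> H" using that by (auto simp: L_def)
      have l': "loop_at X x0 l'" by (rule loop_at_if_homotopic[OF l(1) that(2)])
      then show ?thesis using loop_class_eq_iff[OF l(1) l'] that(2) l(2) by (simp add: L_def)
    qed
  qed (use X in \<open>auto simp: L_def\<close>)
  have "{loop_class X x0 l | l. L l} = H"
  proof (intro equalityI subsetI)
    fix a assume a: "a \<in> H"
    then have "a \<in> carrier ?G" using subgroup.subset[OF H] by blast
    then obtain w where "loop_at X x0 w" "a = loop_class X x0 w" by (auto simp: carrier_fundamental_group)
    then show "a \<in> {loop_class X x0 l | l. L l}" using a by (auto simp: L_def)
  qed (auto simp: L_def)
  then show ?thesis using pc_cover_subgroup_cover cover_subgroup_subgroup_cover by metis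
qed


section \<open>Local structure of manifolds\<close>

lemma ex_convex_open_subset_Euclidean_space:
  assumes B: "openin (Euclidean_space d) B" and z: "z \<in> B"
  obtains C where "openin (Euclidean_space d) C" "z \<in> C" "C \<subseteq> B"
    "\<And>y y' s. \<lbrakk>y \<in> C; y' \<in> C; s \<in> {0..1}\<rbrakk> \<Longrightarrow> (\<lambda>i. (1 - s) * y i + s * y' i) \<in> C"
proof -
  obtain T where T: "openin (powertop_real UNIV) T" "B = T \<inter> {x. \<forall>i\<ge>d. x i = 0}"
    using B unfolding Euclidean_space_def openin_subtopology by blast
  obtain W where W: "z \<in> (\<Pi>\<^sub>E i\<in>UNIV. W i)" "\<And>i. open (W i)" "finite {i. W i \<noteq> UNIV}" "(\<Pi>\<^sub>E i\<in>UNIV. W i) \<subseteq> T"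
    using product_topology_open_contains_basis[OF T(1), of z] z T(2) by auto
  have "\<exists>e>0. ball (z i) e \<subseteq> W i" for i
    using W(1,2) open_contains_ball by (fastforce simp: PiE_iff)
  then obtain e where e: "\<And>i. e i > 0" "\<And>i. ball (z i) (e i) \<subseteq> W i" by metis
  \<comment> \<open>Factors that are the whole line must be kept: proper intervals in infinitely
    many coordinates would not form an open box in the product topology.\<close>
  define J where "J i = (if W i = UNIV then UNIV else ball (z i) (e i))" for i
  have J: "open (J i)" "convex (J i)" "z i \<in> J i" "J i \<subseteq> W i" for i
    using e by (auto simp: J_def)
  let ?C = "(\<Pi>\<^sub>E i\<in>UNIV. J i) \<inter> {x. \<forall>i\<ge>d. x i = 0}"
  have "finite {i. J i \<noteq> UNIV}" by (rule finite_subset[OF _ W(3)]) (auto simp: J_def)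
  then have "openin (powertop_real UNIV) (\<Pi>\<^sub>E i\<in>UNIV. J i)"
    using J(1) by (intro product_topology_basis) auto
  then have "openin (Euclidean_space d) ?C"
    unfolding Euclidean_space_def openin_subtopology by blast
  moreover have "z \<in> ?C" using J(3) z T(2) by (auto simp: PiE_iff)
  moreover have "?C \<subseteq> B"
  proof
    fix x assume x: "x \<in> ?C"
    then have "x \<in> (\<Pi>\<^sub>E i\<in>UNIV. W i)" using J(4) by (auto simp: PiE_iff)
    then show "x \<in> B" using x W(4) T(2) by blast
  qed
  moreover have "(\<lambda>i. (1 - s) * y i + s * y' i) \<in> ?C" if y: "y \<in> ?C" "y' \<in> ?C" and s: "s \<in> {0..1}" for y y' s
  proof -
    have "(1 - s) * y i + s * y' i \<in> J i" for i
    proof -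
      have "y i \<in> J i" "y' i \<in> J i" using y by (auto simp: PiE_iff)
      then show ?thesis using convexD_alt[OF J(2), of "y i" i "y' i" s] s by simp
    qed
    then show ?thesis using y by (auto simp: PiE_iff)
  qed
  ultimately show ?thesis using that by blast
qed

text \<open>\<open>V\<close> corresponds to a convex open set in the chart. Segments there give
  connecting paths, and straight-line interpolation in the chart gives homotopies with fixed
  ends.\<close>

lemma simple_open_chart:
  assumes chart: "is_chart d X (U, \<phi>)" and W: "openin X W" and x: "x \<in> U" "x \<in> W"
  shows "\<exists>V. simple_open X V \<and> x \<in> V \<and> V \<subseteq> W"
proof -
  let ?E = "Euclidean_space d" and ?I = "top_of_set {0..1::real}"
  have U: "openin X U" and imU: "openin ?E (\<phi> ` U)"
    and hom: "homeomorphic_map (subtopology X U) (subtopology ?E (\<phi> ` U)) \<phi>"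
    using chart by (auto simp: is_chart_def)
  have topU: "topspace (subtopology X U) = U" using openin_subset[OF U] by auto
  have topI: "topspace (subtopology ?E (\<phi> ` U)) = \<phi> ` U" using openin_subset[OF imU] by auto
  obtain \<psi> where "homeomorphic_maps (subtopology X U) (subtopology ?E (\<phi> ` U)) \<phi> \<psi>"
    using hom homeomorphic_map_maps by blast
  then have \<phi>: "continuous_map (subtopology X U) (subtopology ?E (\<phi> ` U)) \<phi>"
    and \<psi>: "continuous_map (subtopology ?E (\<phi> ` U)) (subtopology X U) \<psi>"
    and \<psi>\<phi>: "\<And>y. y \<in> U \<Longrightarrow> \<psi> (\<phi> y) = y" and \<phi>\<psi>: "\<And>z. z \<in> \<phi> ` U \<Longrightarrow> \<phi> (\<psi> z) = z"
    using topU topI by (auto simp: homeomorphic_maps_def)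
  have "openin (subtopology X U) (U \<inter> W)" using W by (auto simp: openin_subtopology)
  then have "openin (subtopology ?E (\<phi> ` U)) (\<phi> ` (U \<inter> W))"
    using homeomorphic_map_openness[OF hom, of "U \<inter> W"] topU by auto
  then have "openin ?E (\<phi> ` (U \<inter> W))" using openin_trans_full imU by blast
  then obtain C where C: "openin ?E C" "\<phi> x \<in> C" "C \<subseteq> \<phi> ` (U \<inter> W)"
    and conv: "\<And>y y' s. \<lbrakk>y \<in> C; y' \<in> C; s \<in> {0..1}\<rbrakk> \<Longrightarrow> (\<lambda>i. (1 - s) * y i + s * y' i) \<in> C"
    using ex_convex_open_subset_Euclidean_space[of d "\<phi> ` (U \<inter> W)" "\<phi> x"] x by blast
  have CE: "C \<subseteq> topspace ?E" using openin_subset[OF C(1)] .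
  have CU: "C \<subseteq> \<phi> ` U" using C(3) by blast
  define V where "V = {y \<in> U. \<phi> y \<in> C}"
  have "openin (subtopology ?E (\<phi> ` U)) C" using C(1) CU imU by (simp add: openin_open_subtopology)
  then have "openin (subtopology X U) V"
    using openin_continuous_map_preimage[OF \<phi>] topU unfolding V_def by fastforce
  then have oV: "openin X V" using openin_trans_full U by blast
  have VW: "V \<subseteq> W"
  proof
    fix y assume y: "y \<in> V"
    then obtain y' where "y' \<in> U" "y' \<in> W" "\<phi> y = \<phi> y'" using C(3) by (auto simp: V_def)
    then show "y \<in> W" using \<psi>\<phi>[of y] \<psi>\<phi>[of y'] y by (simp add: V_def)
  qed
  have \<psi>V: "\<psi> z \<in> V" if z: "z \<in> C" for z
  proof -
    have zU: "z \<in> \<phi> ` U" using z CU by blast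
    then have "\<psi> z \<in> U" using \<psi>\<phi> by auto
    then show ?thesis using \<phi>\<psi>[OF zU] z by (simp add: V_def)
  qed
  have cont\<psi>: "continuous_map Y X (\<lambda>a. \<psi> (k a))"
    if k: "continuous_map Y (powertop_real UNIV) k" and kC: "\<And>a. a \<in> topspace Y \<Longrightarrow> k a \<in> C" for Y :: "'b topology" and k
  proof -
    have "continuous_map Y (subtopology ?E (\<phi> ` U)) k"
      unfolding Euclidean_space_def continuous_map_in_subtopology subtopology_subtopology
      using k kC CU CE by (auto simp: topspace_Euclidean_space)
    then have "continuous_map Y (subtopology X U) (\<psi> \<circ> k)" using continuous_map_compose \<psi> by blast
    then show ?thesis by (simp add: continuous_map_in_subtopology o_def)
  qed
  have coord: "continuous_map Y euclideanreal (\<lambda>a. \<phi> (u a) i)"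
    if u: "continuous_map Y X u" and uV: "\<And>a. a \<in> topspace Y \<Longrightarrow> u a \<in> V" for Y :: "'b topology" and u i
  proof -
    have "continuous_map Y (subtopology X U) u" using u uV by (auto simp: continuous_map_in_subtopology V_def)
    then have "continuous_map Y (subtopology ?E (\<phi> ` U)) (\<phi> \<circ> u)" using continuous_map_compose \<phi> by blast
    then have "continuous_map Y (powertop_real UNIV) (\<phi> \<circ> u)"
      by (simp add: Euclidean_space_def continuous_map_in_subtopology)
    then show ?thesis by (auto simp: continuous_map_componentwise_UNIV)
  qed
  have "\<exists>u. pathin (subtopology X V) u \<and> u 0 = y \<and> u 1 = z" if y: "y \<in> V" and z: "z \<in> V" for y z
  proof -
    let ?k = "\<lambda>t i. (1 - t) * \<phi> y i + t * \<phi> z i"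
    have kC: "?k t \<in> C" if "t \<in> {0..1}" for t
      using conv[of "\<phi> y" "\<phi> z" t] y z that by (simp add: V_def)
    have "continuous_map ?I X (\<lambda>t. \<psi> (?k t))"
      using kC by (intro cont\<psi>) (auto simp: continuous_map_componentwise_UNIV intro!: continuous_intros)
    then have "pathin X (\<lambda>t. \<psi> (?k t))" by (simp only: pathin_def)
    then have "pathin (subtopology X V) (\<lambda>t. \<psi> (?k t))"
      using \<psi>V[OF kC] by (simp add: pathin_subtopology)
    moreover have "\<psi> (?k 0) = y" "\<psi> (?k 1) = z" using \<psi>\<phi> y z by (auto simp: V_def)
    ultimately show ?thesis by blast
  qed
  moreover have "path_homotopic X u v"
    if u: "pathin (subtopology X V) u" and v: "pathin (subtopology X V) v" and e: "u 0 = v 0" "u 1 = v 1" for u v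
  proof -
    have "pathin X u" "pathin X v"
      and uV: "\<And>t. t \<in> {0..1} \<Longrightarrow> u t \<in> V" and vV: "\<And>t. t \<in> {0..1} \<Longrightarrow> v t \<in> V"
      using u v by (auto simp: pathin_subtopology)
    then have cu: "continuous_map ?I X u" and cv: "continuous_map ?I X v" by (simp_all only: pathin_def)
    let ?Q = "prod_topology ?I ?I"
    let ?k = "\<lambda>z i. (1 - fst z) * \<phi> (u (snd z)) i + fst z * \<phi> (v (snd z)) i"
    have kC: "?k z \<in> C" if "z \<in> topspace ?Q" for z
      using conv[of "\<phi> (u (snd z))" "\<phi> (v (snd z))" "fst z"] uV[of "snd z"] vV[of "snd z"] that by (auto simp: V_def)
    have su: "continuous_map ?Q X (\<lambda>z. u (snd z))"
      by (rule continuous_map_compose[OF continuous_map_snd cu, unfolded o_def])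
    have sv: "continuous_map ?Q X (\<lambda>z. v (snd z))"
      by (rule continuous_map_compose[OF continuous_map_snd cv, unfolded o_def])
    have f: "continuous_map ?Q euclideanreal fst"
      using continuous_map_fst[of ?I ?I] by (simp add: continuous_map_in_subtopology)
    have "continuous_map ?Q euclideanreal (\<lambda>z. ?k z i)" for i
      using uV vV
      by (intro continuous_map_add continuous_map_real_mult continuous_map_diff f coord[OF su] coord[OF sv]) auto
    then have "continuous_map ?Q X (\<lambda>z. \<psi> (?k z))"
      using kC by (intro cont\<psi>) (auto simp: continuous_map_componentwise_UNIV)
    moreover have "\<psi> (?k (0, t)) = u t" "\<psi> (?k (1, t)) = v t" if "t \<in> {0..1}" for t
      using \<psi>\<phi> uV[OF that] vV[OF that] by (auto simp: V_def)
    moreover have "\<psi> (?k (s, 0)) = u 0" "\<psi> (?k (s, 1)) = u 1" for s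
    proof -
      have "?k (s, 0) = \<phi> (u 0)" "?k (s, 1) = \<phi> (u 1)" by (auto simp: e algebra_simps)
      then show "\<psi> (?k (s, 0)) = u 0" "\<psi> (?k (s, 1)) = u 1"
        using \<psi>\<phi> uV[of 0] uV[of 1] by (auto simp: V_def)
    qed
    ultimately show ?thesis
      unfolding path_homotopic_def
      \<comment> \<open>This form of homotopy asks for agreement with \<open>u\<close> and
        \<open>v\<close> on \<open>[0, 1]\<close> only; outside the interval passing to the chart
        and back need not return the value.\<close>
      by (subst homotopic_with) (auto intro!: exI[of _ "\<lambda>z. \<psi> (?k z)"])
  qed
  ultimately have "simple_open X V" using oV by (simp add: simple_open_def)
  moreover have "x \<in> V" using x C(2) by (simp add: V_def)
  ultimately show ?thesis using VW by blast
qed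

lemma smooth_manifold_simple_open_base:
  assumes "smooth_manifold d X \<A>"
  shows "neighbourhood_base_of (simple_open X) X"
proof -
  have "\<exists>V. simple_open X V \<and> x \<in> V \<and> V \<subseteq> W" if W: "openin X W" "x \<in> W" for W x
  proof -
    have "x \<in> topspace X" using openin_subset W by blast
    then obtain c where c: "c \<in> \<A>" "x \<in> fst c" "is_chart d X c"
      using assms unfolding smooth_manifold_def smooth_atlas_def by blast
    then show ?thesis using simple_open_chart[of d X "fst c" "snd c" W x] W by simp
  qed
  moreover have "\<forall>S. simple_open X S \<longrightarrow> openin X S" by (simp add: simple_open_def)
  ultimately show ?thesis using open_neighbourhood_base_of[of "simple_open X" X] by simp
qed

lemma connected_imp_path_connected:
  assumes X: "neighbourhood_base_of (simple_open X) X" and c: "connected_space X"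
  shows "path_connected_space X"
proof -
  have "path_connectedin X V" if V: "simple_open X V" for V
  proof -
    have "topspace (subtopology X V) = V" using V openin_subset[of X V] by (auto simp: simple_open_def)
    then show ?thesis
      using V openin_subset[of X V] unfolding path_connectedin_def path_connected_space_def simple_open_def by simp
  qed
  then have "locally_path_connected_space X"
    using X unfolding locally_path_connected_space_def by (rule neighbourhood_base_of_mono[rotated])
  then show ?thesis using c path_connected_eq_connected_space by blast
qed


section \<open>Counting covers\<close>

locale p_group_covers = p_group "fundamental_group X x0" p m
  for X :: "'a topology" and x0 :: 'a and p m :: nat +
  assumes simple_base: "neighbourhood_base_of (simple_open X) X"
    and path_conn: "path_connected_space X"
    and x0_in: "x0 \<in> topspace X"
begin

abbreviation "\<pi> \<equiv> fundamental_group X x0"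

lemma subgroup_cover_subgroup: "pc_cover X x0 C \<Longrightarrow> subgroup (cover_subgroup X x0 C) \<pi>"
  by (intro finite_submonoid_is_subgroup[OF fin] cover_subgroup_subset one_in_cover_subgroup
      cover_subgroup_mult_closed)

lemma ex_path_cover:
  assumes "subgroup H \<pi>"
  obtains C :: "'a path_cover" where "pc_cover X x0 C" "cover_subgroup X x0 C = H"
  using ex_cover_with_subgroup[OF simple_base path_conn x0_in is_group assms] by blast

lemmas covers_iff = covers_iff_subgroup_le[OF simple_base]

text \<open>The converse depends on a Frattini cover existing on the type of path classes, which
  \<open>ex_path_cover\<close> provides.\<close>

lemma below_frattini_iff:
  assumes C: "pc_cover X x0 C"
  shows "below_frattini X x0 C \<longleftrightarrow> frattini \<pi> \<subseteq> cover_subgroup X x0 C"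
proof
  assume "below_frattini X x0 C"
  then obtain F :: "'a path_cover" where F: "frattini_cover X x0 F" "F \<succ> C"
    unfolding below_frattini_def by blast
  then show "frattini \<pi> \<subseteq> cover_subgroup X x0 C"
    using covers_iff[of x0 F C] C unfolding frattini_cover_def by simp
next
  assume le: "frattini \<pi> \<subseteq> cover_subgroup X x0 C"
  obtain F :: "'a path_cover" where F: "pc_cover X x0 F" "cover_subgroup X x0 F = frattini \<pi>"
    using ex_path_cover[OF subgroup_F] .
  then have "F \<succ> C" using covers_iff[OF F(1) C] le by simp
  then show "below_frattini X x0 C" using F unfolding below_frattini_def frattini_cover_def by blast
qed

text \<open>An isomorphism class is a fibre of \<open>cover_subgroup\<close>. Every subgroup has a
  nonempty fibre, so fibres correspond one to one to subgroups, and a property that depends only on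
  the subgroup may be counted there.\<close>

lemma num_cover_classes_eq:
  assumes P: "\<And>C. pc_cover X x0 C \<Longrightarrow> P C \<longleftrightarrow> R (cover_subgroup X x0 C)"
  shows "num_cover_classes X x0 P = card {H. subgroup H \<pi> \<and> R H}"
proof -
  let ?K = "\<lambda>H. {C :: 'a path_cover. pc_cover X x0 C \<and> cover_subgroup X x0 C = H}"
  have cls: "cover_iso_rel X x0 `` {C} = ?K (cover_subgroup X x0 C)" if C: "pc_cover X x0 C" for C
    using C cover_iso_iff_subgroup_eq[OF simple_base C] by (auto simp: cover_iso_rel_def)
  have "{C. pc_cover X x0 C \<and> P C} // cover_iso_rel X x0 = ?K ` {H. subgroup H \<pi> \<and> R H}"
  proof (intro equalityI subsetI)
    fix A assume "A \<in> {C. pc_cover X x0 C \<and> P C} // cover_iso_rel X x0"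
    then obtain C where C: "pc_cover X x0 C" "P C" "A = cover_iso_rel X x0 `` {C}"
      by (auto simp: quotient_def)
    then have "subgroup (cover_subgroup X x0 C) \<pi>" "R (cover_subgroup X x0 C)"
      using subgroup_cover_subgroup P by auto
    then show "A \<in> ?K ` {H. subgroup H \<pi> \<and> R H}" using cls[OF C(1)] C(3) by blast
  next
    fix A assume "A \<in> ?K ` {H. subgroup H \<pi> \<and> R H}"
    then obtain H where H: "subgroup H \<pi>" "R H" "A = ?K H" by blast
    obtain C :: "'a path_cover" where C: "pc_cover X x0 C" "cover_subgroup X x0 C = H"
      using ex_path_cover[OF H(1)] .
    then have "P C" using P H by simp
    moreover have "A = cover_iso_rel X x0 `` {C}" using cls[OF C(1)] C(2) H(3) by simp
    ultimately show "A \<in> {C. pc_cover X x0 C \<and> P C} // cover_iso_rel X x0"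
      using C(1) by (auto simp: quotient_def)
  qed
  moreover have "inj_on ?K {H. subgroup H \<pi> \<and> R H}"
  proof (rule inj_onI)
    fix H H' assume H: "H \<in> {H. subgroup H \<pi> \<and> R H}" and eq: "?K H = ?K H'"
    obtain C :: "'a path_cover" where C: "pc_cover X x0 C" "cover_subgroup X x0 C = H"
      using ex_path_cover[of H] H by blast
    then have "C \<in> ?K H'" using eq by blast
    then show "H = H'" using C by simp
  qed
  ultimately show ?thesis unfolding num_cover_classes_def by (simp add: card_image)
qed

text \<open>The universal property is tested on a cover of the intersection of the two subgroups: it
  lies above both factors, hence above the join, which gives the inclusion that is not
  immediate.\<close>

lemma is_join_iff:
  fixes C1 C2 C :: "'a path_cover"
  assumes C1: "pc_cover X x0 C1" and C2: "pc_cover X x0 C2"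
  shows "is_join X x0 C1 C2 C \<longleftrightarrow>
    pc_cover X x0 C \<and> cover_subgroup X x0 C = cover_subgroup X x0 C1 \<inter> cover_subgroup X x0 C2"
proof
  assume J: "is_join X x0 C1 C2 C"
  then have C: "pc_cover X x0 C" "C \<succ> C1" "C \<succ> C2"
    and least: "\<And>C' :: 'a path_cover. pc_cover X x0 C' \<Longrightarrow> C' \<succ> C1 \<Longrightarrow> C' \<succ> C2 \<Longrightarrow> C' \<succ> C"
    by (auto simp: is_join_def)
  have "subgroup (cover_subgroup X x0 C1 \<inter> cover_subgroup X x0 C2) \<pi>"
    using subgroup_cover_subgroup C1 C2 subgroups_Inter_pair by blast
  then obtain E :: "'a path_cover" where E: "pc_cover X x0 E"
    "cover_subgroup X x0 E = cover_subgroup X x0 C1 \<inter> cover_subgroup X x0 C2"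
    using ex_path_cover by blast
  have "E \<succ> C" using least[OF E(1)] covers_iff[OF E(1) C1] covers_iff[OF E(1) C2] E(2) by simp
  then show "pc_cover X x0 C \<and> cover_subgroup X x0 C = cover_subgroup X x0 C1 \<inter> cover_subgroup X x0 C2"
    using C covers_iff[OF E(1) C(1)] covers_iff[OF C(1) C1] covers_iff[OF C(1) C2] E(2) by auto
next
  assume C: "pc_cover X x0 C \<and> cover_subgroup X x0 C = cover_subgroup X x0 C1 \<inter> cover_subgroup X x0 C2"
  then have C': "pc_cover X x0 C" by simp
  show "is_join X x0 C1 C2 C"
    unfolding is_join_def
  proof (intro conjI allI impI)
    fix E :: "'a path_cover" assume E: "pc_cover X x0 E \<and> E \<succ> C1 \<and> E \<succ> C2"
    then have E': "pc_cover X x0 E" by simp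
    show "E \<succ> C" using E C covers_iff[OF E' C'] covers_iff[OF E' C1] covers_iff[OF E' C2] by simp
  qed (use C covers_iff[OF C' C1] covers_iff[OF C' C2] in auto)
qed

lemma is_join_list_iff:
  fixes C :: "'a path_cover"
  assumes "\<forall>D\<in>set Ds. pc_cover X x0 D"
  shows "is_join_list X x0 Ds C \<longleftrightarrow>
    pc_cover X x0 C \<and> cover_subgroup X x0 C = foldr (\<inter>) (map (cover_subgroup X x0) Ds) (carrier \<pi>)"
  using assms
proof (induction Ds arbitrary: C)
  case Nil
  have "is_join_list X x0 [] C \<longleftrightarrow> pc_cover X x0 C \<and> cover_iso C (trivial_cover X x0)" by simp
  also have "\<dots> \<longleftrightarrow> pc_cover X x0 C \<and> cover_subgroup X x0 C = carrier \<pi>"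
    using cover_iso_iff_subgroup_eq[OF simple_base _ trivial_cover(1)[OF x0_in path_conn]]
      trivial_cover(2)[OF x0_in path_conn] by metis
  finally show ?case by simp
next
  case (Cons D Ds)
  let ?J = "foldr (\<inter>) (map (cover_subgroup X x0) Ds) (carrier \<pi>)"
  have D: "pc_cover X x0 D" using Cons.prems by simp
  have IH: "is_join_list X x0 Ds C' \<longleftrightarrow> pc_cover X x0 C' \<and> cover_subgroup X x0 C' = ?J" for C'
    using Cons by simp
  \<comment> \<open>The intermediate join in \<open>is_join_list\<close> is existentially quantified
    over covers, so the partial intersection must be realised by one.\<close>
  have "subgroup ?J \<pi>"
    using Cons.prems subgroup_cover_subgroup by (intro subgroup_Int_list) auto
  then obtain E :: "'a path_cover" where E: "pc_cover X x0 E" "cover_subgroup X x0 E = ?J"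
    using ex_path_cover by blast
  have "is_join_list X x0 (D # Ds) C \<longleftrightarrow>
      (\<exists>C'. (pc_cover X x0 C' \<and> cover_subgroup X x0 C' = ?J) \<and> is_join X x0 D C' C)"
    by (simp add: IH)
  also have "\<dots> \<longleftrightarrow> pc_cover X x0 C \<and> cover_subgroup X x0 C = cover_subgroup X x0 D \<inter> ?J"
    using is_join_iff[OF D] E by metis
  finally show ?case by simp
qed

lemma join_of_minimal_iff:
  fixes C :: "'a path_cover"
  assumes C: "pc_cover X x0 C"
  shows "join_of_minimal X x0 C k \<longleftrightarrow> Int_of_maximals \<pi> (cover_subgroup X x0 C) k"
proof
  assume "join_of_minimal X x0 C k"
  then obtain Ds where Ds: "length Ds = k" "\<forall>D\<in>set Ds. minimal_cover X x0 D" "is_join_list X x0 Ds C"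
    unfolding join_of_minimal_def by blast
  then have "cover_subgroup X x0 C = foldr (\<inter>) (map (cover_subgroup X x0) Ds) (carrier \<pi>)"
    using is_join_list_iff[of Ds C] by (simp add: minimal_cover_def)
  then show "Int_of_maximals \<pi> (cover_subgroup X x0 C) k"
    unfolding Int_of_maximals_def using Ds
    by (intro exI[of _ "map (cover_subgroup X x0) Ds"]) (simp add: minimal_cover_def)
next
  assume "Int_of_maximals \<pi> (cover_subgroup X x0 C) k"
  then obtain Ms where Ms: "length Ms = k" "\<forall>M\<in>set Ms. maximal_subgroup M \<pi>"
    "foldr (\<inter>) Ms (carrier \<pi>) = cover_subgroup X x0 C"
    unfolding Int_of_maximals_def by blast
  define c where "c M = (SOME D :: 'a path_cover. pc_cover X x0 D \<and> cover_subgroup X x0 D = M)" for M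
  have c: "pc_cover X x0 (c M) \<and> cover_subgroup X x0 (c M) = M" if M: "M \<in> set Ms" for M
  proof -
    have "subgroup M \<pi>" using Ms(2) M by (simp add: maximal_subgroup_def)
    then have "\<exists>D :: 'a path_cover. pc_cover X x0 D \<and> cover_subgroup X x0 D = M"
      using ex_path_cover by metis
    then show ?thesis unfolding c_def by (rule someI_ex)
  qed
  have "map (cover_subgroup X x0) (map c Ms) = Ms"
    using c by (simp add: map_idI)
  then have "is_join_list X x0 (map c Ms) C"
    using is_join_list_iff[of "map c Ms" C] c C Ms(3) by simp
  moreover have "\<forall>D\<in>set (map c Ms). minimal_cover X x0 D"
    using c Ms(2) by (simp add: minimal_cover_def)
  ultimately show "join_of_minimal X x0 C k"
    unfolding join_of_minimal_def using Ms(1) by (intro exI[of _ "map c Ms"]) simp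
qed

section \<open>The three counts\<close>

lemma num_below_frattini:
  "real (num_cover_classes X x0 (below_frattini X x0)) = gauss_sum p (group_rank \<pi>)"
  using num_cover_classes_eq[of "below_frattini X x0" "\<lambda>H. frattini \<pi> \<subseteq> H"] below_frattini_iff
    card_all_supergroups[OF order_eq] by simp

lemma num_join_number:
  assumes k: "k \<le> group_rank \<pi>"
  shows "real (num_cover_classes X x0
      (\<lambda>C. below_frattini X x0 C \<and> has_join_number X x0 C (group_rank \<pi> - k))) = gauss_binomial p (group_rank \<pi>) k"
proof -
  have "num_cover_classes X x0 (\<lambda>C. below_frattini X x0 C \<and> has_join_number X x0 C (group_rank \<pi> - k))
      = card {H. subgroup H \<pi> \<and> frattini \<pi> \<subseteq> H \<and> Int_of_maximals \<pi> H (group_rank \<pi> - k) \<and>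
          (\<forall>i<group_rank \<pi> - k. \<not> Int_of_maximals \<pi> H i)}"
    by (rule num_cover_classes_eq) (simp add: below_frattini_iff has_join_number_def join_of_minimal_iff)
  then show ?thesis
    unfolding supergroups_Int_number_eq[OF k] using card_supergroups[OF order_eq k] by simp
qed

lemma num_quotient_rank:
  assumes k: "k \<le> group_rank \<pi>"
  shows "real (num_cover_classes X x0
      (\<lambda>C. below_frattini X x0 C \<and>
        group_rank (\<pi>\<lparr>carrier := cover_subgroup X x0 C\<rparr> Mod frattini \<pi>) = k)) = gauss_binomial p (group_rank \<pi>) k"
proof -
  have "num_cover_classes X x0 (\<lambda>C. below_frattini X x0 C \<and>
        group_rank (\<pi>\<lparr>carrier := cover_subgroup X x0 C\<rparr> Mod frattini \<pi>) = k)
      = card {H. subgroup H \<pi> \<and> frattini \<pi> \<subseteq> H \<and> group_rank (\<pi>\<lparr>carrier := H\<rparr> Mod frattini \<pi>) = k}"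
    by (rule num_cover_classes_eq) (simp add: below_frattini_iff)
  then show ?thesis
    unfolding supergroups_group_rank_eq using card_supergroups[OF order_eq k] by simp
qed

end

theorem theorem5p1:
  fixes p n d :: nat
    and X :: "'a topology" and x0 :: 'a and \<A> :: "'a chart set"
  assumes "prime p"
    and "smooth_manifold d X \<A>" and "compact_space X" and "connected_space X"
    and "x0 \<in> topspace X"
    and "finite_p_group p (fundamental_group X x0)"
    and "group_rank (fundamental_group X x0) = n"
  shows "real (num_cover_classes X x0 (below_frattini X x0)) = gauss_sum p n \<and>
         (\<forall>k\<le>n. real (num_cover_classes X x0
              (\<lambda>C. below_frattini X x0 C \<and> has_join_number X x0 C (n - k)))
            = gauss_binomial p n k) \<and>
         (\<forall>k\<le>n. real (num_cover_classes X x0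
              (\<lambda>C. below_frattini X x0 C \<and>
                   group_rank (fundamental_group X x0 \<lparr>carrier := cover_subgroup X x0 C\<rparr>
                               Mod frattini (fundamental_group X x0)) = k))
            = gauss_binomial p n k)"
proof -
  have base: "neighbourhood_base_of (simple_open X) X"
    using smooth_manifold_simple_open_base[OF assms(2)] .
  obtain m where m: "group (fundamental_group X x0)" "finite (carrier (fundamental_group X x0))"
    "order (fundamental_group X x0) = p ^ m"
    using assms(6) unfolding finite_p_group_def by blast
  interpret p_group_covers X x0 p m
    using m assms(1,5) base connected_imp_path_connected[OF base assms(4)]
    by (intro p_group_covers.intro p_group.intro p_group_axioms.intro
        p_group_covers_axioms.intro) auto
  show ?thesis
    using num_below_frattini num_join_number num_quotient_rank assms(7) by simp
qed

end
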